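(* Let $E$ be a finite set, let $\nu$ be a shift-invariant probability law on $E^{\mathbb Z}$, let $\varrho$ be a probability law on $\mathbb N$, and let $\mathrm P$, $Y$, $R_n$ be the associated joint law, word sequence and empirical distribution of words (see context). If $\nu$ has summable variation, then the family of probability laws $\mathrm P(R_n\in\cdot\,)$, $n\in\mathbb N$, satisfies the large deviation principle on $\mathcal P^{\rm inv}(\tilde E^{\mathbb Z})$ with rate $n$ and with rate function $I^{\rm ann}\colon \mathcal P^{\rm inv}(\tilde E^{\mathbb Z})\to[0,\infty]$ given by the specific relative entropy $$I^{\rm ann}(Q)=H(Q\mid \mathrm P).$$ Moreover, $I^{\rm ann}$ is lower semi-continuous, has compact level sets, is affine, and has a unique zero at $Q=\mathrm P$.
   Context: $\mathbb N=\{1,2,\dots\}$, $\mathbb N_0=\mathbb N\cup\{0\}$. $E$ (the letters) carries the discrete topology; $\tilde E=\bigcup_{\ell\in\mathbb N}E^\ell$ is the set of finite words, also with the discrete topology; $|y|$ is the length of a word $y$. $E^{\mathbb Z}$ and $\tilde E^{\mathbb Z}$ carry the product topology, with left-shifts $\theta$ and $\tilde\theta$. $\mathcal P^{\rm inv}(\tilde E^{\mathbb Z})$ is the set of $\tilde\theta$-invariant probability laws on $\tilde E^{\mathbb Z}$, with the topology of weak convergence. Random letters and words: $X=(X_k)_{k\in\mathbb Z}$ has law $\nu$; $\tau=(\tau_i)_{i\in\mathbb Z}$ is i.i.d. with law $\varrho$, independent of $X$; $T_0=0$ and $T_i=T_{i-1}+\tau_i$ for $i\in\mathbb Z$. The words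 are $Y_i=(X_{T_{i-1}+1},\dots,X_{T_i})$, $i\in\mathbb Z$, and $Y=(Y_i)_{i\in\mathbb Z}$. The joint law of $X$ and $\tau$ is denoted $\mathrm P$; the induced law of $Y$ on $\tilde E^{\mathbb Z}$ is also denoted $\mathrm P$. The empirical distribution of words is $$R_n=\frac1n\sum_{i=0}^{n-1}\delta_{\tilde\theta^i (Y_{(0,n]})^{\rm per}},$$ where $(Y_{(0,n]})^{\rm per}\in\tilde E^{\mathbb Z}$ is the $n$-periodic sequence that coincides with $Y_1,\dots,Y_n$ at the indices $1,\dots,n$. Summable variation: let $(\nu_{x^-}(\cdot);x^-\in E^{-\mathbb N_0})$ be a regular version of the conditional law $\nu(\cdot\mid X_{(-\infty,0]})$ of $X_{(0,\infty)}$. For $n\in\mathbb N_0$ put $$\phi(n)=\sup_{x^-,\hat x^-}\ \sup_{A\in\sigma(X_1):\,\nu_{x^-}(A)>0}\big|\log\nu_{x^-}(A)-\log\nu_{\hat x^-}(A)\big|,$$ where the first supremum is over all $x^-,\hat x^-\in E^{-\mathbb N_0}$ that agree on the coordinates in $(-n,0]\cap\mathbb Z$ (no restriction if $n=0$), and $\log 0=-\infty$. The law $\nu$ has summable variation if $\sum_{n\in\mathbb N_0}\phi(n)<\infty$ (for a suitable fixed regular version). Specific relative entropy: for shift-invariant laws $\lambda,\mu$ on $F^{\mathbb Z}$, $H(\lambda\mid\mu)=\lim_{n\to\infty}\frac1n h(\lambda|_n\mid\mu|_n)$, where $\lambda|_n,\mu|_n$ are the laws of $n$ consecutive coordinates and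 $h(\cdot\mid\cdot)$ is relative entropy (Kullback–Leibler divergence, $+\infty$ if absolute continuity fails). *)

theory Defs
  imports "HOL-Probability.Probability"
begin

section \<open>Two-sided sequences and shift-invariant laws\<close>

definition seq_space :: "'a set \<Rightarrow> (int \<Rightarrow> 'a) measure" where
  "seq_space A = PiM UNIV (\<lambda>_. count_space A)"

definition seq_topology :: "'a set \<Rightarrow> (int \<Rightarrow> 'a) topology" where
  "seq_topology A = product_topology (\<lambda>_. discrete_topology A) UNIV"

definition left_shift :: "(int \<Rightarrow> 'a) \<Rightarrow> int \<Rightarrow> 'a" where
  "left_shift x k = x (k + 1)"

definition inv_laws :: "'a set \<Rightarrow> (int \<Rightarrow> 'a) measure set" where
  "inv_laws A = {Q. sets Q = sets (seq_space A) \<and> prob_space Q \<and> distr Q (seq_space A) left_shift = Q}"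

definition weak_topology :: "'a set \<Rightarrow> (int \<Rightarrow> 'a) measure topology" where
  "weak_topology A = topology_generated_by
     {{Q \<in> inv_laws A. (\<integral>x. f x \<partial>Q) \<in> U} | f U.
        continuous_map (seq_topology A) euclideanreal f \<and>
        (\<exists>B. \<forall>x \<in> topspace (seq_topology A). \<bar>f x\<bar> \<le> B) \<and> open U}"

definition borel_of :: "'a topology \<Rightarrow> 'a measure" where
  "borel_of X = sigma (topspace X) {U. openin X U}"

definition mixture :: "real \<Rightarrow> 'a measure \<Rightarrow> 'a measure \<Rightarrow> 'a measure" where
  "mixture a M N = measure_of (space M) (sets M)
     (\<lambda>B. ennreal a * emeasure M B + ennreal (1 - a) * emeasure N B)"

section \<open>Large deviation principle\<close>

text \<open>The library has \<open>ln 0 = 0\<close>; here the convention is \<open>log 0 = -\<infinity>\<close>.\<close>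

definition ereal_ln :: "real \<Rightarrow> ereal" where
  "ereal_ln x = (if x = 0 then -\<infinity> else ereal (ln x))"

definition LDP :: "'a topology \<Rightarrow> (nat \<Rightarrow> 'a measure) \<Rightarrow> ('a \<Rightarrow> ereal) \<Rightarrow> bool" where
  "LDP X \<mu> I \<longleftrightarrow>
     (\<forall>G. openin X G \<longrightarrow>
        - (INF q\<in>G. I q) \<le> liminf (\<lambda>n. ereal_ln (measure (\<mu> n) G) / ereal (real n))) \<and>
     (\<forall>C. closedin X C \<longrightarrow>
        limsup (\<lambda>n. ereal_ln (measure (\<mu> n) C) / ereal (real n)) \<le> - (INF q\<in>C. I q))"

definition lower_semicontinuous :: "'a topology \<Rightarrow> ('a \<Rightarrow> ereal) \<Rightarrow> bool" where
  "lower_semicontinuous X I \<longleftrightarrow> (\<forall>c. openin X {q \<in> topspace X. c < I q})"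

section \<open>Specific relative entropy\<close>

text \<open>
  \<open>rel_entropy M N\<close> is \<open>h(M | N)\<close>; the library's \<open>KL_divergence\<close> takes the reference measure
  first.  The negative part of the log-density is always \<open>M\<close>-integrable, so when the log-density
  is not integrable its integral is \<open>+\<infinity>\<close>, whereas the Bochner integral would return 0.
\<close>

definition rel_entropy :: "'a measure \<Rightarrow> 'a measure \<Rightarrow> ereal" where
  "rel_entropy M N =
     (if absolutely_continuous N M \<and> integrable M (entropy_density (exp 1) N M)
      then ereal (KL_divergence (exp 1) N M) else \<infinity>)"

definition marginal :: "'a set \<Rightarrow> nat \<Rightarrow> (int \<Rightarrow> 'a) measure \<Rightarrow> (int \<Rightarrow> 'a) measure" where
  "marginal A n Q = distr Q (PiM {1..int n} (\<lambda>_. count_space A)) (\<lambda>x. restrict x {1..int n})"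

definition entropy_rate :: "'a set \<Rightarrow> (int \<Rightarrow> 'a) measure \<Rightarrow> (int \<Rightarrow> 'a) measure \<Rightarrow> nat \<Rightarrow> ereal" where
  "entropy_rate A Q P n = rel_entropy (marginal A n Q) (marginal A n P) / ereal (real n)"

definition specific_rel_entropy :: "'a set \<Rightarrow> (int \<Rightarrow> 'a) measure \<Rightarrow> (int \<Rightarrow> 'a) measure \<Rightarrow> ereal" where
  "specific_rel_entropy A Q P = lim (entropy_rate A Q P)"

section \<open>Summable variation\<close>

definition past_space :: "(int \<Rightarrow> 'e) measure" where
  "past_space = PiM {..0} (\<lambda>_. count_space UNIV)"

definition future_space :: "(int \<Rightarrow> 'e) measure" where
  "future_space = PiM {0<..} (\<lambda>_. count_space UNIV)"

definition regular_version ::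
    "(int \<Rightarrow> 'e) measure \<Rightarrow> ((int \<Rightarrow> 'e) \<Rightarrow> (int \<Rightarrow> 'e) measure) \<Rightarrow> bool" where
  "regular_version \<nu> K \<longleftrightarrow>
     K \<in> measurable past_space (prob_algebra future_space) \<and>
     (\<forall>A \<in> sets past_space. \<forall>B \<in> sets future_space.
        emeasure \<nu> {x \<in> space \<nu>. restrict x {..0} \<in> A \<and> restrict x {0<..} \<in> B} =
        (\<integral>\<^sup>+z\<in>A. emeasure (K z) B \<partial>(distr \<nu> past_space (\<lambda>x. restrict x {..0}))))"

definition variation :: "((int \<Rightarrow> 'e) \<Rightarrow> (int \<Rightarrow> 'e) measure) \<Rightarrow> nat \<Rightarrow> ereal" where
  "variation K n =
     (SUP (z, z') \<in> {(z, z'). z \<in> space past_space \<and> z' \<in> space past_space \<and>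
                        (\<forall>k. - int n < k \<and> k \<le> 0 \<longrightarrow> z k = z' k)}.
      SUP B \<in> {B \<in> sets (vimage_algebra (space future_space) (\<lambda>y. y 1) (count_space UNIV)).
                 0 < measure (K z) B}.
        \<bar>ereal_ln (measure (K z) B) - ereal_ln (measure (K z') B)\<bar>)"

definition summable_variation :: "(int \<Rightarrow> 'e) measure \<Rightarrow> bool" where
  "summable_variation \<nu> \<longleftrightarrow> (\<exists>K. regular_version \<nu> K \<and> (\<Sum>n. variation K n) < \<infinity>)"

section \<open>Cutting words out of the letter sequence\<close>

definition words :: "'e list set" where
  "words = {w. w \<noteq> []}"

definition renewal_time :: "(int \<Rightarrow> nat) \<Rightarrow> int \<Rightarrow> int" where
  "renewal_time t i =
     (if 0 \<le> i then (\<Sum>j\<in>{1..i}. int (t j)) else - (\<Sum>j\<in>{i<..0}. int (t j)))"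

lemma renewal_time_0: "renewal_time t 0 = 0"
  by (simp add: renewal_time_def)

lemma renewal_time_step: "renewal_time t i = renewal_time t (i - 1) + int (t i)"
proof (cases "1 \<le> i")
  case True
  then have "{1..i} = insert i {1..i-1}" by auto
  with True show ?thesis by (simp add: renewal_time_def)
next
  case False
  then have "{i-1<..0} = insert i {i<..0}" by auto
  with False show ?thesis by (cases "i = 0") (simp_all add: renewal_time_def)
qed

definition word_seq :: "(int \<Rightarrow> 'e) \<times> (int \<Rightarrow> nat) \<Rightarrow> int \<Rightarrow> 'e list" where
  "word_seq = (\<lambda>(x, t) i. map x [renewal_time t (i - 1) + 1..renewal_time t i])"

definition joint_law :: "(int \<Rightarrow> 'e) measure \<Rightarrow> nat measure \<Rightarrow> ((int \<Rightarrow> 'e) \<times> (int \<Rightarrow> nat)) measure" where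
  "joint_law \<nu> \<rho> = \<nu> \<Otimes>\<^sub>M PiM UNIV (\<lambda>_. \<rho>)"

definition word_law :: "(int \<Rightarrow> 'e) measure \<Rightarrow> nat measure \<Rightarrow> (int \<Rightarrow> 'e list) measure" where
  "word_law \<nu> \<rho> = distr (joint_law \<nu> \<rho>) (seq_space words) word_seq"

definition periodic :: "nat \<Rightarrow> (int \<Rightarrow> 'a) \<Rightarrow> int \<Rightarrow> 'a" where
  "periodic n y k = y ((k - 1) mod int n + 1)"

definition empirical :: "nat \<Rightarrow> (int \<Rightarrow> 'e list) \<Rightarrow> (int \<Rightarrow> 'e list) measure" where
  "empirical n y = measure_of (space (seq_space words)) (sets (seq_space words))
     (\<lambda>B. (\<Sum>i<n. emeasure (return (seq_space words) ((left_shift ^^ i) (periodic n y))) B) / of_nat n)"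

definition empirical_law ::
    "(int \<Rightarrow> 'e) measure \<Rightarrow> nat measure \<Rightarrow> nat \<Rightarrow> (int \<Rightarrow> 'e list) measure measure" where
  "empirical_law \<nu> \<rho> n =
     distr (joint_law \<nu> \<rho>) (borel_of (weak_topology words)) (\<lambda>\<omega>. empirical n (word_seq \<omega>))"

section \<open>Well-definedness\<close>

text \<open>
  With \<open>\<rho>\<close> a law on \<open>{1..}\<close>, every point of \<open>joint_law \<nu> \<rho>\<close> yields non-empty words only.
  Hence the maps under the \<open>distr\<close> in \<open>word_law\<close> and, for \<open>n > 0\<close>, in \<open>empirical_law\<close>
  are measurable, and \<open>empirical\<close> takes values in the invariant laws.
\<close>

lemma renewal_time_mono_step: "(\<And>i. 1 \<le> t i) \<Longrightarrow> renewal_time t (i - 1) < renewal_time t i"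
  using renewal_time_step[of t i] by (smt (verit) of_nat_0_less_iff less_le_trans zero_less_one)

lemma measurable_map_list:
  "(\<lambda>x. map x is) \<in> measurable (seq_space (UNIV :: 'e::countable set)) (count_space UNIV)"
proof (induction "is")
  case Nil show ?case by simp
next
  case (Cons k "is")
  have 1: "(\<lambda>x. x k) \<in> measurable (seq_space (UNIV :: 'e::countable set)) (count_space UNIV)"
    unfolding seq_space_def by measurable
  have "(\<lambda>x. (x k # map x is)) \<in> measurable (seq_space (UNIV :: 'e::countable set)) (count_space UNIV)"
    by (rule measurable_compose_countable[OF _ 1, where f="\<lambda>a x. a # map x is"])
       (rule measurable_compose[OF Cons], simp)
  then show ?case by simp
qed

lemma renewal_time_measurable:
  assumes "sets \<rho> = sets (count_space {1..})"
  shows "(\<lambda>t. renewal_time t i) \<in> measurable (PiM UNIV (\<lambda>_. \<rho>)) (count_space UNIV)"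
proof -
  have *: "(\<lambda>t. int (t j)) \<in> measurable (PiM UNIV (\<lambda>_. \<rho>)) (count_space UNIV)" for j
  proof -
    have "(\<lambda>t. t j) \<in> measurable (PiM UNIV (\<lambda>_. \<rho>)) \<rho>" by measurable
    moreover have "int \<in> measurable \<rho> (count_space UNIV)"
      unfolding measurable_cong_sets[OF assms refl] by simp
    ultimately show ?thesis by (rule measurable_compose)
  qed
  have S: "(\<lambda>t. \<Sum>j\<in>J. int (t j)) \<in> measurable (PiM UNIV (\<lambda>_. \<rho>)) (count_space UNIV)" if "finite J" for J
    using that
  proof (induction J)
    case empty show ?case by simp
  next
    case (insert j J)
    have "(\<lambda>t. int (t j) + (\<Sum>j\<in>J. int (t j))) \<in> measurable (PiM UNIV (\<lambda>_. \<rho>)) (count_space UNIV)"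
      by (rule measurable_compose_countable[OF _ *[of j], where f="\<lambda>a t. a + (\<Sum>j\<in>J. int (t j))"])
         (rule measurable_compose[OF insert.IH], simp)
    then show ?case using insert.hyps by simp
  qed
  show ?thesis
  proof (cases "0 \<le> i")
    case True then show ?thesis unfolding renewal_time_def using S[of "{1..i}"] by simp
  next
    case False then show ?thesis unfolding renewal_time_def
      using measurable_compose[OF S[of "{i<..0}"], of uminus] by simp
  qed
qed

lemma word_seq_measurable:
  assumes "sets \<nu> = sets (seq_space (UNIV :: 'e::finite set))"
    and "sets \<rho> = sets (count_space {1..})"
  shows "word_seq \<in> measurable (joint_law \<nu> \<rho>) (seq_space words)"
  unfolding seq_space_def
proof (rule measurable_PiM_single')
  have sp: "space \<rho> = {1..}" using sets_eq_imp_space_eq[OF assms(2)] by simp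
  have w: "word_seq \<omega> i \<in> words" if "\<omega> \<in> space (joint_law \<nu> \<rho>)" for \<omega> i
  proof -
    obtain x t where [simp]: "\<omega> = (x, t)" by force
    have "1 \<le> t j" for j using that sp by (auto simp: joint_law_def space_pair_measure space_PiM)
    then show ?thesis using renewal_time_mono_step[of t i] by (auto simp: words_def word_seq_def)
  qed
  then show "word_seq \<in> space (joint_law \<nu> \<rho>) \<rightarrow> UNIV \<rightarrow>\<^sub>E space (count_space words)" by auto
  fix i :: int
  have M: "(\<lambda>\<omega>. map (fst \<omega>) is) \<in> measurable (joint_law \<nu> \<rho>) (count_space UNIV)" for "is"
    unfolding joint_law_def
    by (rule measurable_compose[OF measurable_fst])
       (unfold measurable_cong_sets[OF assms(1) refl], rule measurable_map_list)
  have R: "(\<lambda>\<omega>. renewal_time (snd \<omega>) j) \<in> measurable (joint_law \<nu> \<rho>) (count_space UNIV)" for j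
    unfolding joint_law_def
    by (rule measurable_compose[OF measurable_snd renewal_time_measurable[OF assms(2)]])
  have "(\<lambda>\<omega>. map (fst \<omega>) [renewal_time (snd \<omega>) (i - 1) + 1..renewal_time (snd \<omega>) i])
      \<in> measurable (joint_law \<nu> \<rho>) (count_space UNIV)"
    by (rule measurable_compose_countable[OF _ R[of "i-1"], where f="\<lambda>a \<omega>. map (fst \<omega>) [a + 1..renewal_time (snd \<omega>) i]"],
       rule measurable_compose_countable[OF _ R[of i], where f="\<lambda>b \<omega>. map (fst \<omega>) [_ + 1..b]"], rule M)
  then have "(\<lambda>\<omega>. word_seq \<omega> i) \<in> measurable (joint_law \<nu> \<rho>) (count_space UNIV)"
    by (simp add: word_seq_def case_prod_beta)
  with w show "(\<lambda>\<omega>. word_seq \<omega> i) \<in> measurable (joint_law \<nu> \<rho>) (count_space words)"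
    by (auto simp: measurable_def Pi_iff)
qed

lemma left_shift_measurable: "left_shift \<in> measurable (seq_space A) (seq_space A)"
  unfolding seq_space_def
proof (rule measurable_PiM_single')
  show "left_shift \<in> space (PiM UNIV (\<lambda>_. count_space A)) \<rightarrow> UNIV \<rightarrow>\<^sub>E space (count_space A)"
    by (auto simp: left_shift_def space_PiM PiE_iff)
  fix i :: int
  show "(\<lambda>x. left_shift x i) \<in> PiM UNIV (\<lambda>_. count_space A) \<rightarrow>\<^sub>M count_space A"
    unfolding left_shift_def by (rule measurable_component_singleton) simp
qed

lemma left_shift_funpow: "(left_shift ^^ i) x k = x (k + int i)"
  by (induction i arbitrary: k) (simp_all add: left_shift_def algebra_simps)

lemma emeasure_empirical:
  assumes "B \<in> sets (seq_space words)"
  shows "emeasure (empirical n y) B =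
   (\<Sum>i<n. emeasure (return (seq_space words) ((left_shift ^^ i) (periodic n y))) B) / of_nat n"
proof -
  show ?thesis unfolding empirical_def
  proof (rule emeasure_measure_of_sigma)
    let ?W = "seq_space words :: (int \<Rightarrow> 'a list) measure"
    show "sigma_algebra (space ?W) (sets ?W)" ..
    show "positive (sets ?W) (\<lambda>B. (\<Sum>i<n. emeasure (return ?W ((left_shift ^^ i) (periodic n y))) B) / of_nat n)"
      by (simp add: positive_def)
    show "countably_additive (sets ?W) (\<lambda>B. (\<Sum>i<n. emeasure (return ?W ((left_shift ^^ i) (periodic n y))) B) / of_nat n)"
      by (auto simp: countably_additive_def divide_ennreal_def suminf_sum[symmetric] suminf_emeasure[symmetric]
          simp del: emeasure_return)
  qed fact
qed

lemma empirical_inv_laws: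
  assumes "y \<in> space (seq_space words)" "0 < n"
  shows "empirical n y \<in> inv_laws words"
proof -
  let ?W = "seq_space words :: (int \<Rightarrow> 'a list) measure" 
  let ?d = "\<lambda>i. return ?W ((left_shift ^^ i) (periodic n y))"
  have sp: "(left_shift ^^ i) (periodic n y) \<in> space ?W" for i
    using assms by (auto simp: seq_space_def space_PiM left_shift_funpow periodic_def PiE_iff)
  have s: "sets (empirical n y) = sets ?W" by (simp add: empirical_def)
  have "space (empirical n y) = space ?W" by (simp add: empirical_def)
  then have "emeasure (empirical n y) (space (empirical n y)) = 1"
    using assms sp
    by (simp add: emeasure_empirical of_nat_less_top)
  then have p: "prob_space (empirical n y)" by (rule prob_spaceI)
  have per: "(left_shift ^^ n) (periodic n y) = periodic n y"
  proof
    fix k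
    have "(k - 1 + int n) mod int n = (k - 1) mod int n" by simp
    then show "(left_shift ^^ n) (periodic n y) k = periodic n y k"
      by (simp add: left_shift_funpow periodic_def algebra_simps)
  qed
  have i: "distr (empirical n y) ?W left_shift = empirical n y"
  proof (rule measure_eqI)
    show "sets (distr (empirical n y) ?W left_shift) = sets (empirical n y)" by (simp add: s)
    fix B assume "B \<in> sets (distr (empirical n y) ?W left_shift)"
    then have B: "B \<in> sets ?W" by simp
    have m: "left_shift \<in> measurable (empirical n y) ?W" using left_shift_measurable[of words] s by (simp cong: measurable_cong_sets)
    have B': "left_shift -` B \<inter> space ?W \<in> sets ?W" using B left_shift_measurable measurable_sets by blast
    have e: "emeasure (?d i) (left_shift -` B \<inter> space ?W) = emeasure (?d (Suc i)) B" for i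
      using B B' sp[of i] by (simp add: indicator_def)
    have "emeasure (distr (empirical n y) ?W left_shift) B = emeasure (empirical n y) (left_shift -` B \<inter> space ?W)"
      using B m sets_eq_imp_space_eq[OF s] by (simp add: emeasure_distr)
    also have "\<dots> = (\<Sum>i<n. emeasure (?d (Suc i)) B) / of_nat n"
      using B' by (simp only: emeasure_empirical e)
    also have "(\<Sum>i<n. emeasure (?d (Suc i)) B) = (\<Sum>i<n. emeasure (?d i) B)"
    proof -
      have "(\<Sum>i<n. emeasure (?d (Suc i)) B) = (\<Sum>i=1..<Suc n. emeasure (?d i) B)"
        using sum.shift_bounds_Suc_ivl[of "\<lambda>i. emeasure (?d i) B" 0 n] by (simp add: atLeast0LessThan del: funpow.simps)
      also have "\<dots> = (\<Sum>i=1..<n. emeasure (?d i) B) + emeasure (?d n) B"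
        using assms(2) by (subst sum.atLeastLessThan_Suc) auto
      also have "emeasure (?d n) B = emeasure (?d 0) B" using per by simp
      also have "(\<Sum>i=1..<n. emeasure (?d i) B) + emeasure (?d 0) B = (\<Sum>i<n. emeasure (?d i) B)"
        using assms(2) by (simp add: lessThan_atLeast0 sum.atLeast_Suc_lessThan[of 0 n] add.commute)
      finally show ?thesis .
    qed
    finally show "emeasure (distr (empirical n y) ?W left_shift) B = emeasure (empirical n y) B"
      using B by (simp only: emeasure_empirical)
  qed
  show ?thesis using s p i by (simp add: inv_laws_def)
qed

lemma topspace_weak_topology: "topspace (weak_topology A) = inv_laws A"
proof -
  have "inv_laws A \<in> {{Q \<in> inv_laws A. (\<integral>x. f x \<partial>Q) \<in> U} | f U.
        continuous_map (seq_topology A) euclideanreal f \<and>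
        (\<exists>B. \<forall>x \<in> topspace (seq_topology A). \<bar>f x\<bar> \<le> B) \<and> open (U::real set)}"
    by (rule CollectI, rule exI[of _ "\<lambda>_. 0"], rule exI[of _ UNIV]) auto
  then show ?thesis by (auto simp: weak_topology_def)
qed

lemma empirical_measurable:
  assumes "sets \<nu> = sets (seq_space (UNIV :: 'e::finite set))"
    and "sets \<rho> = sets (count_space {1..})" and "0 < n"
  shows "(\<lambda>\<omega>. empirical n (word_seq \<omega>)) \<in> measurable (joint_law \<nu> \<rho>) (borel_of (weak_topology words))"
proof -
  have Y: "word_seq \<in> measurable (joint_law \<nu> \<rho>) (seq_space words)"
    using assms(1,2) by (rule word_seq_measurable)
  have val: "empirical n (word_seq \<omega>) \<in> space (borel_of (weak_topology words))"
    if "\<omega> \<in> space (joint_law \<nu> \<rho>)" for \<omega>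
    using empirical_inv_laws[OF measurable_space[OF Y that] assms(3)]
    by (simp add: borel_of_def topspace_weak_topology space_measure_of_conv)
  have id: "(\<lambda>y. y) \<in> seq_space (words :: 'e list set) \<rightarrow>\<^sub>M seq_space UNIV"
    unfolding seq_space_def
  proof (rule measurable_PiM_single')
    fix i :: int
    have "(\<lambda>y. y i) \<in> PiM UNIV (\<lambda>_. count_space (words :: 'e list set)) \<rightarrow>\<^sub>M count_space words"
      by (rule measurable_component_singleton) simp
    then show "(\<lambda>y. y i) \<in> PiM UNIV (\<lambda>_. count_space (words :: 'e list set)) \<rightarrow>\<^sub>M count_space UNIV"
      by (rule measurable_compose) simp
  qed simp
  have L: "(\<lambda>\<omega>. map (word_seq \<omega>) [1..int n]) \<in> measurable (joint_law \<nu> \<rho>) (count_space UNIV)"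
    by (rule measurable_compose[OF measurable_compose[OF Y id] measurable_map_list])
  have eq: "empirical n (word_seq \<omega>) = empirical n (\<lambda>k. map (word_seq \<omega>) [1..int n] ! nat (k - 1))" for \<omega> :: "(int \<Rightarrow> 'e) \<times> (int \<Rightarrow> nat)"
  proof -
    have "periodic n (word_seq \<omega>) = periodic n (\<lambda>k. map (word_seq \<omega>) [1..int n] ! nat (k - 1))"
    proof
      fix k
      have "0 \<le> (k - 1) mod int n" "(k - 1) mod int n < int n" using assms(3) by auto
      then show "periodic n (word_seq \<omega>) k = periodic n (\<lambda>k. map (word_seq \<omega>) [1..int n] ! nat (k - 1)) k"
        by (simp add: periodic_def add.commute)
    qed
    then show ?thesis by (simp add: empirical_def)
  qed
  have "(\<lambda>\<omega>. empirical n (word_seq \<omega>)) -` C \<inter> space (joint_law \<nu> \<rho>) \<in> sets (joint_law \<nu> \<rho>)" for C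
  proof -
    have "(\<lambda>\<omega>. empirical n (word_seq \<omega>)) -` C \<inter> space (joint_law \<nu> \<rho>) =
      (\<lambda>\<omega>. map (word_seq \<omega>) [1..int n]) -` {l. empirical n (\<lambda>k. l ! nat (k - 1)) \<in> C} \<inter> space (joint_law \<nu> \<rho>)"
      by (simp only: vimage_def mem_Collect_eq eq[symmetric])
    also have "\<dots> \<in> sets (joint_law \<nu> \<rho>)" by (rule measurable_sets[OF L]) simp
    finally show ?thesis .
  qed
  with val show ?thesis by (auto intro: measurableI)
qed

end

theory Submission
  imports Defs
begin

text \<open>
  Everything rests on one property of the word law \<open>P\<close>. Write \<open>P(w)\<close> for the probability that \<open>P\<close>
  gives to the word sequence \<open>w\<close> at the sites \<open>1, 2, \<dots>\<close>. Call \<open>P\<close> quasi-Bernoulli with constant \<open>C\<close> if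
  \<open>exp(-C) P(u) P(v) \<le> P(uv) \<le> exp C P(u) P(v)\<close> for all \<open>u\<close> and \<open>v\<close>. Summable variation gives this for
  \<open>\<nu>\<close>: the conditional probability of a letter string given the past is a product of one-step
  probabilities, and the \<open>i\<close>-th factors for two different pasts differ at most by the factor
  \<open>exp (\<phi>(i - 1))\<close>, since the pasts have by then \<open>i - 1\<close> letters in common. The whole products therefore
  differ at most by \<open>exp (\<Sum>i. \<phi>(i))\<close> (\<open>word_prob_variation\<close>, \<open>summable_variation_quasi_bernoulli\<close>).
  Given the word lengths, which are i.i.d. and independent of the letters, a sequence of words is just
  its concatenation, so the word law inherits the property with the same constant
  (\<open>quasi_bernoulli_word_law\<close>). From there on only a stationary quasi-Bernoulli law on sequences over a
  countable alphabet is used (locale \<open>quasi_bernoulli\<close>).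

  Relative entropy is handled through its variational form, the supremum of
  \<open>\<integral> f dq - ln \<integral> exp f dp\<close> over bounded \<open>f\<close> (\<open>kl\<close>, \<open>rel_entropy_variational\<close>). Testing with the sum
  of a function of the first block and a function of the second shows that the block entropies \<open>h\<^sub>n\<close> of
  \<open>Q\<close> relative to \<open>P\<close> satisfy \<open>h\<^sub>n + h\<^sub>m \<le> h\<^sub>n\<^sub>+\<^sub>m + C\<close>. So \<open>h\<^sub>n / n\<close> converges to the supremum of
  \<open>(h\<^sub>k - C) / k\<close> (\<open>rate_limit\<close>), which is lower semicontinuous because it is a supremum of continuous
  functions of \<open>Q\<close>, and affine because \<open>h\<^sub>n\<close> is affine in \<open>Q\<close> up to \<open>ln 2\<close>.

  Upper bound (\<open>upper_bound\<close>): the exponential moment of a sum of \<open>f\<close> over disjoint \<open>k\<close>-blocks is at most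
  \<open>exp C \<integral> exp f dP\<close> to the power of the number of blocks, and convexity of \<open>exp\<close> reduces the average
  over all \<open>k\<close>-windows to disjoint blocks. Markov's inequality gives a neighbourhood of each \<open>Q\<close> whose
  probability decays at any rate below \<open>rate Q\<close>. The same moment bound for single letters gives
  exponential tightness, and a finite cover finishes the proof.

  Lower bound (\<open>lower_bound\<close>): for large \<open>k\<close> compare \<open>P\<close> with the law that strings together independent
  \<open>k\<close>-blocks of \<open>Q\<close>. Each position inside a block of \<open>Q\<close> sees a short word with the probability that \<open>Q\<close>
  gives it, so by Chebyshev's inequality the empirical law is close to \<open>Q\<close> even if \<open>Q\<close> is not
  ergodic; the entropy per site relative to \<open>P\<close> is at most \<open>(h\<^sub>k + C) / k\<close>. The entropy bound
  for a single event (\<open>kl_event\<close>) turns this into a lower bound for the probability under \<open>P\<close>. Level sets are compact because the lower bound, applied to the complement of the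
  compact sets from exponential tightness, forces the rate to be large there (\<open>compact_level_sets\<close>).

  Unique zero (\<open>rate_eq_zero_iff\<close>): if \<open>rate Q = 0\<close>, the numbers \<open>h\<^sub>n\<close> are bounded by \<open>C\<close>, so after a long
  past a further block contributes almost no entropy. This forces \<open>Q \<ge> exp(-C) P\<close> on cylinders.
  Subtracting \<open>exp(-C) P\<close> from \<open>Q\<close> and normalising leaves a stationary law, whose rate is again zero by
  affinity. Repeating the step gives \<open>Q \<ge> P\<close>, hence \<open>Q = P\<close>.
\<close>

section \<open>Block laws of stationary sequences\<close>

lemma space_seq_space: "y \<in> space (seq_space A) \<longleftrightarrow> (\<forall>i. y i \<in> A)"
  by (auto simp: seq_space_def space_PiM PiE_iff)

lemma inv_lawsD:
  assumes "Q \<in> inv_laws A"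
  shows "sets Q = sets (seq_space A)" "prob_space Q" "distr Q (seq_space A) left_shift = Q"
    "space Q = space (seq_space A)"
  using assms sets_eq_imp_space_eq[of Q "seq_space A"] by (auto simp: inv_laws_def)

definition block :: "nat \<Rightarrow> (int \<Rightarrow> 'a) \<Rightarrow> 'a list" where
  "block n y = map y [1..int n]"

lemma length_block [simp]: "length (block n y) = n"
  by (simp add: block_def)

lemma measurable_window:
  "(\<lambda>y. map y js) \<in> measurable (seq_space (A :: 'a::countable set)) (count_space UNIV)"
proof (induction js)
  case Nil show ?case by simp
next
  case (Cons k js)
  have "(\<lambda>x. x k) \<in> measurable (seq_space A) (count_space A)"
    unfolding seq_space_def by (rule measurable_component_singleton) simp
  then have 1: "(\<lambda>x. x k) \<in> measurable (seq_space A) (count_space UNIV)"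
    by (rule measurable_compose) simp
  have "(\<lambda>x. (x k # map x js)) \<in> measurable (seq_space A) (count_space UNIV)"
    by (rule measurable_compose_countable[OF _ 1, where f="\<lambda>a x. a # map x js"])
       (rule measurable_compose[OF Cons], simp)
  then show ?case by simp
qed

lemma measurable_window_inv:
  assumes "Q \<in> inv_laws (A :: 'a::countable set)"
  shows "(\<lambda>y. map y js) \<in> measurable Q (count_space UNIV)"
    "block n \<in> measurable Q (count_space UNIV)"
  using measurable_window[of js A] measurable_window[of "[1..int n]" A] inv_lawsD(1)[OF assms]
  by (simp_all add: block_def[abs_def] cong: measurable_cong_sets)

lemma map_upto_shift: "map (\<lambda>k. y (k + c)) [a..b] = map y [a + c..b + c]"
  by (rule nth_equalityI) (simp_all add: algebra_simps)

lemma measurable_funpow_left_shift: "left_shift ^^ n \<in> measurable (seq_space A) (seq_space A)"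
proof (induction n)
  case 0 show ?case by (simp add: id_def)
next
  case (Suc n)
  from measurable_comp[OF Suc left_shift_measurable] show ?case by (simp add: o_def)
qed

lemma distr_funpow_left_shift:
  assumes "Q \<in> inv_laws A" shows "distr Q (seq_space A) (left_shift ^^ n) = Q"
proof (induction n)
  case 0
  show ?case using inv_lawsD[OF assms] distr_id2[of "seq_space A" Q] by (simp add: id_def)
next
  case (Suc n)
  have mQ: "left_shift ^^ n \<in> measurable Q (seq_space A)" for n
    using measurable_funpow_left_shift inv_lawsD(1)[OF assms] by (simp cong: measurable_cong_sets)
  have "distr Q (seq_space A) (left_shift ^^ Suc n)
      = distr (distr Q (seq_space A) (left_shift ^^ n)) (seq_space A) left_shift"
    by (subst distr_distr[OF left_shift_measurable mQ]) (simp add: o_def)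
  then show ?case using Suc inv_lawsD(3)[OF assms] by (simp add: o_def)
qed

text \<open>
  Shifting forward preserves the law by definition. A window to the left of the origin is therefore
  reached the other way round: moving it forward turns it into the block at \<open>1, \<dots>, n\<close>.
\<close>

lemma distr_window:
  fixes A :: "'a::countable set"
  assumes Q: "Q \<in> inv_laws A"
  shows "distr Q (count_space UNIV) (\<lambda>y. map y [a + 1..a + int n]) = distr Q (count_space UNIV) (block n)"
proof -
  have mQ: "left_shift ^^ n \<in> measurable Q (seq_space A)" for n
    using measurable_funpow_left_shift inv_lawsD(1)[OF Q] by (simp cong: measurable_cong_sets)
  have eq: "distr Q (count_space UNIV) (\<lambda>y. map y [b + int c..d + int c]) = distr Q (count_space UNIV) (\<lambda>y. map y [b..d])" for b d c
  proof -
    have "distr Q (count_space UNIV) (\<lambda>y. map y [b..d])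
        = distr (distr Q (seq_space A) (left_shift ^^ c)) (count_space UNIV) (\<lambda>y. map y [b..d])"
      by (simp add: distr_funpow_left_shift[OF Q])
    also have "\<dots> = distr Q (count_space UNIV) ((\<lambda>y. map y [b..d]) \<circ> (left_shift ^^ c))"
      by (rule distr_distr[OF measurable_window mQ])
    also have "(\<lambda>y. map y [b..d]) \<circ> (left_shift ^^ c) = (\<lambda>y :: int \<Rightarrow> 'a. map y [b + int c..d + int c])"
    proof
      fix y :: "int \<Rightarrow> 'a"
      have "(left_shift ^^ c) y = (\<lambda>k. y (k + int c))" by (rule ext) (rule left_shift_funpow)
      then show "((\<lambda>y. map y [b..d]) \<circ> (left_shift ^^ c)) y = map y [b + int c..d + int c]"
        by (simp only: o_def map_upto_shift)
    qed
    finally show ?thesis by simp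
  qed
  show ?thesis
  proof (cases "0 \<le> a")
    case True
    then show ?thesis using eq[of 1 "nat a" "int n"] by (simp add: block_def[abs_def] algebra_simps)
  next
    case False
    then show ?thesis using eq[of "a+1" "nat (-a)" "a + int n"] by (simp add: block_def[abs_def] algebra_simps)
  qed
qed

text \<open>
  Blocks over a countable alphabet form a countable type. As a probability mass function the law of a
  block makes every bounded function of it integrable, without measurability conditions.
\<close>

definition block_law :: "nat \<Rightarrow> (int \<Rightarrow> 'a) measure \<Rightarrow> 'a list pmf" where
  "block_law n Q = Abs_pmf (distr Q (count_space UNIV) (block n))"

lemma measure_pmf_block_law:
  fixes A :: "'a::countable set"
  assumes Q: "Q \<in> inv_laws A"
  shows "measure_pmf (block_law n Q) = distr Q (count_space UNIV) (block n)"
proof -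
  interpret prob_space Q by (rule inv_lawsD[OF Q])
  let ?M = "distr Q (count_space UNIV) (block n)"
  interpret M: prob_space ?M by (rule prob_space_distr) (rule measurable_window_inv[OF Q])
  have "AE x in ?M. measure ?M {x} \<noteq> 0"
    by (subst M.AE_support_countable) (auto intro!: exI[of _ UNIV])
  then have "?M \<in> {M. prob_space M \<and> sets M = UNIV \<and> (AE x in M. measure M {x} \<noteq> 0)}"
    using M.prob_space_axioms by simp
  then show ?thesis unfolding block_law_def by (rule Abs_pmf_inverse)
qed

lemma expectation_block_law:
  fixes A :: "'a::countable set" and f :: "'a list \<Rightarrow> real"
  assumes Q: "Q \<in> inv_laws A"
  shows "measure_pmf.expectation (block_law n Q) f = (\<integral>y. f (block n y) \<partial>Q)"
  unfolding measure_pmf_block_law[OF Q]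
  by (rule integral_distr) (auto intro: measurable_window_inv[OF Q])

lemma expectation_window:
  fixes A :: "'a::countable set" and f :: "'a list \<Rightarrow> real"
  assumes Q: "Q \<in> inv_laws A"
  shows "(\<integral>y. f (map y [a + 1..a + int n]) \<partial>Q) = measure_pmf.expectation (block_law n Q) f"
proof -
  have "(\<integral>y. f (map y [a + 1..a + int n]) \<partial>Q) = integral\<^sup>L (distr Q (count_space UNIV) (\<lambda>y. map y [a + 1..a + int n])) f"
    by (rule integral_distr[symmetric]) (auto intro: measurable_window_inv[OF Q])
  then show ?thesis by (simp add: distr_window[OF Q] measure_pmf_block_law[OF Q])
qed

lemma set_pmf_block_law:
  fixes A :: "'a::countable set"
  assumes Q: "Q \<in> inv_laws A"
  shows "set_pmf (block_law n Q) \<subseteq> {u. length u = n \<and> set u \<subseteq> A}"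
proof -
  have "AE u in measure_pmf (block_law n Q). length u = n \<and> set u \<subseteq> A"
    unfolding measure_pmf_block_law[OF Q]
    by (subst AE_distr_iff[OF measurable_window_inv(2)[OF Q]])
       (auto intro!: AE_I2 simp: inv_lawsD(4)[OF Q] space_seq_space block_def)
  then show ?thesis by (auto simp: AE_measure_pmf_iff)
qed

text \<open>
  Any part of a block that is itself a window is distributed like a block of its length; taking,
  dropping, and removing the first or last letter are the instances used later.
\<close>

lemma map_pmf_block_law:
  fixes A :: "'a::countable set"
  assumes Q: "Q \<in> inv_laws A"
  assumes "\<And>y. g (block n y) = map y [a + 1..a + int m]"
  shows "map_pmf g (block_law n Q) = block_law m Q"
proof -
  have "measure_pmf (map_pmf g (block_law n Q)) = measure_pmf (block_law m Q)"
    unfolding measure_pmf_block_law[OF Q] map_pmf_rep_eq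
    by (subst distr_distr) (auto intro: measurable_window_inv[OF Q] simp: o_def assms(2) distr_window[OF Q])
  then show ?thesis by (simp add: measure_pmf_inject)
qed

lemma drop_upto: "drop m [a..b] = [a + int m..b]"
  by (rule nth_equalityI) auto

lemma take_upto: "a + int m \<le> b + 1 \<Longrightarrow> take m [a..b] = [a..a + int m - 1]"
  by (rule nth_equalityI) auto

lemma window_block:
  "i + k \<le> n \<Longrightarrow> take k (drop i (block n y)) = map y [int i + 1..int i + int k]"
  by (simp add: block_def take_map drop_map drop_upto take_upto algebra_simps)

lemma map_pmf_window:
  fixes A :: "'a::countable set"
  assumes Q: "Q \<in> inv_laws A" and "i + k \<le> n"
  shows "map_pmf (\<lambda>u. take k (drop i u)) (block_law n Q) = block_law k Q"
  using assms by (intro map_pmf_block_law[where a="int i"]) (auto simp: window_block)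

lemma map_pmf_take:
  fixes A :: "'a::countable set"
  assumes Q: "Q \<in> inv_laws A" and "k \<le> n"
  shows "map_pmf (take k) (block_law n Q) = block_law k Q"
  using map_pmf_window[OF Q, of 0 k n] assms(2) by (simp add: map_pmf_def)

lemma map_pmf_drop:
  fixes A :: "'a::countable set"
  assumes Q: "Q \<in> inv_laws A" and "i \<le> n"
  shows "map_pmf (drop i) (block_law n Q) = block_law (n - i) Q"
proof -
  have "map_pmf (drop i) (block_law n Q) = map_pmf (\<lambda>u. take (n - i) (drop i u)) (block_law n Q)"
    using set_pmf_block_law[OF Q, of n] by (intro map_pmf_cong) auto
  then show ?thesis using map_pmf_window[OF Q, of i "n - i" n] assms(2) by simp
qed

lemma map_pmf_butlast:
  fixes A :: "'a::countable set"
  assumes Q: "Q \<in> inv_laws A"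
  shows "map_pmf butlast (block_law (Suc n) Q) = block_law n Q"
proof -
  have "map_pmf butlast (block_law (Suc n) Q) = map_pmf (take n) (block_law (Suc n) Q)"
    using set_pmf_block_law[OF Q, of "Suc n"] by (intro map_pmf_cong) (auto simp: butlast_conv_take)
  then show ?thesis by (simp add: map_pmf_take[OF Q])
qed

lemma map_pmf_tl:
  fixes A :: "'a::countable set"
  assumes Q: "Q \<in> inv_laws A"
  shows "map_pmf tl (block_law (Suc n) Q) = block_law n Q"
  using map_pmf_drop[OF Q, of 1 "Suc n"] by (simp add: drop_Suc[abs_def])

text \<open>
  Windows around the origin exhaust the finite sets of sites, so their laws determine the measure.
\<close>

lemma seq_measure_eqI:
  fixes A :: "'a::countable set"
  assumes M: "finite_measure M" "sets M = sets (seq_space A)" and N: "sets N = sets (seq_space A)"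
  assumes eq: "\<And>m. 1 \<le> m \<Longrightarrow> distr M (count_space UNIV) (\<lambda>y. map y [- int m + 1..int m])
      = distr N (count_space UNIV) (\<lambda>y. map y [- int m + 1..int m])"
  shows "M = N"
proof (rule measure_eqI_PiM_infinite)
  show "sets M = sets (PiM UNIV (\<lambda>_. count_space A))" "sets N = sets (PiM UNIV (\<lambda>_. count_space A))"
    using M N by (auto simp: seq_space_def)
  show "finite_measure M" by fact
  fix F J assume J: "finite J" and "J \<subseteq> (UNIV :: int set)" and F: "\<And>i. i \<in> J \<Longrightarrow> F i \<in> sets (count_space A)"
  obtain m where m: "\<And>i. i \<in> J \<Longrightarrow> \<bar>i\<bar> < int m" "1 \<le> m"
  proof -
    have "finite (abs ` J)" using J by simp
    then obtain b where "\<forall>x\<in>abs ` J. x < b" by (meson finite_set_of_finite_funs bdd_above.unfold bdd_above_finite gt_ex order_le_less_trans)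
    then show ?thesis by (intro that[of "nat (max b 1)"]) force+
  qed
  let ?w = "\<lambda>y. map y [- int m + 1..int m]"
  let ?S = "{u. \<forall>i\<in>J. u ! nat (i + int m - 1) \<in> F i}"
  have nth: "?w y ! nat (i + int m - 1) = y i" if "i \<in> J" for i y
  proof -
    have "?w y ! nat (i + int m - 1) = y (- int m + 1 + int (nat (i + int m - 1)))"
      using m(1)[OF that] by (subst nth_map) (auto simp: nth_upto abs_less_iff)
    moreover have "0 \<le> i + int m - 1" using m(1)[OF that] by linarith
    ultimately show ?thesis by simp
  qed
  have S: "(?w y \<in> ?S) = (\<forall>i\<in>J. y i \<in> F i)" for y
    unfolding mem_Collect_eq by (intro ball_cong refl) (simp only: nth)
  have e: "emeasure L (prod_emb UNIV (\<lambda>_. count_space A) J (Pi\<^sub>E J F)) = emeasure (distr L (count_space UNIV) ?w) ?S"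
    if L: "sets L = sets (seq_space A)" for L
  proof -
    have sp: "space L = space (seq_space A)" using L by (rule sets_eq_imp_space_eq)
    have mm: "?w \<in> measurable L (count_space UNIV)"
      using measurable_window[of _ A] L by (simp cong: measurable_cong_sets)
    have "?w -` ?S \<inter> space L = {y \<in> space L. \<forall>i\<in>J. y i \<in> F i}"
      using S by blast
    also have "\<dots> = prod_emb UNIV (\<lambda>_. count_space A) J (Pi\<^sub>E J F)"
      by (auto simp: prod_emb_def sp space_seq_space PiE_iff space_PiM restrict_def)
    finally show ?thesis using mm by (simp add: emeasure_distr)
  qed
  show "emeasure M (prod_emb UNIV (\<lambda>_. count_space A) J (Pi\<^sub>E J F)) = emeasure N (prod_emb UNIV (\<lambda>_. count_space A) J (Pi\<^sub>E J F))"
    using e[OF M(2)] e[OF N] eq[OF m(2)] by simp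
qed

lemma inv_laws_eqI:
  fixes A :: "'a::countable set"
  assumes M: "M \<in> inv_laws A" and N: "N \<in> inv_laws A" and eq: "\<And>n. block_law n M = block_law n N"
  shows "M = N"
proof (rule seq_measure_eqI)
  show "finite_measure M" using inv_lawsD(2)[OF M] by (rule prob_space.finite_measure)
  show "sets M = sets (seq_space A)" "sets N = sets (seq_space A)" using M N inv_lawsD by auto
  fix m :: nat
  have "distr L (count_space UNIV) (\<lambda>y. map y [- int m + 1..int m]) = measure_pmf (block_law (2 * m) L)" if "L \<in> inv_laws A" for L
    using distr_window[OF that, of "- int m" "2 * m"] by (simp add: measure_pmf_block_law[OF that])
  with M N eq show "distr M (count_space UNIV) (\<lambda>y. map y [- int m + 1..int m])
      = distr N (count_space UNIV) (\<lambda>y. map y [- int m + 1..int m])" by simp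
qed

section \<open>Relative entropy as a supremum over bounded test functions\<close>

abbreviation mean :: "'a pmf \<Rightarrow> ('a \<Rightarrow> real) \<Rightarrow> real" where
  "mean p f \<equiv> measure_pmf.expectation p f"

lemma bounded_range_iff: "bounded (range f) \<longleftrightarrow> (\<exists>B\<ge>0. \<forall>x. \<bar>f x :: real\<bar> \<le> B)"
proof
  assume "bounded (range f)"
  then obtain B where "\<forall>x. \<bar>f x\<bar> \<le> B" unfolding bounded_iff by auto
  then show "\<exists>B\<ge>0. \<forall>x. \<bar>f x\<bar> \<le> B" by (metis abs_ge_zero order_trans)
qed (auto simp: bounded_iff)

lemma bounded_rangeI: "(\<And>x. \<bar>f x :: real\<bar> \<le> B) \<Longrightarrow> bounded (range f)"
  unfolding bounded_iff by auto

lemma bounded_range_exp: "bounded (range f) \<Longrightarrow> bounded (range (\<lambda>x. exp (f x :: real)))"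
proof -
  assume "bounded (range f)"
  then obtain B where "\<And>x. \<bar>f x\<bar> \<le> B" unfolding bounded_range_iff by auto
  then show ?thesis by (intro bounded_rangeI[where B="exp B"]) (simp add: abs_le_iff)
qed

lemma bounded_range_comp: "bounded (range f) \<Longrightarrow> bounded (range (\<lambda>x. f (g x)))"
  by (erule bounded_subset) auto

lemma bounded_range_arith:
  fixes f g :: "'a \<Rightarrow> real"
  assumes "bounded (range f)" "bounded (range g)"
  shows "bounded (range (\<lambda>x. f x + g x))" "bounded (range (\<lambda>x. f x - g x))"
    "bounded (range (\<lambda>x. f x * g x))" "bounded (range (\<lambda>x. max (f x) (g x)))"
proof -
  obtain B C where B: "0 \<le> B" "\<And>x. \<bar>f x\<bar> \<le> B" "\<And>x. \<bar>g x\<bar> \<le> C" "0 \<le> C"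
    using assms unfolding bounded_range_iff by auto
  have le: "\<bar>f x + g x\<bar> \<le> B + C" "\<bar>f x - g x\<bar> \<le> B + C" "\<bar>max (f x) (g x)\<bar> \<le> B + C" for x
    using B(1,4) B(2)[of x] B(3)[of x] by linarith+
  show "bounded (range (\<lambda>x. f x + g x))" using le(1) by (rule bounded_rangeI)
  show "bounded (range (\<lambda>x. f x - g x))" using le(2) by (rule bounded_rangeI)
  show "bounded (range (\<lambda>x. max (f x) (g x)))" using le(3) by (rule bounded_rangeI)
  show "bounded (range (\<lambda>x. f x * g x))"
    by (rule bounded_rangeI[where B="B * C"]) (auto simp: abs_mult intro!: mult_mono B)
qed

lemma bounded_range_const [simp]: "bounded (range (\<lambda>x. c :: real))"
  by (rule bounded_rangeI[where B="\<bar>c\<bar>"]) simp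

lemma bounded_range_indicator [simp]: "bounded (range (indicator X :: 'a \<Rightarrow> real))"
  by (rule bounded_rangeI[where B=1]) (auto split: split_indicator)

lemmas bounded_range_intros = bounded_range_exp bounded_range_arith bounded_range_const bounded_range_indicator

lemma integrable_pmf_bounded:
  "bounded (range f) \<Longrightarrow> integrable (measure_pmf p) (f :: 'a \<Rightarrow> real)"
  unfolding bounded_range_iff
  by (elim exE conjE, rule measure_pmf.integrable_const_bound) auto

lemma mean_mono:
  assumes "bounded (range f)" "bounded (range g)" "\<And>x. x \<in> set_pmf p \<Longrightarrow> f x \<le> g x"
  shows "mean p f \<le> mean p g"
  using assms by (intro integral_mono_AE integrable_pmf_bounded) (auto simp: AE_measure_pmf_iff)

lemma mean_exp_pos:
  assumes "bounded (range f)"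
  shows "0 < mean p (\<lambda>x. exp (f x))"
proof -
  obtain B where "\<And>x. \<bar>f x\<bar> \<le> B" using assms unfolding bounded_range_iff by auto
  then have "mean p (\<lambda>x. exp (- B)) \<le> mean p (\<lambda>x. exp (f x))"
    by (intro mean_mono bounded_range_exp assms bounded_range_const) (simp add: abs_le_iff minus_le_iff)
  then show ?thesis by (simp add: less_le_trans[OF exp_gt_zero])
qed

lemma mean_count_space:
  assumes "bounded (range f)"
  shows "mean p f = (\<integral>x. pmf p x * f x \<partial>count_space UNIV)"
    "integrable (count_space UNIV) (\<lambda>x. pmf p x * f x)"
proof -
  have "integrable (density (count_space UNIV) (\<lambda>x. ennreal (pmf p x))) f"
    using integrable_pmf_bounded[OF assms, of p] by (simp add: measure_pmf_eq_density)
  then show "integrable (count_space UNIV) (\<lambda>x. pmf p x * f x)"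
    by (subst (asm) integrable_density) auto
  show "mean p f = (\<integral>x. pmf p x * f x \<partial>count_space UNIV)"
    by (simp add: measure_pmf_eq_density integral_density)
qed

text \<open>
  Both inequalities of the quasi-Bernoulli property, stated for point masses, are used through
  expectations of nonnegative functions.
\<close>

lemma mean_le_dominated:
  assumes "bounded (range f)" "\<And>x. 0 \<le> f x" "\<And>x. pmf p x \<le> c * pmf q x"
  shows "mean p f \<le> c * mean q f"
proof -
  have "(\<integral>x. pmf p x * f x \<partial>count_space UNIV) \<le> (\<integral>x. c * (pmf q x * f x) \<partial>count_space UNIV)"
  proof (intro integral_mono integrable_mult_right mean_count_space(2) assms(1))
    show "pmf p x * f x \<le> c * (pmf q x * f x)" for x
      using mult_right_mono[OF assms(3) assms(2), of x x] by (simp add: mult.assoc)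
  qed
  then show ?thesis by (simp add: mean_count_space(1)[OF assms(1)])
qed

lemma mean_mix:
  assumes "bounded (range f)" "\<And>x. pmf q x = a * pmf q1 x + b * pmf q2 x"
  shows "mean q f = a * mean q1 f + b * mean q2 f"
  using mean_count_space(2)[OF assms(1)]
  by (simp add: mean_count_space(1)[OF assms(1)] assms(2) algebra_simps)

text \<open>
  The Donsker-Varadhan form of relative entropy. Each estimate below inserts one explicit test
  function; densities appear only where this supremum is identified with the integral of the log density.
\<close>

definition kl :: "'a pmf \<Rightarrow> 'a pmf \<Rightarrow> ereal" where
  "kl q p = (SUP f\<in>{f. bounded (range f)}. ereal (mean q f - ln (mean p (\<lambda>x. exp (f x)))))"

lemma kl_upper: "bounded (range f) \<Longrightarrow> ereal (mean q f - ln (mean p (\<lambda>x. exp (f x)))) \<le> kl q p"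
  unfolding kl_def by (rule SUP_upper) simp

lemma kl_least:
  "(\<And>f. bounded (range f) \<Longrightarrow> ereal (mean q f - ln (mean p (\<lambda>x. exp (f x)))) \<le> c) \<Longrightarrow> kl q p \<le> c"
  unfolding kl_def by (rule SUP_least) simp

lemma kl_nonneg: "0 \<le> kl q p"
  using kl_upper[of "\<lambda>_. 0" q p] by (simp add: zero_ereal_def)

text \<open>
  The inequality \<open>1 + s \<le> exp s\<close>, integrated for \<open>s = f - ln \<integral> exp f dp\<close>.
\<close>

lemma kl_self: "kl p p = 0"
proof (rule antisym[OF kl_least kl_nonneg])
  fix f :: "'a \<Rightarrow> real" assume f: "bounded (range f)"
  define L where "L = ln (mean p (\<lambda>x. exp (f x)))"
  have "mean p (\<lambda>x. 1 + (f x - L)) \<le> mean p (\<lambda>x. exp (f x - L))"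
    by (intro mean_mono bounded_range_intros f exp_ge_add_one_self)
  also have "\<dots> = mean p (\<lambda>x. exp (f x)) / exp L" by (simp add: exp_diff)
  also have "\<dots> = 1" using mean_exp_pos[OF f, of p] by (simp add: L_def)
  finally show "ereal (mean p f - ln (mean p (\<lambda>x. exp (f x)))) \<le> 0"
    using integrable_pmf_bounded[OF f, of p] by (simp add: L_def)
qed

text \<open>
  Adding a constant to a test function does not change its value in the supremum, so nearly optimal
  test functions can be taken with exponential moment 1.
\<close>

lemma kl_normalized:
  assumes "ereal c < kl q p"
  obtains f where "bounded (range f)" "mean p (\<lambda>x. exp (f x)) = 1" "c < mean q f"
proof -
  from assms obtain f where f: "bounded (range f)" "c < mean q f - ln (mean p (\<lambda>x. exp (f x)))"
    unfolding kl_def less_SUP_iff by auto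
  define L where "L = ln (mean p (\<lambda>x. exp (f x)))"
  have "mean p (\<lambda>x. exp (f x - L)) = 1"
    using mean_exp_pos[OF f(1), of p] by (simp add: exp_diff L_def)
  moreover have "c < mean q (\<lambda>x. f x - L)"
    using f(2) integrable_pmf_bounded[OF f(1), of q] by (simp add: L_def)
  ultimately show ?thesis using bounded_range_arith(2)[OF f(1) bounded_range_const] that by blast
qed

lemma kl_normalized_upper:
  assumes "bounded (range f)" "mean p (\<lambda>x. exp (f x)) \<le> c" "0 < c"
  shows "ereal (mean q f) \<le> kl q p + ereal (ln c)"
proof -
  have "ln (mean p (\<lambda>x. exp (f x))) \<le> ln c" using assms mean_exp_pos[OF assms(1), of p] by simp
  then have "ereal (mean q f) \<le> ereal (mean q f - ln (mean p (\<lambda>x. exp (f x)))) + ereal (ln c)" by simp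
  also have "\<dots> \<le> kl q p + ereal (ln c)" by (intro add_right_mono kl_upper assms)
  finally show ?thesis .
qed

text \<open>
  The test function \<open>t\<close> times the indicator of \<open>A\<close>, with \<open>exp t = 1 / p(A)\<close>, has exponential moment at
  most 2. When \<open>q(A)\<close> is close to 1 this bounds \<open>p(A)\<close> from below by roughly \<open>exp (- h)\<close>, which is how an
  entropy estimate becomes a large deviation lower bound.
\<close>

lemma kl_event:
  assumes kl: "kl q p \<le> ereal h" and A: "0 < measure_pmf.prob q A"
  shows "0 < measure_pmf.prob p A"
    and "- measure_pmf.prob q A * ln (measure_pmf.prob p A) \<le> h + ln 2"
proof -
  have mq: "mean q (\<lambda>x. t * indicator A x) = t * measure_pmf.prob q A" for t :: real by simp
  have mp: "mean p (\<lambda>x. exp (t * indicator A x)) = 1 + (exp t - 1) * measure_pmf.prob p A" for t :: real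
  proof -
    have "(\<lambda>x. exp (t * indicator A x)) = (\<lambda>x. 1 + (exp t - 1) * indicator A x)"
      by (auto split: split_indicator)
    then show ?thesis using integrable_pmf_bounded[of "indicator A" p] by simp
  qed
  have bd: "bounded (range (\<lambda>x. t * indicator A x))" for t :: real
    by (intro bounded_range_intros)
  have key: "t * measure_pmf.prob q A \<le> h + ln 2" if "1 + (exp t - 1) * measure_pmf.prob p A \<le> 2" for t
  proof -
    have "ereal (mean q (\<lambda>x. t * indicator A x)) \<le> kl q p + ereal (ln 2)"
      by (rule kl_normalized_upper[OF bd]) (use that mp in auto)
    also have "\<dots> \<le> ereal h + ereal (ln 2)" using kl by (rule add_right_mono)
    finally show ?thesis by (simp add: mq)
  qed
  show pos: "0 < measure_pmf.prob p A"
  proof (rule ccontr)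
    assume "\<not> ?thesis"
    then have "measure_pmf.prob p A = 0" by (simp add: less_le)
    then have "((h + ln 2 + 1) / measure_pmf.prob q A) * measure_pmf.prob q A \<le> h + ln 2"
      by (intro key) simp
    then show False using A by simp
  qed
  have "exp (- ln (measure_pmf.prob p A)) * measure_pmf.prob p A = 1"
    using pos by (simp add: exp_minus)
  then have "(- ln (measure_pmf.prob p A)) * measure_pmf.prob q A \<le> h + ln 2"
    by (intro key) (simp add: left_diff_distrib)
  then show "- measure_pmf.prob q A * ln (measure_pmf.prob p A) \<le> h + ln 2"
    by (simp add: mult.commute)
qed

text \<open>
  Transfers an inequality between nearly optimal values to the suprema, which may be infinite.
  Nonnegativity provides a finite value below each supremum.
\<close>

lemma ereal_convex_le:
  fixes x y z :: ereal
  assumes ab: "0 < a" "0 < b" and xy: "0 \<le> x" "0 \<le> y"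
    and le: "\<And>c d. ereal c < x \<Longrightarrow> ereal d < y \<Longrightarrow> ereal (a * c + b * d) \<le> z"
  shows "ereal a * x + ereal b * y \<le> z"
proof -
  have neg: "ereal (- 1) < x" "ereal (- 1) < y"
    using xy by (auto intro: less_le_trans[of _ 0])
  consider "x = \<infinity>" | "y = \<infinity>" | r s where "x = ereal r" "y = ereal s"
    using xy by (cases x; cases y) auto
  then show ?thesis
  proof cases
    case 1
    have "ereal B \<le> z" for B
      using le[of "(B + b) / a" "- 1"] neg ab 1 by simp
    then have "z = \<infinity>" by (rule ereal_top)
    then show ?thesis by simp
  next
    case 2
    have "ereal B \<le> z" for B
      using le[of "- 1" "(B + a) / b"] neg ab 2 by simp
    then have "z = \<infinity>" by (rule ereal_top)
    then show ?thesis by simp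
  next
    case 3
    show ?thesis
    proof (cases z)
      case (real t)
      have "a * r + b * s \<le> t + e" if "0 < e" for e
      proof -
        have "a * (r - e / (a + b)) + b * (s - e / (a + b)) \<le> t"
          using le[of "r - e / (a + b)" "s - e / (a + b)"] 3 real ab that by simp
        moreover have "a * (e / (a + b)) + b * (e / (a + b)) = e"
          using ab by (simp add: add_divide_distrib[symmetric] distrib_right[symmetric])
        ultimately show ?thesis by (simp add: right_diff_distrib)
      qed
      then have "a * r + b * s \<le> t" by (rule field_le_epsilon)
      then show ?thesis using 3 real by simp
    next
      case MInf
      then show ?thesis using le[OF neg] by simp
    qed simp
  qed
qed

text \<open>
  The sum of a test function of one part and a test function of the other is a test function of the
  whole; its exponential moment factorises up to the constant \<open>c\<close>.
\<close>

lemma kl_superadditive: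
  assumes dom: "\<And>F G. bounded (range F) \<Longrightarrow> bounded (range G) \<Longrightarrow> (\<And>u. 0 \<le> F u) \<Longrightarrow> (\<And>v. 0 \<le> G v) \<Longrightarrow>
      mean p (\<lambda>w. F (s w) * G (t w)) \<le> c * (mean p1 F * mean p2 G)"
    and c: "0 < c"
  shows "kl (map_pmf s q) p1 + kl (map_pmf t q) p2 \<le> kl q p + ereal (ln c)"
proof -
  have "ereal 1 * kl (map_pmf s q) p1 + ereal 1 * kl (map_pmf t q) p2 \<le> kl q p + ereal (ln c)"
  proof (rule ereal_convex_le)
    fix x y assume x: "ereal x < kl (map_pmf s q) p1" and y: "ereal y < kl (map_pmf t q) p2"
    obtain f where f: "bounded (range f)" "mean p1 (\<lambda>x. exp (f x)) = 1" "x < mean (map_pmf s q) f"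
      by (rule kl_normalized[OF x])
    obtain g where g: "bounded (range g)" "mean p2 (\<lambda>x. exp (g x)) = 1" "y < mean (map_pmf t q) g"
      by (rule kl_normalized[OF y])
    note bd = bounded_range_comp[OF f(1), of s] bounded_range_comp[OF g(1), of t]
    have "mean p (\<lambda>w. exp (f (s w) + g (t w))) \<le> c"
      using dom[of "\<lambda>u. exp (f u)" "\<lambda>v. exp (g v)"] bounded_range_exp[OF f(1)] bounded_range_exp[OF g(1)] f(2) g(2)
      by (simp add: exp_add)
    then have "ereal (mean q (\<lambda>w. f (s w) + g (t w))) \<le> kl q p + ereal (ln c)"
      by (intro kl_normalized_upper bounded_range_arith bd c)
    from order_trans[OF _ this]
    show "ereal (1 * x + 1 * y) \<le> kl q p + ereal (ln c)"
      using f(3) g(3) bd by (simp add: integrable_pmf_bounded)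
  qed (simp_all add: kl_nonneg)
  then show ?thesis by (simp add: one_ereal_def[symmetric])
qed

lemma kl_mix_le:
  assumes "\<And>x. pmf q x = a * pmf q1 x + (1 - a) * pmf q2 x" and a: "0 \<le> a" "a \<le> 1"
  shows "kl q p \<le> ereal a * kl q1 p + ereal (1 - a) * kl q2 p"
proof (rule kl_least)
  fix f :: "'a \<Rightarrow> real" assume f: "bounded (range f)"
  let ?L = "ln (mean p (\<lambda>x. exp (f x)))"
  have "mean q f - ?L = a * (mean q1 f - ?L) + (1 - a) * (mean q2 f - ?L)"
    unfolding mean_mix[OF f assms(1)] by (simp add: algebra_simps)
  then have "ereal (mean q f - ?L) = ereal a * ereal (mean q1 f - ?L) + ereal (1 - a) * ereal (mean q2 f - ?L)"
    by simp
  also have "\<dots> \<le> ereal a * kl q1 p + ereal (1 - a) * kl q2 p"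
    using a by (intro add_mono ereal_mult_left_mono kl_upper f) auto
  finally show "ereal (mean q f - ?L) \<le> ereal a * kl q1 p + ereal (1 - a) * kl q2 p" .
qed

text \<open>
  Convexity of relative entropy has a converse up to \<open>ln 2\<close>: the maximum of two normalised test
  functions has exponential moment at most 2 and is at least as good as either of them. Divided by the
  block length, the error \<open>ln 2\<close> vanishes, so the limit is affine.
\<close>

lemma kl_mix_ge:
  assumes mix: "\<And>x. pmf q x = a * pmf q1 x + (1 - a) * pmf q2 x" and a: "0 \<le> a" "a \<le> 1"
  shows "ereal a * kl q1 p + ereal (1 - a) * kl q2 p \<le> kl q p + ereal (ln 2)"
proof -
  have ge: "kl q p \<le> kl q p + ereal (ln 2)"
    by (simp add: ereal_le_add_self)
  consider "a = 0" | "a = 1" | "0 < a" "0 < 1 - a" using a by linarith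
  then show ?thesis
  proof cases
    case 1
    then have "q = q2" using mix by (intro pmf_eqI) simp
    then show ?thesis using 1 ge by (simp add: zero_ereal_def[symmetric] one_ereal_def[symmetric])
  next
    case 2
    then have "q = q1" using mix by (intro pmf_eqI) simp
    then show ?thesis using 2 ge by (simp add: zero_ereal_def[symmetric] one_ereal_def[symmetric])
  next
    case 3
    then show ?thesis
    proof (rule ereal_convex_le)
      fix c d assume x: "ereal c < kl q1 p" and y: "ereal d < kl q2 p"
      obtain f where f: "bounded (range f)" "mean p (\<lambda>x. exp (f x)) = 1" "c < mean q1 f"
        by (rule kl_normalized[OF x])
      obtain g where g: "bounded (range g)" "mean p (\<lambda>x. exp (g x)) = 1" "d < mean q2 g"
        by (rule kl_normalized[OF y])
      let ?h = "\<lambda>x. max (f x) (g x)"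
      have h: "bounded (range ?h)" using f(1) g(1) by (rule bounded_range_arith)
      have "mean p (\<lambda>x. exp (?h x)) \<le> mean p (\<lambda>x. exp (f x) + exp (g x))"
        by (intro mean_mono bounded_range_intros f g) (auto simp: max_def)
      also have "\<dots> = 2"
        using f g by (simp add: integrable_pmf_bounded bounded_range_exp)
      finally have "ereal (mean q ?h) \<le> kl q p + ereal (ln 2)"
        by (intro kl_normalized_upper h) auto
      moreover have "a * c + (1 - a) * d \<le> mean q ?h"
        unfolding mean_mix[OF h mix]
      proof (intro add_mono mult_left_mono)
        have "mean q1 f \<le> mean q1 ?h" "mean q2 g \<le> mean q2 ?h"
          by (intro mean_mono f g h; simp)+
        then show "c \<le> mean q1 ?h" "d \<le> mean q2 ?h" using f g by auto
      qed (use a in auto)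
      ultimately show "ereal (a * c + (1 - a) * d) \<le> kl q p + ereal (ln 2)"
        by (meson ereal_less_eq(3) order_trans)
    qed (simp_all add: kl_nonneg)
  qed
qed

definition conc :: "'a list pmf \<Rightarrow> 'a list pmf \<Rightarrow> 'a list pmf" where
  "conc q p = map_pmf (\<lambda>(u, v). u @ v) (pair_pmf q p)"

text \<open>
  Fubini's theorem for bounded functions, reduced to nonnegative ones by adding the bound.
\<close>

lemma mean_pair_pmf:
  assumes "bounded (range f)"
  shows "mean (pair_pmf p q) f = mean p (\<lambda>u. mean q (\<lambda>v. f (u, v)))"
proof -
  obtain B where B: "\<And>x. \<bar>f x\<bar> \<le> B" using assms unfolding bounded_range_iff by auto
  define g where "g x = f x + B" for x
  have g: "bounded (range g)" "\<And>x. 0 \<le> g x" unfolding g_def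
  proof -
    show "bounded (range (\<lambda>x. f x + B))" by (intro bounded_range_intros assms)
    show "0 \<le> f x + B" for x using B[of x] by linarith
  qed
  have gu: "bounded (range (\<lambda>v. g (u, v)))" for u by (rule bounded_range_comp[OF g(1)])
  have gm: "bounded (range (\<lambda>u. mean q (\<lambda>v. g (u, v))))"
  proof (rule bounded_rangeI)
    fix u
    have "mean q (\<lambda>v. g (u, v)) \<le> mean q (\<lambda>v. 2 * B)"
      by (intro mean_mono gu bounded_range_const) (use B in \<open>auto simp: g_def abs_le_iff\<close>)
    moreover have "0 \<le> mean q (\<lambda>v. g (u, v))" using g by (simp add: integral_nonneg_AE)
    ultimately show "\<bar>mean q (\<lambda>v. g (u, v))\<bar> \<le> 2 * B" by simp
  qed
  have "ennreal (mean (pair_pmf p q) g) = (\<integral>\<^sup>+x. ennreal (g x) \<partial>pair_pmf p q)"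
    by (rule nn_integral_eq_integral[symmetric]) (auto intro: integrable_pmf_bounded g)
  also have "\<dots> = (\<integral>\<^sup>+u. \<integral>\<^sup>+v. ennreal (g (u, v)) \<partial>q \<partial>p)" by (rule nn_integral_pair_pmf')
  also have "\<dots> = (\<integral>\<^sup>+u. ennreal (mean q (\<lambda>v. g (u, v))) \<partial>p)"
    by (intro nn_integral_cong nn_integral_eq_integral) (auto intro: integrable_pmf_bounded gu g)
  also have "\<dots> = ennreal (mean p (\<lambda>u. mean q (\<lambda>v. g (u, v))))"
    by (rule nn_integral_eq_integral) (auto intro!: integrable_pmf_bounded gm integral_nonneg_AE g)
  finally have "mean (pair_pmf p q) g = mean p (\<lambda>u. mean q (\<lambda>v. g (u, v)))"
    by (subst (asm) ennreal_inj) (auto intro!: integral_nonneg_AE g)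
  moreover have "mean (pair_pmf p q) g = mean (pair_pmf p q) f + B"
  proof -
    have "g = (\<lambda>x. f x + B)" by (simp add: fun_eq_iff g_def)
    then show ?thesis by (simp add: integrable_pmf_bounded[OF assms])
  qed
  moreover have "mean p (\<lambda>u. mean q (\<lambda>v. g (u, v))) = mean p (\<lambda>u. mean q (\<lambda>v. f (u, v))) + B"
  proof -
    have e: "mean q (\<lambda>v. g (u, v)) = mean q (\<lambda>v. f (u, v)) + B" for u
      using integrable_pmf_bounded[OF bounded_range_comp[OF assms, of "Pair u"], of q] by (simp add: g_def)
    have "bounded (range (\<lambda>u. mean q (\<lambda>v. f (u, v))))"
      using bounded_range_arith(2)[OF gm bounded_range_const[of B]] by (simp add: e)
    then show ?thesis unfolding e by (simp add: integrable_pmf_bounded)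
  qed
  ultimately show ?thesis by simp
qed

lemma mean_conc:
  assumes "bounded (range f)"
  shows "mean (conc p q) f = mean p (\<lambda>u. mean q (\<lambda>v. f (u @ v)))"
proof -
  have "mean (conc p q) f = mean (pair_pmf p q) (\<lambda>x. f (case x of (u, v) \<Rightarrow> u @ v))"
    by (simp add: conc_def)
  also have "\<dots> = mean p (\<lambda>u. mean q (\<lambda>v. f (u @ v)))"
    by (subst mean_pair_pmf[OF bounded_range_comp[OF assms]]) simp
  finally show ?thesis .
qed

lemma set_pmf_conc: "set_pmf (conc p q) = (\<lambda>(u, v). u @ v) ` (set_pmf p \<times> set_pmf q)"
  by (simp add: conc_def)

lemma abs_mean_le:
  assumes "\<And>x. \<bar>f x\<bar> \<le> B"
  shows "\<bar>mean p f\<bar> \<le> B"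
proof -
  have b: "bounded (range f)" using assms by (rule bounded_rangeI)
  have "mean p f \<le> mean p (\<lambda>_. B)" "mean p (\<lambda>_. - B) \<le> mean p f"
    by (intro mean_mono b bounded_range_const; use assms in \<open>simp add: abs_le_iff minus_le_iff\<close>)+
  then show ?thesis by simp
qed

text \<open>
  Maximise over the second factor with the first one fixed. The optimal value
  \<open>g u = ln \<integral> exp f(uv) p\<^sub>2(dv)\<close> is a bounded function of the first factor and serves there as the test
  function.
\<close>

lemma kl_conc_le:
  assumes dom: "\<And>F. bounded (range F) \<Longrightarrow> (\<And>w. 0 \<le> F w) \<Longrightarrow> mean (conc p1 p2) F \<le> c * mean p F"
    and c: "0 < c"
  shows "kl (conc q1 q2) p \<le> kl q1 p1 + kl q2 p2 + ereal (ln c)"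
proof (cases "kl q1 p1 = \<infinity> \<or> kl q2 p2 = \<infinity>")
  case True
  then show ?thesis using kl_nonneg[of q1 p1] kl_nonneg[of q2 p2] by auto
next
  case False
  then obtain k1 k2 where k: "kl q1 p1 = ereal k1" "kl q2 p2 = ereal k2"
    using kl_nonneg[of q1 p1] kl_nonneg[of q2 p2] by (cases "kl q1 p1"; cases "kl q2 p2") auto
  show ?thesis
  proof (rule kl_least)
    fix f :: "'a list \<Rightarrow> real" assume f: "bounded (range f)"
    obtain B where B: "\<And>x. \<bar>f x\<bar> \<le> B" using f unfolding bounded_range_iff by auto
    define g where "g u = ln (mean p2 (\<lambda>v. exp (f (u @ v))))" for u
    have fu: "bounded (range (\<lambda>v. f (u @ v)))" for u by (rule bounded_range_comp[OF f])
    have eg: "exp (g u) = mean p2 (\<lambda>v. exp (f (u @ v)))" for u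
      unfolding g_def using mean_exp_pos[OF fu] by simp
    have g: "bounded (range g)"
    proof (rule bounded_rangeI)
      fix u
      have "mean p2 (\<lambda>v. exp (f (u @ v))) \<le> mean p2 (\<lambda>v. exp B)"
        by (intro mean_mono bounded_range_intros fu) (use B in \<open>auto simp: abs_le_iff\<close>)
      moreover have "mean p2 (\<lambda>v. exp (- B)) \<le> mean p2 (\<lambda>v. exp (f (u @ v)))"
        by (intro mean_mono bounded_range_intros fu) (use B in \<open>auto simp: abs_le_iff minus_le_iff\<close>)
      ultimately have "exp (g u) \<le> exp B" "exp (- B) \<le> exp (g u)" unfolding eg by auto
      then show "\<bar>g u\<bar> \<le> B" by (simp add: abs_le_iff minus_le_iff)
    qed
    have mb: "bounded (range (\<lambda>u. mean q2 (\<lambda>v. f (u @ v))))"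
      by (rule bounded_rangeI[where B=B]) (rule abs_mean_le, rule B)
    have "mean (conc q1 q2) f = mean q1 (\<lambda>u. mean q2 (\<lambda>v. f (u @ v)))" by (rule mean_conc[OF f])
    also have "\<dots> \<le> mean q1 (\<lambda>u. g u + k2)"
    proof (rule mean_mono[OF mb])
      fix u show "mean q2 (\<lambda>v. f (u @ v)) \<le> g u + k2"
        using kl_upper[OF fu[of u], of q2 p2] by (simp add: k g_def)
    qed (intro bounded_range_intros g)
    also have "\<dots> = mean q1 g + k2" using g by (simp add: integrable_pmf_bounded)
    also have "mean q1 g \<le> ln (mean p1 (\<lambda>u. exp (g u))) + k1"
      using kl_upper[OF g, of q1 p1] by (simp add: k)
    also have "mean p1 (\<lambda>u. exp (g u)) = mean (conc p1 p2) (\<lambda>w. exp (f w))"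
      unfolding eg by (rule mean_conc[symmetric]) (rule bounded_range_exp[OF f])
    also have "ln \<dots> \<le> ln (c * mean p (\<lambda>w. exp (f w)))"
      using mean_exp_pos[OF f] dom[OF bounded_range_exp[OF f]] c by simp
    also have "\<dots> = ln c + ln (mean p (\<lambda>w. exp (f w)))"
      using mean_exp_pos[OF f, of p] c by (simp add: ln_mult)
    finally show "ereal (mean (conc q1 q2) f - ln (mean p (\<lambda>w. exp (f w)))) \<le> kl q1 p1 + kl q2 p2 + ereal (ln c)"
      by (simp add: k)
  qed
qed

section \<open>The variational formula for relative entropy\<close>

text \<open>
  That no test function exceeds the relative entropy is \<open>1 + s \<le> exp s\<close> with \<open>s = f - ln \<integral> exp f dN - ln D\<close>,
  where \<open>D\<close> is the density, multiplied by \<open>D\<close> and integrated. Conversely the log density truncated at levels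
  \<open>n\<close> and \<open>- n\<close> is a test function with exponential moment at most \<open>1 + exp (- n)\<close>. The mean of
  its negative part is bounded because \<open>- D ln D \<le> 1\<close>, so finiteness of the supremum forces
  integrability of the log density.
\<close>

lemma rel_entropy_variational:
  fixes M N :: "'a measure"
  assumes M: "prob_space M" and N: "prob_space N" and sets: "sets M = sets N"
  shows "rel_entropy M N =
    (SUP f\<in>{f \<in> borel_measurable N. bounded (range f)}. ereal ((\<integral>x. f x \<partial>M) - ln (\<integral>x. exp (f x) \<partial>N)))"
    (is "_ = (SUP f\<in>?F. ?J f)")
proof -
  interpret M: prob_space M by fact
  interpret N: prob_space N by fact
  have mM: "borel_measurable M = (borel_measurable N :: ('a \<Rightarrow> real) set)" by (intro measurable_cong_sets sets refl)
  have bi: "integrable M f" "integrable N f" if "f \<in> borel_measurable N" "\<And>x. \<bar>f x\<bar> \<le> B" for f :: "'a \<Rightarrow> real" and B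
    using that mM by (auto intro!: M.integrable_const_bound[where B=B] N.integrable_const_bound[where B=B])
  have nonneg: "0 \<le> (SUP f\<in>?F. ?J f)"
    by (rule SUP_upper2[of "\<lambda>_. 0"]) (auto simp: zero_ereal_def N.prob_space M.prob_space)
  show ?thesis
  proof (cases "absolutely_continuous N M")
    case False
    then obtain A where A: "A \<in> null_sets N" "A \<notin> null_sets M" unfolding absolutely_continuous_def by auto
    have Am: "A \<in> sets N" "A \<in> sets M" using A sets by auto
    have pos: "0 < measure M A" using A(2) Am M.emeasure_eq_measure[of A]
      by (auto simp: null_sets_def zero_less_measure_iff)
    have "ereal B \<le> (SUP f\<in>?F. ?J f)" for B
    proof (rule SUP_upper2)
      let ?f = "\<lambda>x. (B / measure M A) * indicator A x :: real"
      have "bounded (range ?f)" by (intro bounded_range_intros)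
      then show "?f \<in> ?F" using Am by simp
      have "AE x in N. exp (?f x) = 1" using AE_not_in[OF A(1)] by eventually_elim simp
      then have "(\<integral>x. exp (?f x) \<partial>N) = (\<integral>x. 1 \<partial>N)"
        using Am by (intro integral_cong_AE) auto
      then show "ereal B \<le> ?J ?f" using Am pos by (simp add: N.prob_space)
    qed
    then have "(SUP f\<in>?F. ?J f) = \<infinity>" by (rule ereal_top)
    then show ?thesis using False by (simp add: rel_entropy_def)
  next
    case ac: True
    obtain D where D: "D \<in> borel_measurable N" "AE x in N. RN_deriv N M x = ennreal (D x)"
        "AE x in M. 0 < D x" "\<And>x. 0 \<le> D x"
      using N.real_RN_deriv[OF M.finite_measure_axioms ac sets] by metis
    have Mdens: "M = density N (\<lambda>x. ennreal (D x))"
    proof -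
      have "M = density N (RN_deriv N M)" by (rule N.density_RN_deriv[OF ac sets, symmetric])
      also have "\<dots> = density N (\<lambda>x. ennreal (D x))" by (rule density_cong) (use D in auto)
      finally show ?thesis .
    qed
    have int: "(\<integral>x. f x \<partial>M) = (\<integral>x. D x * f x \<partial>N)" "integrable M f \<longleftrightarrow> integrable N (\<lambda>x. D x * f x)"
      if "f \<in> borel_measurable N" for f :: "'a \<Rightarrow> real"
      using that D by (auto simp: Mdens integral_density integrable_density)
    have D1: "integrable N D" "(\<integral>x. D x \<partial>N) = 1"
      using int[of "\<lambda>_. 1"] M.prob_space by auto
    have lnD: "(\<lambda>x. ln (D x)) \<in> borel_measurable N" using D(1) by measurable
    have "AE x in N. entropy_density (exp 1) N M x = ln (D x)"
      using D(2) by eventually_elim (simp add: entropy_density_def log_def D(4))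
    then have ed: "AE x in M. entropy_density (exp 1) N M x = ln (D x)"
      by (rule absolutely_continuous_AE[OF sets ac])
    have "entropy_density (exp 1) N M \<in> borel_measurable N"
      unfolding entropy_density_def comp_def by measurable
    then have edm: "entropy_density (exp 1) N M \<in> borel_measurable M" unfolding mM .
    have re: "rel_entropy M N = (if integrable M (\<lambda>x. ln (D x)) then ereal (\<integral>x. ln (D x) \<partial>M) else \<infinity>)"
      using ac integrable_cong_AE[OF edm _ ed] integral_cong_AE[OF edm _ ed] lnD mM
      by (simp add: rel_entropy_def KL_divergence_def)
    show ?thesis
    proof (rule antisym)
      show "(SUP f\<in>?F. ?J f) \<le> rel_entropy M N"
      proof (cases "integrable M (\<lambda>x. ln (D x))")
        case True
        show ?thesis
        proof (rule SUP_least)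
          fix f :: "'a \<Rightarrow> real" assume "f \<in> ?F"
          then obtain B where f: "f \<in> borel_measurable N" "\<And>x. \<bar>f x\<bar> \<le> B" unfolding bounded_range_iff by auto
          define L where "L = ln (\<integral>x. exp (f x) \<partial>N)"
          have ef: "integrable N (\<lambda>x. exp (f x))"
            by (rule bi(2)[of _ "exp B"]) (use f in \<open>auto simp: abs_le_iff\<close>)
          have "(\<integral>x. exp (- B) \<partial>N) \<le> (\<integral>x. exp (f x) \<partial>N)"
            by (intro integral_mono ef) (use f in \<open>auto simp: abs_le_iff minus_le_iff\<close>)
          then have "0 < (\<integral>x. exp (f x) \<partial>N)" by (simp add: N.prob_space less_le_trans[OF exp_gt_zero])
          then have eL: "(\<integral>x. exp (f x - L) \<partial>N) = 1" by (simp add: exp_diff L_def)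
          have eL_int: "integrable N (\<lambda>x. exp (f x - L))" using ef by (simp add: exp_diff)
          have "(\<integral>x. f x \<partial>M) - L - (\<integral>x. ln (D x) \<partial>M) = (\<integral>x. f x - L - ln (D x) \<partial>M)"
            using bi(1)[OF f] True by (simp add: M.prob_space)
          also have "\<dots> = (\<integral>x. D x * (f x - L - ln (D x)) \<partial>N)"
            by (rule int) (use f lnD in measurable)
          also have "\<dots> \<le> (\<integral>x. exp (f x - L) - D x \<partial>N)"
          proof (rule integral_mono)
            show "integrable N (\<lambda>x. D x * (f x - L - ln (D x)))"
              by (subst int(2)[symmetric]) (use f lnD bi(1)[OF f] True in \<open>auto\<close>)
            show "integrable N (\<lambda>x. exp (f x - L) - D x)" using ef D1 by (simp add: exp_diff)
            show "D x * (f x - L - ln (D x)) \<le> exp (f x - L) - D x" for x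
            proof (cases "D x = 0")
              case False
              then have p: "0 < D x" using D(4)[of x] by simp
              have "f x - L - ln (D x) \<le> exp (f x - L - ln (D x)) - 1"
                using exp_ge_add_one_self[of "f x - L - ln (D x)"] by linarith
              also have "\<dots> = exp (f x - L) / D x - 1" using p by (simp add: exp_diff)
              finally have "D x * (f x - L - ln (D x)) \<le> D x * (exp (f x - L) / D x - 1)"
                using p by (intro mult_left_mono) auto
              also have "\<dots> = exp (f x - L) - D x" using p by (simp add: right_diff_distrib)
              finally show ?thesis .
            qed simp
          qed
          also have "\<dots> = 0" using eL_int D1 eL by simp
          finally show "?J f \<le> rel_entropy M N" using True by (simp add: re L_def)
        qed
      qed (simp add: re)
    next
      show "rel_entropy M N \<le> (SUP f\<in>?F. ?J f)"
      proof (cases "(SUP f\<in>?F. ?J f)")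
        case (real S)
        \<comment> \<open>Where the density vanishes the log density is minus infinity, while \<open>ln 0 = 0\<close>; the value
          \<open>- n\<close> is therefore prescribed there.\<close>
        define f where "f n x = (if 0 < D x then max (- real n) (min (real n) (ln (D x))) else - real n)" for n x
        define g where "g n x = min (real n) (max 0 (- ln (D x)))" for n x
        have clamp: "0 \<le> r \<Longrightarrow> min r \<bar>t\<bar> = max (- r) (min r t) + 2 * min r (max 0 (- t))"
            "0 \<le> r \<Longrightarrow> \<bar>max (- r) (min r t)\<bar> \<le> \<bar>t\<bar>"
            "\<bar>t\<bar> \<le> r \<Longrightarrow> max (- r) (min r t) = t" for r t :: real
          by (auto simp: min_def max_def)
        have fm: "f n \<in> borel_measurable N" "g n \<in> borel_measurable N" for n
          unfolding f_def g_def using D(1) by measurable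
        have fb: "\<bar>f n x\<bar> \<le> real n" "\<bar>g n x\<bar> \<le> real n" for n x by (auto simp: f_def g_def)
        have up: "(\<integral>x. f n x \<partial>M) \<le> S + exp (- real n)" for n
        proof -
          have "ereal ((\<integral>x. f n x \<partial>M) - ln (\<integral>x. exp (f n x) \<partial>N)) \<le> ereal S"
            unfolding real[symmetric] by (rule SUP_upper) (use fm bounded_rangeI[of "f n", OF fb(1)] in auto)
          moreover have "ln (\<integral>x. exp (f n x) \<partial>N) \<le> exp (- real n)"
          proof -
            have ei: "integrable N (\<lambda>x. exp (f n x))"
              by (rule bi(2)[of _ "exp (real n)"]) (use fm fb in \<open>auto simp: abs_le_iff\<close>)
            have "(\<integral>x. exp (- real n) \<partial>N) \<le> (\<integral>x. exp (f n x) \<partial>N)"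
              by (intro integral_mono ei) (use fb in \<open>auto simp: abs_le_iff minus_le_iff\<close>)
            then have p: "0 < (\<integral>x. exp (f n x) \<partial>N)" by (simp add: N.prob_space less_le_trans[OF exp_gt_zero])
            have "(\<integral>x. exp (f n x) \<partial>N) \<le> (\<integral>x. D x + exp (- real n) \<partial>N)"
            proof (intro integral_mono ei)
              show "exp (f n x) \<le> D x + exp (- real n)" for x
              proof (cases "0 < D x")
                case True
                then have "f n x \<le> ln (D x) \<or> f n x = - real n" by (auto simp: f_def)
                then have "exp (f n x) \<le> exp (ln (D x)) \<or> exp (f n x) = exp (- real n)" by auto
                then show ?thesis using True by (auto intro: add_increasing add_increasing2)
              qed (use D(4)[of x] in \<open>simp add: f_def\<close>)
            qed (use D1 in auto)
            also have "\<dots> = 1 + exp (- real n)" using D1 by (simp add: N.prob_space)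
            finally have "ln (\<integral>x. exp (f n x) \<partial>N) \<le> ln (1 + exp (- real n))" using p by (subst ln_le_cancel_iff) (auto intro: add_pos_pos)
            also have "\<dots> \<le> exp (- real n)" by (rule ln_add_one_self_le_self) simp
            finally show ?thesis .
          qed
          ultimately show ?thesis by simp
        qed
        have gneg: "(\<integral>x. g n x \<partial>M) \<le> 1" for n
        proof -
          have "(\<integral>x. g n x \<partial>M) = (\<integral>x. D x * g n x \<partial>N)" by (rule int) (rule fm)
          also have "\<dots> \<le> (\<integral>x. 1 \<partial>N)"
          proof (rule integral_mono)
            show "integrable N (\<lambda>x. D x * g n x)"
              using bi(1)[OF fm(2) fb(2)] by (simp add: int(2)[OF fm(2)])
            show "D x * g n x \<le> 1" for x
            proof (cases "D x = 0")
              case False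
              then have p: "0 < D x" using D(4)[of x] by simp
              have "- ln (D x) \<le> 1 / D x - 1" using ln_le_minus_one[of "1 / D x"] p by (simp add: ln_div)
              then have "max 0 (- ln (D x)) \<le> 1 / D x" using p by (auto simp: max_def intro: order_trans)
              then have "g n x \<le> 1 / D x" unfolding g_def by (rule min.coboundedI2)
              then have "D x * g n x \<le> D x * (1 / D x)" using p by (intro mult_left_mono) auto
              then show ?thesis using p by simp
            qed simp
          qed simp
          finally show ?thesis by (simp add: N.prob_space)
        qed
        have Mm: "(\<lambda>x. ln (D x)) \<in> borel_measurable M" "\<And>n. f n \<in> borel_measurable M" "\<And>n. g n \<in> borel_measurable M"
          using lnD fm mM by auto
        \<comment> \<open>\<open>min n \<bar>ln D\<bar> = f n + 2 g n\<close>, with the truncated negative part \<open>g n\<close>; both means are bounded.\<close>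
        have bound: "(\<integral>\<^sup>+x. ennreal (min (real n) \<bar>ln (D x)\<bar>) \<partial>M) \<le> ennreal (S + 3)" for n
        proof -
          have "(\<integral>\<^sup>+x. ennreal (min (real n) \<bar>ln (D x)\<bar>) \<partial>M) = ennreal (\<integral>x. min (real n) \<bar>ln (D x)\<bar> \<partial>M)"
            by (rule nn_integral_eq_integral) (use Mm in \<open>auto intro!: M.integrable_const_bound[where B="real n"]\<close>)
          also have "(\<integral>x. min (real n) \<bar>ln (D x)\<bar> \<partial>M) = (\<integral>x. f n x + 2 * g n x \<partial>M)"
          proof (rule integral_cong_AE)
            show "AE x in M. min (real n) \<bar>ln (D x)\<bar> = f n x + 2 * g n x"
              using D(3) by eventually_elim (simp only: f_def g_def if_True clamp(1)[of "real n"] of_nat_0_le_iff)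
          qed (use Mm in measurable)
          also have "\<dots> = (\<integral>x. f n x \<partial>M) + 2 * (\<integral>x. g n x \<partial>M)"
            using bi(1)[OF fm(1) fb(1)] bi(1)[OF fm(2) fb(2)] by simp
          also have "\<dots> \<le> S + 3"
          proof -
            have "exp (- real n) \<le> 1" by simp
            then show ?thesis using up[of n] gneg[of n] by linarith
          qed
          finally show ?thesis by (simp add: ennreal_leI)
        qed
        have integ: "integrable M (\<lambda>x. ln (D x))"
        proof (rule integrableI_bounded)
          have "(\<integral>\<^sup>+x. ennreal (norm (ln (D x))) \<partial>M) = (\<integral>\<^sup>+x. (SUP n. ennreal (min (real n) \<bar>ln (D x)\<bar>)) \<partial>M)"
          proof (rule nn_integral_cong)
            fix x
            obtain k where k: "\<bar>ln (D x)\<bar> \<le> real k" using real_arch_simple by blast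
            show "ennreal (norm (ln (D x))) = (SUP n. ennreal (min (real n) \<bar>ln (D x)\<bar>))"
            proof (rule antisym)
              show "ennreal (norm (ln (D x))) \<le> (SUP n. ennreal (min (real n) \<bar>ln (D x)\<bar>))"
                by (rule SUP_upper2[of k]) (use k in auto)
            qed (auto intro!: SUP_least ennreal_leI)
          qed
          also have "\<dots> = (SUP n. \<integral>\<^sup>+x. ennreal (min (real n) \<bar>ln (D x)\<bar>) \<partial>M)"
            by (rule nn_integral_monotone_convergence_SUP)
               (use Mm in \<open>auto simp: incseq_def le_fun_def intro!: ennreal_leI\<close>)
          also have "\<dots> \<le> ennreal (S + 3)" by (rule SUP_least) (rule bound)
          finally show "(\<integral>\<^sup>+x. ennreal (norm (ln (D x))) \<partial>M) < \<infinity>" by (simp add: le_less_trans)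
        qed (rule Mm)
        have "(\<lambda>n. \<integral>x. f n x \<partial>M) \<longlonglongrightarrow> (\<integral>x. ln (D x) \<partial>M)"
        proof (rule integral_dominated_convergence[where w="\<lambda>x. \<bar>ln (D x)\<bar>"])
          show "AE x in M. (\<lambda>n. f n x) \<longlonglongrightarrow> ln (D x)"
            using D(3)
          proof eventually_elim
            case (elim x)
            obtain k where k: "\<bar>ln (D x)\<bar> \<le> real k" using real_arch_simple by blast
            have "eventually (\<lambda>n. f n x = ln (D x)) sequentially"
              using eventually_ge_at_top[of k] by eventually_elim (use elim k in \<open>simp only: f_def if_True clamp(3) of_nat_le_iff order_trans[of _ "real k"]\<close>)
            then show ?case by (rule tendsto_eventually)
          qed
          show "AE x in M. norm (f n x) \<le> \<bar>ln (D x)\<bar>" for n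
            using D(3) by eventually_elim (simp only: f_def if_True clamp(2) of_nat_0_le_iff real_norm_def)
        qed (use Mm integ in auto)
        moreover have "(\<lambda>n. S + exp (- real n)) \<longlonglongrightarrow> S + 0"
          by (intro tendsto_add tendsto_const filterlim_compose[OF exp_at_bot] filterlim_compose[OF filterlim_uminus_at_bot_at_top] filterlim_real_sequentially)
        ultimately have "(\<integral>x. ln (D x) \<partial>M) \<le> S + 0"
          by (rule LIMSEQ_le) (use up in auto)
        then show ?thesis using integ real by (simp add: re)
      next
        case MInf
        then show ?thesis using nonneg by simp
      qed simp
    qed
  qed
qed

text \<open>
  Bounded measurable functions of the coordinates \<open>1, \<dots>, n\<close> and bounded functions of lists of length \<open>n\<close>
  are the same test functions, read in two ways.
\<close>

lemma rel_entropy_marginal: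
  fixes A :: "'a::countable set"
  assumes Q: "Q \<in> inv_laws A" and P: "P \<in> inv_laws A"
  shows "rel_entropy (marginal A n Q) (marginal A n P) = kl (block_law n Q) (block_law n P)"
proof -
  let ?X = "PiM {1..int n} (\<lambda>_. count_space A)"
  let ?r = "\<lambda>x::int\<Rightarrow>'a. restrict x {1..int n}"
  have r: "?r \<in> measurable L ?X" if "L \<in> inv_laws A" for L
  proof -
    have "?r \<in> measurable (seq_space A) ?X" unfolding seq_space_def by measurable
    then show ?thesis using inv_lawsD(1)[OF that] by (simp cong: measurable_cong_sets)
  qed
  have pr: "prob_space (marginal A n L)" if "L \<in> inv_laws A" for L
    unfolding marginal_def by (rule prob_space.prob_space_distr[OF inv_lawsD(2)[OF that] r[OF that]])
  have im: "(\<integral>x. h x \<partial>marginal A n L) = (\<integral>y. h (?r y) \<partial>L)" if "L \<in> inv_laws A" "h \<in> borel_measurable ?X" for L and h :: "_ \<Rightarrow> real"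
    unfolding marginal_def using r[OF that(1)] that(2) by (rule integral_distr)
  have F: "{f \<in> borel_measurable (marginal A n P). bounded (range f)} = {f \<in> borel_measurable ?X. bounded (range f)}"
    by (simp add: marginal_def)
  have win: "(\<lambda>x. map x [1..int n]) \<in> measurable ?X (count_space UNIV)"
  proof -
    have "(\<lambda>x. map x js) \<in> measurable ?X (count_space UNIV)" if "set js \<subseteq> {1..int n}" for js
      using that
    proof (induction js)
      case (Cons k js)
      have "(\<lambda>x. x k) \<in> measurable ?X (count_space A)"
        by (rule measurable_component_singleton) (use Cons in auto)
      then have 1: "(\<lambda>x. x k) \<in> measurable ?X (count_space UNIV)"
        by (rule measurable_compose) simp
      have "(\<lambda>x. (x k # map x js)) \<in> measurable ?X (count_space UNIV)"
        by (rule measurable_compose_countable[OF _ 1, where f="\<lambda>a x. a # map x js"])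
           (rule measurable_compose[OF Cons.IH], use Cons.prems in auto)
      then show ?case by simp
    qed simp
    then show ?thesis by simp
  qed
  have mr: "map (?r y) [1..int n] = block n y" for y
    by (simp add: block_def)
  have V: "rel_entropy (marginal A n Q) (marginal A n P) = (SUP f\<in>{f :: (int \<Rightarrow> 'a) \<Rightarrow> real. f \<in> borel_measurable ?X \<and> bounded (range f)}.
      ereal ((\<integral>x. f x \<partial>marginal A n Q) - ln (\<integral>x. exp (f x) \<partial>marginal A n P)))"
    using rel_entropy_variational[OF pr[OF Q] pr[OF P]] by (simp add: F) (simp add: marginal_def)
  show ?thesis
  proof (rule antisym)
    show "rel_entropy (marginal A n Q) (marginal A n P) \<le> kl (block_law n Q) (block_law n P)"
      unfolding V
    proof (rule SUP_least)
      fix f :: "(int \<Rightarrow> 'a) \<Rightarrow> real" assume "f \<in> {f \<in> borel_measurable ?X. bounded (range f)}"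
      then have f: "f \<in> borel_measurable ?X" "bounded (range f)" by auto
      define f' where "f' u = f (\<lambda>i\<in>{1..int n}. u ! nat (i - 1))" for u :: "'a list"
      have f': "f (?r y) = f' (block n y)" for y
        unfolding f'_def block_def by (rule arg_cong[where f=f]) (auto simp: fun_eq_iff)
      have "bounded (range f')" unfolding f'_def by (rule bounded_range_comp[OF f(2)])
      then have "ereal (mean (block_law n Q) f' - ln (mean (block_law n P) (\<lambda>x. exp (f' x)))) \<le> kl (block_law n Q) (block_law n P)"
        by (rule kl_upper)
      moreover have "(\<integral>x. f x \<partial>marginal A n Q) = mean (block_law n Q) f'"
        unfolding im[OF Q f(1)] expectation_block_law[OF Q] f' by (rule refl)
      moreover have "(\<lambda>x. exp (f x)) \<in> borel_measurable ?X" using f(1) by measurable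
      then have "(\<integral>x. exp (f x) \<partial>marginal A n P) = mean (block_law n P) (\<lambda>x. exp (f' x))"
        unfolding im[OF P \<open>(\<lambda>x. exp (f x)) \<in> borel_measurable ?X\<close>] expectation_block_law[OF P] f' by simp
      ultimately show "ereal ((\<integral>x. f x \<partial>marginal A n Q) - ln (\<integral>x. exp (f x) \<partial>marginal A n P)) \<le> kl (block_law n Q) (block_law n P)"
        by simp
    qed
    show "kl (block_law n Q) (block_law n P) \<le> rel_entropy (marginal A n Q) (marginal A n P)"
    proof (rule kl_least)
      fix f :: "'a list \<Rightarrow> real" assume f: "bounded (range f)"
      define f' where "f' x = f (map x [1..int n])" for x :: "int \<Rightarrow> 'a"
      have m: "f' \<in> borel_measurable ?X" unfolding f'_def by (rule measurable_compose[OF win]) simp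
      have m2: "(\<lambda>x. exp (f' x)) \<in> borel_measurable ?X" using m by measurable
      have "bounded (range f')" unfolding f'_def by (rule bounded_range_comp[OF f])
      then show "ereal (mean (block_law n Q) f - ln (mean (block_law n P) (\<lambda>x. exp (f x)))) \<le> rel_entropy (marginal A n Q) (marginal A n P)"
        unfolding V
      proof (intro SUP_upper2[of f'])
        have "(\<integral>x. f' x \<partial>marginal A n Q) = mean (block_law n Q) f"
          unfolding im[OF Q m] expectation_block_law[OF Q] by (simp add: f'_def mr)
        moreover have "(\<integral>x. exp (f' x) \<partial>marginal A n P) = mean (block_law n P) (\<lambda>x. exp (f x))"
          unfolding im[OF P m2] expectation_block_law[OF P] by (simp add: f'_def mr)
        ultimately show "ereal (mean (block_law n Q) f - ln (mean (block_law n P) (\<lambda>x. exp (f x)))) \<le> ereal ((\<integral>x. f' x \<partial>marginal A n Q) - ln (\<integral>x. exp (f' x) \<partial>marginal A n P))"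
          by simp
      qed (simp add: m)
    qed
  qed
qed

section \<open>The weak topology is the topology of cylinder probabilities\<close>

text \<open>
  The cylinder probabilities are the coordinates in which stationary laws are handled: the weak
  topology is pulled back from the product topology along this map.
\<close>

definition cyl :: "(int \<Rightarrow> 'a) measure \<Rightarrow> 'a list \<Rightarrow> real" where
  "cyl Q u = pmf (block_law (length u) Q) u"

lemma topspace_seq_topology: "topspace (seq_topology A) = space (seq_space A)"
  by (simp add: seq_topology_def seq_space_def space_PiM)

lemma openin_agree:
  assumes "y \<in> space (seq_space A)"
  shows "openin (seq_topology A) {z \<in> space (seq_space A). \<forall>j\<in>set js. z j = y j}"
proof -
  have "{z \<in> space (seq_space A). \<forall>j\<in>set js. z j = y j} = Pi\<^sub>E UNIV (\<lambda>i. if i \<in> set js then {y i} else A)"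
    using assms by (auto simp: space_seq_space PiE_iff split: if_splits)
  moreover have "openin (seq_topology A) (Pi\<^sub>E UNIV (\<lambda>i. if i \<in> set js then {y i} else A))"
    unfolding seq_topology_def
  proof (rule product_topology_basis)
    show "finite {i. (if i \<in> set js then {y i} else A) \<noteq> topspace (discrete_topology A)}"
      by (rule finite_subset[of _ "set js"]) auto
  qed (use assms in \<open>auto simp: space_seq_space\<close>)
  ultimately show ?thesis by simp
qed

lemma continuous_map_window:
  "continuous_map (seq_topology A) euclideanreal (\<lambda>y. f (map y js) :: real)"
proof -
  have "openin (seq_topology A) {y \<in> topspace (seq_topology A). f (map y js) \<in> U}" for U
  proof (subst openin_subopen, intro ballI)
    fix y assume y: "y \<in> {y \<in> topspace (seq_topology A). f (map y js) \<in> U}"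
    let ?T = "{z \<in> space (seq_space A). \<forall>j\<in>set js. z j = y j}"
    have "?T \<subseteq> {y \<in> topspace (seq_topology A). f (map y js) \<in> U}"
    proof
      fix z assume z: "z \<in> ?T"
      then have "map z js = map y js" by simp
      then show "z \<in> {y \<in> topspace (seq_topology A). f (map y js) \<in> U}"
        using y z unfolding topspace_seq_topology mem_Collect_eq by metis
    qed
    moreover have "y \<in> ?T" using y by (simp add: topspace_seq_topology)
    moreover have "openin (seq_topology A) ?T" using y by (intro openin_agree) (simp add: topspace_seq_topology)
    ultimately show "\<exists>T. openin (seq_topology A) T \<and> y \<in> T \<and> T \<subseteq> {y \<in> topspace (seq_topology A). f (map y js) \<in> U}"
      by blast
  qed
  then show ?thesis by (simp add: continuous_map_def)
qed

lemma openin_weak_topology_block: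
  fixes A :: "'a::countable set"
  assumes f: "bounded (range (f :: 'a list \<Rightarrow> real))" and U: "open U"
  shows "openin (weak_topology A) {Q \<in> inv_laws A. mean (block_law n Q) f \<in> U}"
proof -
  obtain B where B: "\<And>x. \<bar>f x\<bar> \<le> B" using f unfolding bounded_range_iff by auto
  have "{Q \<in> inv_laws A. mean (block_law n Q) f \<in> U} = {Q \<in> inv_laws A. (\<integral>y. f (block n y) \<partial>Q) \<in> U}"
    by (auto simp: expectation_block_law)
  moreover have "openin (weak_topology A) \<dots>"
    unfolding weak_topology_def
  proof (rule topology_generated_by_Basis, rule CollectI, intro exI conjI)
    show "continuous_map (seq_topology A) euclideanreal (\<lambda>y. f (block n y))"
      unfolding block_def by (rule continuous_map_window)
    show "\<forall>x\<in>topspace (seq_topology A). \<bar>f (block n x)\<bar> \<le> B" using B by simp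
    show "open U" by fact
  qed simp
  ultimately show ?thesis by simp
qed

definition finite_exhaustion :: "nat \<Rightarrow> 'a::countable set" where
  "finite_exhaustion m = {u. to_nat u < m}"

lemma finite_finite_exhaustion: "finite (finite_exhaustion m)"
  unfolding finite_exhaustion_def
  by (rule finite_imageD[of to_nat]) (auto intro: finite_subset[of _ "{..<m}"])

lemma mean_finite_exhaustion:
  fixes g :: "'a::countable \<Rightarrow> real"
  assumes g: "bounded (range g)"
  shows "(\<lambda>m. \<Sum>u\<in>finite_exhaustion m. pmf p u * g u) \<longlonglongrightarrow> mean p g"
proof -
  obtain B where B: "\<And>x. \<bar>g x\<bar> \<le> B" using g unfolding bounded_range_iff by auto
  have "(\<lambda>m. mean p (\<lambda>u. g u * indicator (finite_exhaustion m) u)) \<longlonglongrightarrow> mean p g"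
  proof (rule integral_dominated_convergence[where w="\<lambda>_. B"])
    show "AE x in p. (\<lambda>i. g x * indicator (finite_exhaustion i) x) \<longlonglongrightarrow> g x"
    proof (rule AE_I2)
      fix x
      have "eventually (\<lambda>m. g x * indicator (finite_exhaustion m) x = g x) sequentially"
        using eventually_gt_at_top[of "to_nat x"] by eventually_elim (simp add: finite_exhaustion_def)
      then show "(\<lambda>m. g x * indicator (finite_exhaustion m) x) \<longlonglongrightarrow> g x" by (rule tendsto_eventually)
    qed
    show "AE x in p. norm (g x * indicator (finite_exhaustion i) x) \<le> B" for i
      by (rule AE_I2) (use B order_trans[OF abs_ge_zero B] in \<open>auto split: split_indicator\<close>)
  qed auto
  moreover have "mean p (\<lambda>u. g u * indicator (finite_exhaustion m) u) = (\<Sum>u\<in>finite_exhaustion m. pmf p u * g u)" for m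
    by (subst integral_measure_pmf[OF finite_finite_exhaustion[of m]]) (auto split: split_indicator_asm)
  ultimately show ?thesis by simp
qed

text \<open>
  After adding a constant the function is nonnegative, and its mean is then a supremum of finite sums
  of cylinder probabilities, each of which is continuous.
\<close>

lemma openin_pullback_block:
  fixes A :: "'a::countable set"
  assumes g: "bounded (range (g :: 'a list \<Rightarrow> real))"
  shows "openin (pullback_topology (inv_laws A) cyl euclidean) {Q \<in> inv_laws A. c < mean (block_law n Q) g}"
proof -
  obtain B where B: "\<And>x. \<bar>g x\<bar> \<le> B" using g unfolding bounded_range_iff by auto
  define h where "h x = g x + B" for x
  have h: "bounded (range h)" "\<And>x. 0 \<le> h x"
  proof -
    have "h = (\<lambda>x. g x + B)" by (simp add: fun_eq_iff h_def)
    then show "bounded (range h)" using bounded_range_arith(1)[OF g bounded_range_const] by simp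
    show "0 \<le> h x" for x using B[of x] by (simp add: h_def)
  qed
  define V where "V m = {q. c + B < (\<Sum>u\<in>finite_exhaustion m. if length u = n then q u * h u else 0)}" for m
  have V: "open (V m)" for m
    unfolding V_def
  proof (intro open_Collect_less continuous_on_sum continuous_on_const)
    show "continuous_on UNIV (\<lambda>q. if length u = n then q u * h u else 0)" for u
      by (cases "length u = n") (auto intro!: continuous_intros)
  qed
  have "{Q \<in> inv_laws A. c < mean (block_law n Q) g} = cyl -` (\<Union>m. V m) \<inter> inv_laws A"
  proof (intro set_eqI iffI)
    fix Q assume "Q \<in> {Q \<in> inv_laws A. c < mean (block_law n Q) g}"
    then have Q: "Q \<in> inv_laws A" "c < mean (block_law n Q) g" by auto
    have mh: "mean (block_law n Q) h = mean (block_law n Q) g + B"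
      using integrable_pmf_bounded[OF g] by (simp add: h_def[abs_def])
    have "c + B < mean (block_law n Q) h" using Q mh by simp
    from order_tendstoD(1)[OF mean_finite_exhaustion[OF h(1)] this]
    obtain m where m: "c + B < (\<Sum>u\<in>finite_exhaustion m. pmf (block_law n Q) u * h u)"
      by (auto simp: eventually_sequentially)
    have "(\<Sum>u\<in>finite_exhaustion m. pmf (block_law n Q) u * h u) = (\<Sum>u\<in>finite_exhaustion m. if length u = n then cyl Q u * h u else 0)"
      using set_pmf_block_law[OF Q(1), of n] by (intro sum.cong) (auto simp: cyl_def pmf_eq_0_set_pmf)
    with m Q show "Q \<in> cyl -` (\<Union>m. V m) \<inter> inv_laws A" by (auto simp: V_def)
  next
    fix Q assume "Q \<in> cyl -` (\<Union>m. V m) \<inter> inv_laws A"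
    then obtain m where Q: "Q \<in> inv_laws A" and
       m: "c + B < (\<Sum>u\<in>finite_exhaustion m. if length u = n then cyl Q u * h u else 0)" by (auto simp: V_def)
    have mh: "mean (block_law n Q) h = mean (block_law n Q) g + B"
      using integrable_pmf_bounded[OF g] by (simp add: h_def[abs_def])
    have "(\<Sum>u\<in>finite_exhaustion m. if length u = n then cyl Q u * h u else 0) = (\<Sum>u\<in>finite_exhaustion m. pmf (block_law n Q) u * h u)"
      using set_pmf_block_law[OF Q, of n] by (intro sum.cong) (auto simp: cyl_def pmf_eq_0_set_pmf)
    also have "\<dots> = mean (block_law n Q) (\<lambda>u. h u * indicator (finite_exhaustion m) u)"
      by (subst integral_measure_pmf[OF finite_finite_exhaustion[of m]]) (auto split: split_indicator_asm)
    also have "\<dots> \<le> mean (block_law n Q) h"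
      by (intro mean_mono bounded_range_intros h) (use h(2) in \<open>auto split: split_indicator\<close>)
    finally show "Q \<in> {Q \<in> inv_laws A. c < mean (block_law n Q) g}" using m mh Q by simp
  qed
  then show ?thesis unfolding openin_pullback_topology using V by (auto intro!: exI[of _ "\<Union>m. V m"])
qed

text \<open>
  The largest function of a window that lies below \<open>f\<close>. Lists that are not windows of any admissible
  sequence get the harmless value 0, which keeps the function bounded.
\<close>

definition window_inf :: "'a set \<Rightarrow> ((int \<Rightarrow> 'a) \<Rightarrow> real) \<Rightarrow> nat \<Rightarrow> 'a list \<Rightarrow> real" where
  "window_inf A f m u = (let Y = {y \<in> space (seq_space A). map y [- int m + 1..int m] = u} in
     if Y = {} then 0 else Inf (f ` Y))"

lemma window_inf_le:
  assumes "y \<in> space (seq_space A)" "\<And>y. y \<in> space (seq_space A) \<Longrightarrow> \<bar>f y\<bar> \<le> B"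
  shows "window_inf A f m (map y [- int m + 1..int m]) \<le> f y"
proof -
  let ?Y = "{z \<in> space (seq_space A). map z [- int m + 1..int m] = map y [- int m + 1..int m]}"
  have "bdd_below (f ` ?Y)" using assms(2) by (intro bdd_belowI[of _ "- B"]) (auto simp: abs_le_iff minus_le_iff)
  then have "Inf (f ` ?Y) \<le> f y" using assms(1) by (intro cInf_lower) auto
  moreover have "?Y \<noteq> {}" using assms(1) by blast
  ultimately show ?thesis unfolding window_inf_def Let_def by (simp only: if_False)
qed

lemma window_inf_ge:
  assumes "y \<in> space (seq_space A)"
    "\<And>z. z \<in> space (seq_space A) \<Longrightarrow> map z [- int m + 1..int m] = map y [- int m + 1..int m] \<Longrightarrow> c \<le> f z"
  shows "c \<le> window_inf A f m (map y [- int m + 1..int m])"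
proof -
  let ?Y = "{z \<in> space (seq_space A). map z [- int m + 1..int m] = map y [- int m + 1..int m]}"
  have ne: "?Y \<noteq> {}" using assms(1) by blast
  then have "c \<le> Inf (f ` ?Y)" using assms(2) by (intro cInf_greatest) auto
  then show ?thesis unfolding window_inf_def Let_def using ne by (simp only: if_False)
qed

lemma bounded_window_inf:
  assumes "\<And>y. y \<in> space (seq_space A) \<Longrightarrow> \<bar>f y\<bar> \<le> B"
  shows "bounded (range (window_inf A f m))"
proof (rule bounded_rangeI)
  fix u
  show "\<bar>window_inf A f m u\<bar> \<le> \<bar>B\<bar>"
  proof (cases "{y \<in> space (seq_space A). map y [- int m + 1..int m] = u} = {}")
    case False
    then obtain y where y: "y \<in> space (seq_space A)" and u: "u = map y [- int m + 1..int m]" by auto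
    have "window_inf A f m u \<le> f y" unfolding u by (rule window_inf_le) (use y assms in auto)
    moreover have "- B \<le> window_inf A f m u" unfolding u
      by (rule window_inf_ge) (use y assms in \<open>auto simp: abs_le_iff minus_le_iff\<close>)
    ultimately show ?thesis using assms[OF y] by linarith
  qed (simp add: window_inf_def)
qed

text \<open>
  A neighbourhood in the product of discrete spaces fixes finitely many coordinates, and every large
  window contains them.
\<close>

lemma window_inf_tendsto:
  assumes f: "continuous_map (seq_topology A) euclideanreal f"
    and B: "\<And>y. y \<in> space (seq_space A) \<Longrightarrow> \<bar>f y\<bar> \<le> B" and y: "y \<in> space (seq_space A)"
  shows "(\<lambda>m. window_inf A f m (map y [- int m + 1..int m])) \<longlonglongrightarrow> f y"
proof (rule LIMSEQ_I)
  fix e :: real assume e: "0 < e"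
  let ?S = "{z \<in> topspace (seq_topology A). f z \<in> {f y - e / 2<..}}"
  have "openin (product_topology (\<lambda>_. discrete_topology A) UNIV) ?S"
    unfolding seq_topology_def[symmetric] by (rule openin_continuous_map_preimage[OF f]) simp
  moreover have "y \<in> ?S" using y e by (simp add: topspace_seq_topology)
  ultimately have "\<exists>X. finite {i \<in> UNIV. X i \<noteq> topspace (discrete_topology A)} \<and>
      (\<forall>i \<in> UNIV. openin (discrete_topology A) (X i)) \<and> y \<in> Pi\<^sub>E UNIV X \<and> Pi\<^sub>E UNIV X \<subseteq> ?S"
    unfolding openin_product_topology_alt by (rule bspec)
  then obtain X where X: "finite {i. X i \<noteq> A}" "y \<in> Pi\<^sub>E UNIV X" "Pi\<^sub>E UNIV X \<subseteq> {z \<in> topspace (seq_topology A). f z \<in> {f y - e / 2<..}}"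
    by auto
  obtain b where b: "\<And>i. X i \<noteq> A \<Longrightarrow> \<bar>i\<bar> < int b"
  proof -
    have "bdd_above (abs ` {i. X i \<noteq> A})" using X(1) by (intro bdd_above_finite) simp
    then obtain c where "\<And>i. X i \<noteq> A \<Longrightarrow> \<bar>i\<bar> \<le> c" unfolding bdd_above_def by auto
    then show ?thesis by (intro that[of "nat c + 1"]) force
  qed
  show "\<exists>no. \<forall>m\<ge>no. norm (window_inf A f m (map y [- int m + 1..int m]) - f y) < e"
  proof (intro exI allI impI)
    fix m assume m: "b \<le> m"
    have "f y - e / 2 \<le> window_inf A f m (map y [- int m + 1..int m])"
    proof (rule window_inf_ge[OF y])
      fix z assume z: "z \<in> space (seq_space A)" "map z [- int m + 1..int m] = map y [- int m + 1..int m]"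
      have "z i \<in> X i" for i
      proof (cases "X i = A")
        case False
        then have "i \<in> {- int m + 1..int m}" using b[of i] m by auto
        then have "z i = y i" using z(2) by auto
        then show ?thesis using X(2) by auto
      qed (use z in \<open>simp add: space_seq_space\<close>)
      then have "z \<in> Pi\<^sub>E UNIV X" by auto
      then show "f y - e / 2 \<le> f z" using X(3) by auto
    qed
    moreover have "window_inf A f m (map y [- int m + 1..int m]) \<le> f y" by (rule window_inf_le[OF y B])
    ultimately show "norm (window_inf A f m (map y [- int m + 1..int m]) - f y) < e" using e by (simp add: abs_less_iff)
  qed
qed

lemma openin_pullback_lsc:
  fixes A :: "'a::countable set"
  assumes f: "continuous_map (seq_topology A) euclideanreal f"
    and B: "\<And>y. y \<in> space (seq_space A) \<Longrightarrow> \<bar>f y\<bar> \<le> B"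
  shows "openin (pullback_topology (inv_laws A) cyl euclidean) {Q \<in> inv_laws A. c < (\<integral>y. f y \<partial>Q)}"
proof -
  let ?w = "\<lambda>m (y :: int \<Rightarrow> 'a). map y [- int m + 1..int m]"
  have fm: "f \<in> borel_measurable (seq_space A)"
    by (rule borel_measurable_LIMSEQ_real[OF window_inf_tendsto[OF f B]])
       (auto intro: measurable_compose[OF measurable_window])
  have eq: "c < (\<integral>y. f y \<partial>Q) \<longleftrightarrow> (\<exists>m. c < mean (block_law (2 * m) Q) (window_inf A f m))" if Q: "Q \<in> inv_laws A" for Q
  proof -
    interpret prob_space Q by (rule inv_lawsD[OF Q])
    have sp: "space Q = space (seq_space A)" by (rule inv_lawsD[OF Q])
    have m: "mean (block_law (2 * m) Q) (window_inf A f m) = (\<integral>y. window_inf A f m (?w m y) \<partial>Q)" for m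
      using expectation_window[OF Q, of "window_inf A f m" "- int m" "2 * m"] by simp
    have mm: "(\<lambda>y. window_inf A f m (?w m y)) \<in> borel_measurable Q" for m
      by (rule measurable_compose[OF measurable_window_inv(1)[OF Q]]) simp
    have fQ: "f \<in> borel_measurable Q" using fm inv_lawsD(1)[OF Q] by (simp cong: measurable_cong_sets)
    have bw: "AE y in Q. norm (window_inf A f m (?w m y)) \<le> B" for m
    proof (rule AE_I2)
      fix y assume "y \<in> space Q"
      then have y: "y \<in> space (seq_space A)" by (simp add: sp)
      have "window_inf A f m (?w m y) \<le> f y" by (rule window_inf_le[OF y B])
      moreover have "- B \<le> window_inf A f m (?w m y)"
        by (rule window_inf_ge[OF y]) (use B in \<open>auto simp: abs_le_iff minus_le_iff\<close>)
      ultimately show "norm (window_inf A f m (?w m y)) \<le> B" using B[OF y] by (simp add: abs_le_iff)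
    qed
    have lim: "(\<lambda>m. mean (block_law (2 * m) Q) (window_inf A f m)) \<longlonglongrightarrow> (\<integral>y. f y \<partial>Q)"
      unfolding m
    proof (rule integral_dominated_convergence[where w="\<lambda>_. B"])
      show "AE y in Q. (\<lambda>m. window_inf A f m (?w m y)) \<longlonglongrightarrow> f y"
        by (rule AE_I2) (use window_inf_tendsto[OF f B] sp in auto)
    qed (use fQ mm bw in auto)
    have le: "mean (block_law (2 * m) Q) (window_inf A f m) \<le> (\<integral>y. f y \<partial>Q)" for m
      unfolding m
    proof (rule integral_mono)
      show "integrable Q (\<lambda>y. window_inf A f m (?w m y))" using bw mm by (rule integrable_const_bound)
      show "integrable Q f" by (rule integrable_const_bound[where B=B]) (use B fQ sp in auto)
      show "window_inf A f m (?w m y) \<le> f y" if "y \<in> space Q" for y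
        using that by (intro window_inf_le[where B=B] B) (auto simp: sp)
    qed
    show ?thesis
    proof
      assume "c < (\<integral>y. f y \<partial>Q)"
      from order_tendstoD(1)[OF lim this] show "\<exists>m. c < mean (block_law (2 * m) Q) (window_inf A f m)"
        by (auto simp: eventually_sequentially)
    qed (use le in \<open>auto intro: less_le_trans\<close>)
  qed
  have "{Q \<in> inv_laws A. c < (\<integral>y. f y \<partial>Q)} = (\<Union>m. {Q \<in> inv_laws A. c < mean (block_law (2 * m) Q) (window_inf A f m)})"
    using eq by auto
  also have "openin (pullback_topology (inv_laws A) cyl euclidean) \<dots>"
    by (intro openin_Union ballI) (auto intro!: openin_pullback_block bounded_window_inf B)
  finally show ?thesis .
qed

text \<open>
  Over an infinite alphabet a bounded continuous function need not be a uniform limit of functions of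
  finitely many coordinates. It is however an increasing limit of such functions, its window infima, so
  its integral is lower semicontinuous in the cylinder probabilities. The same applied to \<open>- f\<close> gives
  continuity.
\<close>

lemma weak_topology_cylinders:
  fixes A :: "'a::countable set"
  assumes "openin (weak_topology A) U"
  obtains V where "open V" "U = {Q \<in> inv_laws A. cyl Q \<in> V}"
proof -
  let ?W = "pullback_topology (inv_laws A) cyl euclidean"
  have "openin ?W U"
    using assms unfolding weak_topology_def openin_topology_generated_by_iff
  proof (rule generate_topology_on_coarsest[rotated 2])
    fix S assume "S \<in> {{Q \<in> inv_laws A. (\<integral>x. f x \<partial>Q) \<in> U} | f U.
        continuous_map (seq_topology A) euclideanreal f \<and>
        (\<exists>B. \<forall>x \<in> topspace (seq_topology A). \<bar>f x\<bar> \<le> B) \<and> open U}"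
    then obtain f U B where S: "S = {Q \<in> inv_laws A. (\<integral>x. f x \<partial>Q) \<in> U}"
      and f: "continuous_map (seq_topology A) euclideanreal f" and U: "open U"
      and B: "\<And>y. y \<in> space (seq_space A) \<Longrightarrow> \<bar>f y\<bar> \<le> B"
      by (auto simp: topspace_seq_topology)
    have f': "continuous_map (seq_topology A) euclideanreal (\<lambda>y. - f y)"
      using f by (rule continuous_map_minus)
    have ts: "topspace ?W = inv_laws A" by (simp add: topspace_pullback_topology)
    have "continuous_map ?W euclideanreal (\<lambda>Q. \<integral>x. f x \<partial>Q)"
      unfolding continuous_map_upper_lower_semicontinuous_lt ts
    proof (intro conjI allI)
      fix a
      show "openin ?W {Q \<in> inv_laws A. a < (\<integral>x. f x \<partial>Q)}" by (rule openin_pullback_lsc[OF f B])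
      have "openin ?W {Q \<in> inv_laws A. - a < (\<integral>x. - f x \<partial>Q)}" by (rule openin_pullback_lsc[OF f']) (use B in simp)
      then show "openin ?W {Q \<in> inv_laws A. (\<integral>x. f x \<partial>Q) < a}" by simp
    qed
    from openin_continuous_map_preimage[OF this, of U] U show "openin ?W S" by (simp add: S ts)
  qed simp
  then show ?thesis unfolding openin_pullback_topology using that by auto
qed

section \<open>Stationary laws with prescribed block laws\<close>

lemma stationary_pmf_window:
  assumes len: "\<And>n u. u \<in> set_pmf (b n) \<Longrightarrow> length u = n"
    and tl: "\<And>n. map_pmf tl (b (Suc n)) = b n" and bl: "\<And>n. map_pmf butlast (b (Suc n)) = b n"
    and "i + k \<le> n"
  shows "map_pmf (\<lambda>u. take k (drop i u)) (b n) = b k"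
proof -
  have d: "map_pmf (drop i) (b (n + i)) = b n" for n i
  proof (induction i)
    case (Suc i)
    have "map_pmf (drop (Suc i)) (b (n + Suc i)) = map_pmf (drop i) (map_pmf tl (b (Suc (n + i))))"
      by (simp add: map_pmf_comp drop_Suc[symmetric])
    also have "\<dots> = b n" by (simp only: tl Suc)
    finally show ?case .
  qed (simp add: map_pmf_def)
  have t: "map_pmf (take k) (b (k + j)) = b k" for k j
  proof (induction j)
    case 0
    have "map_pmf (take k) (b k) = map_pmf (\<lambda>u. u) (b k)" by (rule map_pmf_cong) (auto dest: len)
    then show ?case by simp
  next
    case (Suc j)
    have "map_pmf (take k) (b (k + Suc j)) = map_pmf (\<lambda>u. take k (butlast u)) (b (Suc (k + j)))"
    proof (rule map_pmf_cong)
      fix u assume "u \<in> set_pmf (b (Suc (k + j)))"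
      then have "length u = Suc (k + j)" by (rule len)
      then show "take k u = take k (butlast u)" by (simp add: take_butlast)
    qed simp
    also have "\<dots> = map_pmf (take k) (map_pmf butlast (b (Suc (k + j))))" by (simp add: map_pmf_comp)
    also have "\<dots> = b k" by (simp only: bl Suc)
    finally show ?case .
  qed
  have "map_pmf (\<lambda>u. take k (drop i u)) (b n) = map_pmf (take k) (map_pmf (drop i) (b (k + (n - i - k) + i)))"
    using assms(4) by (simp add: map_pmf_comp)
  then show ?thesis by (simp only: d t)
qed

text \<open>
  Kolmogorov's extension theorem. Letters are coded as real numbers, so that the coordinates take values
  in a Polish space, and decoded afterwards; a code outside the alphabet is sent to a fixed letter.
  Consistency under removal of the last letter and of the first letter gives both the compatibility of
  the windows around the origin and the stationarity of the limit.
\<close>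

lemma stationary_extension:
  fixes A :: "'a::countable set" and b :: "nat \<Rightarrow> 'a list pmf"
  assumes set: "\<And>n u. u \<in> set_pmf (b n) \<Longrightarrow> length u = n \<and> set u \<subseteq> A"
    and tl: "\<And>n. map_pmf tl (b (Suc n)) = b n" and bl: "\<And>n. map_pmf butlast (b (Suc n)) = b n"
  obtains Q where "Q \<in> inv_laws A" "\<And>n. block_law n Q = b n"
proof -
  define code :: "'a \<Rightarrow> real" where "code a = real (to_nat a)" for a
  define decode :: "real \<Rightarrow> 'a" where "decode r = from_nat (nat \<lfloor>r\<rfloor>)" for r
  have dc: "decode (code a) = a" for a by (simp add: decode_def code_def)
  have win: "map_pmf (\<lambda>u. take k (drop i u)) (b n) = b k" if "i + k \<le> n" for i k n
    by (rule stationary_pmf_window[of b, OF _ tl bl that]) (use set in blast)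
  \<comment> \<open>A radius of a window around the origin that covers \<open>J\<close>.\<close>
  define rad where "rad J = (SOME m. J \<subseteq> {- int m + 1..int m})" for J :: "int set"
  have rad: "J \<subseteq> {- int (rad J) + 1..int (rad J)}" if "finite J" for J
  proof -
    have "bdd_above (abs ` J)" using that by (intro bdd_above_finite) simp
    then obtain c where c: "\<And>i. i \<in> J \<Longrightarrow> \<bar>i\<bar> \<le> c" unfolding bdd_above_def by auto
    have "J \<subseteq> {- int (nat c + 1) + 1..int (nat c + 1)}" using c by force
    then show ?thesis unfolding rad_def by (rule someI)
  qed
  define E where "E m J u = (\<lambda>i\<in>J. code (u ! nat (i + int m - 1)))" for m and J :: "int set" and u
  have Em: "E m J \<in> measurable (measure_pmf p) (PiM J (\<lambda>_. borel))" for m J p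
    by (auto simp: measurable_pmf_measure1 space_PiM E_def)
  define PJ where "PJ J = distr (measure_pmf (b (2 * rad J))) (PiM J (\<lambda>_. borel)) (E (rad J) J)" for J
  have mono: "distr (measure_pmf (b (2 * m))) (PiM J (\<lambda>_. borel)) (E m J)
      = distr (measure_pmf (b (2 * m'))) (PiM J (\<lambda>_. borel)) (E m' J)"
    if J: "J \<subseteq> {- int m + 1..int m}" and m: "m \<le> m'" for m m' J
  proof -
    let ?g = "\<lambda>u::'a list. take (2 * m) (drop (m' - m) u)"
    have "b (2 * m) = map_pmf ?g (b (2 * m'))"
    proof (rule win[symmetric])
      obtain d where "m' = m + d" using m le_Suc_ex by blast
      then show "m' - m + 2 * m \<le> 2 * m'" by simp
    qed
    then have "distr (measure_pmf (b (2 * m))) (PiM J (\<lambda>_. borel)) (E m J)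
       = distr (measure_pmf (b (2 * m'))) (PiM J (\<lambda>_. borel)) (E m J \<circ> ?g)"
      by (simp add: map_pmf_rep_eq distr_distr[OF Em] measurable_pmf_measure1)
         (subst distr_distr, auto simp: measurable_pmf_measure1 space_PiM E_def)
    also have "\<dots> = distr (measure_pmf (b (2 * m'))) (PiM J (\<lambda>_. borel)) (E m' J)"
    proof (rule distr_cong_AE)
      show "AE u in measure_pmf (b (2 * m')). (E m J \<circ> ?g) u = E m' J u"
        unfolding AE_measure_pmf_iff
      proof
        fix u assume "u \<in> set_pmf (b (2 * m'))"
        then have u: "length u = 2 * m'" using set by auto
        have "?g u ! nat (i + int m - 1) = u ! nat (i + int m' - 1)" if "i \<in> J" for i
        proof -
          have i: "- int m + 1 \<le> i" "i \<le> int m" using that J by auto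
          then have "nat (i + int m - 1) < 2 * m" "m' - m + nat (i + int m - 1) = nat (i + int m' - 1)" using m by auto
          then show ?thesis using u m by simp
        qed
        then show "(E m J \<circ> ?g) u = E m' J u" by (auto simp: E_def)
      qed
    qed (auto simp: measurable_pmf_measure1 space_PiM E_def)
    finally show ?thesis .
  qed
  have PJ: "PJ J = distr (measure_pmf (b (2 * m))) (PiM J (\<lambda>_. borel)) (E m J)"
    if "J \<subseteq> {- int m + 1..int m}" "finite J" for J m
    using mono[OF that(1), of "max m (rad J)"] mono[OF rad[OF that(2)], of "max m (rad J)"]
    by (simp add: PJ_def)
  interpret PP: polish_projective UNIV PJ
  proof (rule polish_projective.intro, rule projective_family.intro)
    fix J H :: "int set" assume JH: "J \<subseteq> H" "finite H"
    let ?m = "rad H"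
    have "distr (PJ H) (PiM J (\<lambda>_. borel)) (\<lambda>f. restrict f J) = distr (measure_pmf (b (2 * ?m))) (PiM J (\<lambda>_. borel)) ((\<lambda>f. restrict f J) \<circ> E ?m H)"
      unfolding PJ_def by (rule distr_distr[OF measurable_restrict_subset[OF JH(1)] Em])
    also have "(\<lambda>f. restrict f J) \<circ> E ?m H = E ?m J" using JH(1) by (auto simp: fun_eq_iff E_def restrict_def)
    also have "distr (measure_pmf (b (2 * ?m))) (PiM J (\<lambda>_. borel)) (E ?m J) = PJ J"
      by (rule PJ[symmetric]) (use JH rad[OF JH(2)] finite_subset in auto)
    finally show "PJ J = distr (PJ H) (PiM J (\<lambda>_. borel)) (\<lambda>f. restrict f J)" by (rule sym)
  next
    fix J :: "int set"
    show "prob_space (PJ J)" unfolding PJ_def by (rule measure_pmf.prob_space_distr[OF Em])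
  qed
  let ?L = "PP.lim"
  have sL: "sets ?L = sets (PiM UNIV (\<lambda>_. borel))" by simp
  have spL: "space ?L = UNIV" by (simp add: space_PiM)
  have Lr: "distr ?L (PiM J (\<lambda>_. borel)) (\<lambda>x. restrict x J) = PJ J" if "finite J" for J
  proof (rule measure_eqI)
    show "sets (distr ?L (PiM J (\<lambda>_. borel)) (\<lambda>x. restrict x J)) = sets (PJ J)" by (simp add: PJ_def)
    fix X assume "X \<in> sets (distr ?L (PiM J (\<lambda>_. borel)) (\<lambda>x. restrict x J))"
    then have X: "X \<in> sets (PiM J (\<lambda>_. borel))" by simp
    have m: "(\<lambda>x. restrict x J) \<in> measurable ?L (PiM J (\<lambda>_. borel))"
      unfolding measurable_cong_sets[OF sL refl] by (rule measurable_restrict_subset) simp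
    have "emeasure (distr ?L (PiM J (\<lambda>_. borel)) (\<lambda>x. restrict x J)) X = emeasure ?L (prod_emb UNIV (\<lambda>_. borel) J X)"
      using X m by (simp add: emeasure_distr prod_emb_def space_PiM)
    also have "\<dots> = emeasure (PJ J) X" using that X by (intro PP.emeasure_lim_emb) auto
    finally show "emeasure (distr ?L (PiM J (\<lambda>_. borel)) (\<lambda>x. restrict x J)) X = emeasure (PJ J) X" .
  qed
  obtain a0 where a0: "a0 \<in> A"
  proof -
    obtain u where "u \<in> set_pmf (b 1)" using set_pmf_not_empty[of "b 1"] by blast
    then have "length u = 1" "set u \<subseteq> A" using set by auto
    then show ?thesis using that by (cases u) auto
  qed
  define dec where "dec r = (if decode r \<in> A then decode r else a0)" for r
  have decm: "dec \<in> measurable borel (count_space A)"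
  proof -
    have "(\<lambda>n::int. if from_nat (nat n) \<in> A then from_nat (nat n) else a0) \<in> measurable (count_space UNIV) (count_space A)"
      using a0 by auto
    from measurable_compose[OF measurable_real_floor this] show ?thesis
      by (simp add: dec_def[abs_def] decode_def cong: if_cong)
  qed
  have decmm: "dec \<in> measurable borel (count_space UNIV)" using decm by (rule measurable_compose) simp
  define Q where "Q = distr ?L (seq_space A) (\<lambda>x i. dec (x i))"
  have Dm: "(\<lambda>x i. dec (x i)) \<in> measurable ?L (seq_space A)"
    unfolding seq_space_def measurable_cong_sets[OF sL refl]
  proof (rule measurable_PiM_single')
    fix i :: int
    show "(\<lambda>x. dec (x i)) \<in> measurable (PiM UNIV (\<lambda>_. borel)) (count_space A)"
      by (rule measurable_compose[OF measurable_component_singleton[of i UNIV "\<lambda>_. borel"] decm]) simp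
  qed (use a0 in \<open>auto simp: dec_def\<close>)
  have sQ: "sets Q = sets (seq_space A)" by (simp add: Q_def)
  have pQ: "prob_space Q" unfolding Q_def by (rule PP.P.prob_space_distr[OF Dm])
  have wm: "(\<lambda>x. map (\<lambda>i. dec (x i)) js) \<in> measurable (PiM J (\<lambda>_. borel)) (count_space UNIV)" if "set js \<subseteq> J" for js J
    using that
  proof (induction js)
    case (Cons k js)
    have 1: "(\<lambda>x. dec (x k)) \<in> measurable (PiM J (\<lambda>_. borel)) (count_space UNIV)"
      by (rule measurable_compose[OF measurable_component_singleton[of k J "\<lambda>_. borel"] decmm]) (use Cons in auto)
    have "(\<lambda>x. (dec (x k) # map (\<lambda>i. dec (x i)) js)) \<in> measurable (PiM J (\<lambda>_. borel)) (count_space UNIV)"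
      by (rule measurable_compose_countable[OF _ 1, where f="\<lambda>a x. a # map (\<lambda>i. dec (x i)) js"])
         (rule measurable_compose[OF Cons.IH], use Cons.prems in auto)
    then show ?case by simp
  qed simp
  have window: "distr Q (count_space UNIV) (\<lambda>y. map y [- int m + 1..int m]) = measure_pmf (b (2 * m))" for m
  proof -
    let ?J = "{- int m + 1..int m}" and ?js = "[- int m + 1..int m]"
    have rm: "(\<lambda>x. restrict x ?J) \<in> measurable ?L (PiM ?J (\<lambda>_. borel))"
      unfolding measurable_cong_sets[OF sL refl] by (rule measurable_restrict_subset) simp
    have "distr Q (count_space UNIV) (\<lambda>y. map y ?js) = distr ?L (count_space UNIV) (\<lambda>x. map (\<lambda>i. dec (x i)) ?js)"
      unfolding Q_def by (subst distr_distr[OF measurable_window Dm]) (simp add: o_def)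
    also have "\<dots> = distr (distr ?L (PiM ?J (\<lambda>_. borel)) (\<lambda>x. restrict x ?J)) (count_space UNIV) (\<lambda>x. map (\<lambda>i. dec (x i)) ?js)"
      by (subst distr_distr[OF wm rm]) (auto simp: o_def intro!: distr_cong)
    also have "\<dots> = distr (PJ ?J) (count_space UNIV) (\<lambda>x. map (\<lambda>i. dec (x i)) ?js)" by (simp add: Lr)
    also have "\<dots> = distr (measure_pmf (b (2 * m))) (count_space UNIV) ((\<lambda>x. map (\<lambda>i. dec (x i)) ?js) \<circ> E m ?J)"
      by (subst PJ[of _ m]) (auto intro!: distr_distr wm Em)
    also have "\<dots> = distr (measure_pmf (b (2 * m))) (count_space UNIV) (\<lambda>u. u)"
    proof (rule distr_cong_AE)
      show "AE u in measure_pmf (b (2 * m)). ((\<lambda>x. map (\<lambda>i. dec (x i)) ?js) \<circ> E m ?J) u = u"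
        unfolding AE_measure_pmf_iff
      proof
        fix u assume "u \<in> set_pmf (b (2 * m))"
        then have u: "length u = 2 * m" "set u \<subseteq> A" using set by auto
        show "((\<lambda>x. map (\<lambda>i. dec (x i)) ?js) \<circ> E m ?J) u = u"
        proof (rule nth_equalityI)
          fix k assume "k < length (((\<lambda>x. map (\<lambda>i. dec (x i)) ?js) \<circ> E m ?J) u)"
          then have k: "k < 2 * m" by simp
          then have "u ! k \<in> A" using u by (metis nth_mem subsetD)
          then show "((\<lambda>x. map (\<lambda>i. dec (x i)) ?js) \<circ> E m ?J) u ! k = u ! k"
            using k by (simp add: E_def dec_def dc)
        qed (simp add: u)
      qed
    qed auto
    also have "\<dots> = measure_pmf (b (2 * m))" by (rule measure_eqI) (auto simp: emeasure_distr)
    finally show ?thesis .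
  qed
  have mQ: "(\<lambda>y. map y js) \<in> measurable Q (count_space UNIV)" for js
    unfolding measurable_cong_sets[OF sQ refl] by (rule measurable_window)
  \<comment> \<open>Windows cut out of one around the origin: an offset of one site gives stationarity, the right half
    gives the blocks.\<close>
  have sub: "distr Q (count_space UNIV) (\<lambda>y. map y [int i - int m + 1..int i - int m + int k]) = measure_pmf (b k)"
    if "i + k \<le> 2 * m" for i k m
  proof -
    have e: "take k (drop i (map y [- int m + 1..int m])) = map y [int i - int m + 1..int i - int m + int k]" for y :: "int \<Rightarrow> 'a"
      using that by (simp add: take_map drop_map drop_upto take_upto algebra_simps)
    have "measure_pmf (b k) = distr (measure_pmf (b (2 * m))) (count_space UNIV) (\<lambda>u. take k (drop i u))"
      using win[OF that] by (metis map_pmf_rep_eq)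
    also have "\<dots> = distr (distr Q (count_space UNIV) (\<lambda>y. map y [- int m + 1..int m])) (count_space UNIV) (\<lambda>u. take k (drop i u))"
      by (simp only: window)
    also have "\<dots> = distr Q (count_space UNIV) (\<lambda>y. map y [int i - int m + 1..int i - int m + int k])"
      by (subst distr_distr[OF _ mQ]) (simp_all only: o_def e, simp)
    finally show ?thesis by simp
  qed
  have inv: "Q \<in> inv_laws A"
    unfolding inv_laws_def
  proof (intro CollectI conjI sQ pQ)
    have shm: "left_shift \<in> measurable Q (seq_space A)"
      unfolding measurable_cong_sets[OF sQ refl] by (rule left_shift_measurable)
    show "distr Q (seq_space A) left_shift = Q"
    proof (rule seq_measure_eqI)
      show "finite_measure (distr Q (seq_space A) left_shift)"
        using prob_space.prob_space_distr[OF pQ shm] by (rule prob_space.finite_measure)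
      fix m :: nat assume "1 \<le> m"
      have e: "map (left_shift y) [- int m + 1..int m] = map y [int 2 - int (m + 1) + 1..int 2 - int (m + 1) + int (2 * m)]" for y :: "int \<Rightarrow> 'a"
        unfolding left_shift_def map_upto_shift by (simp add: algebra_simps)
      have "distr (distr Q (seq_space A) left_shift) (count_space UNIV) (\<lambda>y. map y [- int m + 1..int m])
          = distr Q (count_space UNIV) (\<lambda>y. map y [int 2 - int (m + 1) + 1..int 2 - int (m + 1) + int (2 * m)])"
        by (subst distr_distr[OF measurable_window shm]) (simp only: o_def e)
      also have "\<dots> = measure_pmf (b (2 * m))" by (rule sub) simp
      finally show "distr (distr Q (seq_space A) left_shift) (count_space UNIV) (\<lambda>y. map y [- int m + 1..int m])
        = distr Q (count_space UNIV) (\<lambda>y. map y [- int m + 1..int m])" by (simp only: window)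
    qed (simp_all add: sQ)
  qed
  have "measure_pmf (block_law n Q) = measure_pmf (b n)" for n
    using sub[of n n n] by (simp add: measure_pmf_block_law[OF inv] block_def[abs_def])
  then have "block_law n Q = b n" for n by (simp add: measure_pmf_inject)
  with inv show ?thesis by (rule that)
qed

section \<open>Compact sets of stationary laws\<close>

text \<open>
  An infinite sum expressed by closed conditions on finite partial sums.
\<close>

lemma nn_integral_finite_sums:
  fixes h :: "'a::countable \<Rightarrow> real"
  assumes h: "\<And>v. 0 \<le> h v" and up: "\<And>F. finite F \<Longrightarrow> sum h F \<le> c"
    and low: "\<And>m. \<exists>F. finite F \<and> c - 1 / real (Suc m) \<le> sum h F"
  shows "(\<integral>\<^sup>+v. ennreal (h v) \<partial>count_space UNIV) = ennreal c"
proof (rule antisym)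
  have ind: "(\<integral>\<^sup>+v. ennreal (h v) * indicator F v \<partial>count_space UNIV) = ennreal (sum h F)" if "finite F" for F
    using that h by (subst nn_integral_count_space'[of F]) (auto simp: sum_ennreal)
  have "(\<integral>\<^sup>+v. ennreal (h v) \<partial>count_space UNIV) = (\<integral>\<^sup>+v. (SUP m. ennreal (h v) * indicator (finite_exhaustion m) v) \<partial>count_space UNIV)"
  proof (rule nn_integral_cong)
    fix v
    show "ennreal (h v) = (SUP m. ennreal (h v) * indicator (finite_exhaustion m) v)"
    proof (rule antisym)
      show "ennreal (h v) \<le> (SUP m. ennreal (h v) * indicator (finite_exhaustion m) v)"
        by (rule SUP_upper2[of "Suc (to_nat v)"]) (auto simp: finite_exhaustion_def)
    qed (auto intro!: SUP_least split: split_indicator)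
  qed
  also have "\<dots> = (SUP m. \<integral>\<^sup>+v. ennreal (h v) * indicator (finite_exhaustion m) v \<partial>count_space UNIV)"
    by (rule nn_integral_monotone_convergence_SUP)
       (auto simp: incseq_def le_fun_def finite_exhaustion_def split: split_indicator)
  also have "\<dots> \<le> ennreal c"
    unfolding ind[OF finite_finite_exhaustion] by (rule SUP_least) (intro ennreal_leI up finite_finite_exhaustion)
  finally show "(\<integral>\<^sup>+v. ennreal (h v) \<partial>count_space UNIV) \<le> ennreal c" .
  show "ennreal c \<le> (\<integral>\<^sup>+v. ennreal (h v) \<partial>count_space UNIV)"
  proof (rule ennreal_le_epsilon)
    fix e :: real assume e: "0 < e"
    obtain m where m: "1 / real (Suc m) < e" using nat_approx_posE[OF e] by metis
    obtain F where F: "finite F" "c - 1 / real (Suc m) \<le> sum h F" using low by blast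
    have "ennreal c \<le> ennreal (sum h F + e)" using F m by (intro ennreal_leI) linarith
    also have "\<dots> = ennreal (sum h F) + ennreal e" using h e by (intro ennreal_plus) (auto intro: sum_nonneg)
    also have "ennreal (sum h F) \<le> (\<integral>\<^sup>+v. ennreal (h v) \<partial>count_space UNIV)"
      unfolding ind[OF F(1), symmetric] by (rule nn_integral_mono) (auto split: split_indicator)
    finally show "ennreal c \<le> (\<integral>\<^sup>+v. ennreal (h v) \<partial>count_space UNIV) + ennreal e"
      by (simp add: add_right_mono)
  qed
qed

text \<open>
  Two distributions of total mass 1 cannot be strictly ordered.
\<close>

lemma pmf_eqI_ge:
  assumes "\<And>x. pmf p x \<le> pmf q x" shows "p = q"
proof (rule ccontr)
  assume "p \<noteq> q"
  then obtain x where "pmf q x < pmf p x" using pmf_neq_exists_less[of q p] by metis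
  with assms[of x] show False by simp
qed

text \<open>
  The prescribed finite sets carry most of the mass of the first letter, hence by stationarity of every
  letter. A sequence of such conditions is what compactness over an infinite alphabet requires.
\<close>

definition tight_laws :: "'a::countable set \<Rightarrow> (nat \<Rightarrow> 'a set) \<Rightarrow> (int \<Rightarrow> 'a) measure set" where
  "tight_laws A F = {Q \<in> inv_laws A. \<forall>m. measure_pmf.prob (block_law 1 Q) {u. hd u \<notin> F m} \<le> 1 / real (Suc m)}"

text \<open>
  The cylinder probabilities of \<open>tight_laws\<close>, described by conditions that involve finitely many
  coordinates each and are therefore closed in the product topology. The two-sided bounds on partial sums
  replace the equations \<open>q u = (\<Sum>v. q (u @ [v])) = (\<Sum>v. q (v # u))\<close>, which do not define a closed set:
  mass could escape to infinity.
\<close>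

definition tight_masses :: "'a::countable set \<Rightarrow> (nat \<Rightarrow> 'a set) \<Rightarrow> ('a list \<Rightarrow> real) set" where
  "tight_masses A F = {q. (\<forall>u. q u \<in> {0..1}) \<and> q [] = 1 \<and> (\<forall>u. \<not> set u \<subseteq> A \<longrightarrow> q u = 0) \<and>
     (\<forall>u G. finite G \<longrightarrow> (\<Sum>v\<in>G. q (u @ [v])) \<le> q u \<and> (\<Sum>v\<in>G. q (v # u)) \<le> q u) \<and>
     (\<forall>u m. q u - 1 / real (Suc m) \<le> (\<Sum>v\<in>F m. q (u @ [v])) \<and> q u - 1 / real (Suc m) \<le> (\<Sum>v\<in>F m. q (v # u)))}"

lemma compact_tight_masses: "compact (tight_masses A F)"
proof -
  have c: "continuous_on UNIV (\<lambda>q :: 'a list \<Rightarrow> real. q u)" for u by simp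
  have imp: "closed {q. a \<longrightarrow> P q}" if "closed {q. P q}" for a and P :: "('a list \<Rightarrow> real) \<Rightarrow> bool"
    using that by (cases a) auto
  have "compactin euclidean (PiE (UNIV :: 'a list set) (\<lambda>_. {0..1::real}))"
    unfolding euclidean_product_topology[symmetric] compactin_PiE by simp
  then have K: "compact (PiE (UNIV :: 'a list set) (\<lambda>_. {0..1::real}))"
    by (rule compactin_euclidean_iff[THEN iffD1])
  let ?C = "{q. q [] = (1::real) \<and> (\<forall>u. \<not> set u \<subseteq> A \<longrightarrow> q u = 0) \<and>
     (\<forall>u G. finite G \<longrightarrow> (\<Sum>v\<in>G. q (u @ [v])) \<le> q u \<and> (\<Sum>v\<in>G. q (v # u)) \<le> q u) \<and>
     (\<forall>u m. q u - 1 / real (Suc m) \<le> (\<Sum>v\<in>F m. q (u @ [v])) \<and> q u - 1 / real (Suc m) \<le> (\<Sum>v\<in>F m. q (v # u)))}"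
  have "closed ?C"
    by (intro closed_Collect_conj closed_Collect_all closed_Collect_eq closed_Collect_le imp continuous_on_sum
        continuous_on_diff continuous_on_const c)
  moreover have "tight_masses A F = PiE UNIV (\<lambda>_. {0..1}) \<inter> ?C"
    by (simp only: tight_masses_def Collect_conj_eq[symmetric] PiE_UNIV_domain) (auto simp: Pi_iff)
  ultimately show ?thesis using K by (simp only: compact_Int_closed)
qed

text \<open>
  Appending and prepending a letter are treated together: \<open>ins\<close> inserts the letter, \<open>rem\<close> removes it
  and \<open>get\<close> reads it. The loss of mass outside \<open>F m\<close> is at most the probability that one letter is
  outside \<open>F m\<close>.
\<close>

lemma cyl_in_tight_masses:
  assumes F: "\<And>m. finite (F m)" and Q: "Q \<in> tight_laws A F"
  shows "cyl Q \<in> tight_masses A F"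
proof -
  have inv: "Q \<in> inv_laws A" and tight: "\<And>m. measure_pmf.prob (block_law 1 Q) {u. hd u \<notin> F m} \<le> 1 / real (Suc m)"
    using Q by (auto simp: tight_laws_def)
  have general: "(\<Sum>v\<in>G. cyl Q (ins v u)) \<le> cyl Q u" if G: "finite G"
    and ins: "\<And>v. length (ins v u) = Suc (length u)" "\<And>v. rem (ins v u) = u" "inj (\<lambda>v. ins v u)"
    and rem: "map_pmf rem (block_law (Suc (length u)) Q) = block_law (length u) Q"
    for G and ins :: "'a \<Rightarrow> 'a list \<Rightarrow> 'a list" and rem u
  proof -
    have "(\<Sum>v\<in>G. cyl Q (ins v u)) = (\<Sum>v\<in>G. pmf (block_law (Suc (length u)) Q) (ins v u))"
      by (simp add: cyl_def ins)
    also have "\<dots> = (\<Sum>w\<in>(\<lambda>v. ins v u) ` G. pmf (block_law (Suc (length u)) Q) w)"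
      by (subst sum.reindex) (auto intro: inj_on_subset[OF ins(3)])
    also have "\<dots> = measure_pmf.prob (block_law (Suc (length u)) Q) ((\<lambda>v. ins v u) ` G)"
      using G by (simp add: measure_measure_pmf_finite)
    also have "\<dots> \<le> measure_pmf.prob (block_law (Suc (length u)) Q) (rem -` {u})"
      by (rule measure_pmf.finite_measure_mono) (auto simp: ins)
    also have "\<dots> = cyl Q u" by (simp add: cyl_def rem[symmetric] pmf_map)
    finally show ?thesis .
  qed
  have general2: "cyl Q u - 1 / real (Suc m) \<le> (\<Sum>v\<in>F m. cyl Q (ins v u))"
    if ins: "\<And>v. length (ins v u) = Suc (length u)" "\<And>w. length w = Suc (length u) \<Longrightarrow> rem w = u \<Longrightarrow> w = ins (get w) u" "inj (\<lambda>v. ins v u)"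
    and rem: "map_pmf rem (block_law (Suc (length u)) Q) = block_law (length u) Q"
    and get: "map_pmf (\<lambda>w. [get w]) (block_law (Suc (length u)) Q) = block_law 1 Q"
    for ins :: "'a \<Rightarrow> 'a list \<Rightarrow> 'a list" and rem get u m
  proof -
    let ?p = "block_law (Suc (length u)) Q"
    have "cyl Q u = measure_pmf.prob ?p (rem -` {u})" by (simp add: cyl_def rem[symmetric] pmf_map)
    also have "\<dots> \<le> measure_pmf.prob ?p ((\<lambda>v. ins v u) ` F m \<union> {w. get w \<notin> F m})"
    proof (rule measure_pmf.finite_measure_mono_AE)
      show "AE w in ?p. w \<in> rem -` {u} \<longrightarrow> w \<in> (\<lambda>v. ins v u) ` F m \<union> {w. get w \<notin> F m}"
        unfolding AE_measure_pmf_iff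
      proof (intro ballI impI)
        fix w assume "w \<in> set_pmf ?p" "w \<in> rem -` {u}"
        then have "w = ins (get w) u" using set_pmf_block_law[OF inv, of "Suc (length u)"] by (intro ins) auto
        then show "w \<in> (\<lambda>v. ins v u) ` F m \<union> {w. get w \<notin> F m}" by blast
      qed
    qed simp
    also have "\<dots> \<le> measure_pmf.prob ?p ((\<lambda>v. ins v u) ` F m) + measure_pmf.prob ?p {w. get w \<notin> F m}"
      by (rule measure_Un_le) auto
    also have "measure_pmf.prob ?p {w. get w \<notin> F m} = measure_pmf.prob (block_law 1 Q) {u. hd u \<notin> F m}"
      unfolding get[symmetric] by (simp add: vimage_def)
    also have "\<dots> \<le> 1 / real (Suc m)" by (rule tight)
    also have "measure_pmf.prob ?p ((\<lambda>v. ins v u) ` F m) = (\<Sum>w\<in>(\<lambda>v. ins v u) ` F m. pmf ?p w)"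
      using F by (simp add: measure_measure_pmf_finite)
    also have "\<dots> = (\<Sum>v\<in>F m. pmf ?p (ins v u))"
      by (subst sum.reindex) (auto intro: inj_on_subset[OF ins(3)])
    also have "\<dots> = (\<Sum>v\<in>F m. cyl Q (ins v u))" by (simp add: cyl_def ins)
    finally show ?thesis by simp
  qed
  have la: "map_pmf (\<lambda>w. [last w]) (block_law (Suc n) Q) = block_law 1 Q" for n
  proof -
    have "map_pmf (\<lambda>w. [last w]) (block_law (Suc n) Q) = map_pmf (\<lambda>w. take 1 (drop n w)) (block_law (Suc n) Q)"
    proof (rule map_pmf_cong)
      fix w assume "w \<in> set_pmf (block_law (Suc n) Q)"
      then have "length w = Suc n" using set_pmf_block_law[OF inv] by auto
      then show "[last w] = take 1 (drop n w)"
        by (metis Cons_nth_drop_Suc One_nat_def diff_Suc_1 last_conv_nth length_0_conv lessI nat.simps(3) take0 take_Suc_Cons)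
    qed simp
    then show ?thesis using map_pmf_window[OF inv, of n 1 "Suc n"] by simp
  qed
  have he: "map_pmf (\<lambda>w. [hd w]) (block_law (Suc n) Q) = block_law 1 Q" for n
  proof -
    have "map_pmf (\<lambda>w. [hd w]) (block_law (Suc n) Q) = map_pmf (take 1) (block_law (Suc n) Q)"
    proof (rule map_pmf_cong)
      fix w assume "w \<in> set_pmf (block_law (Suc n) Q)"
      then have "length w = Suc n" using set_pmf_block_law[OF inv] by auto
      then show "[hd w] = take 1 w" by (cases w) auto
    qed simp
    then show ?thesis using map_pmf_take[OF inv, of 1 "Suc n"] by simp
  qed
  have "block_law 0 Q = return_pmf []"
    using set_pmf_block_law[OF inv, of 0] by (intro set_pmf_subset_singleton[THEN iffD1]) auto
  then have "cyl Q [] = 1" by (simp add: cyl_def)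
  moreover have "cyl Q u = 0" if "\<not> set u \<subseteq> A" for u
    using set_pmf_block_law[OF inv, of "length u"] that by (auto simp: cyl_def pmf_eq_0_set_pmf)
  moreover have "(\<Sum>v\<in>G. cyl Q (u @ [v])) \<le> cyl Q u" if "finite G" for u G
    by (rule general[where ins="\<lambda>v u. u @ [v]" and rem=butlast]) (auto simp: map_pmf_butlast[OF inv] that inj_def)
  moreover have "(\<Sum>v\<in>G. cyl Q (v # u)) \<le> cyl Q u" if "finite G" for u G
    by (rule general[where ins="\<lambda>v u. v # u" and rem=tl]) (auto simp: map_pmf_tl[OF inv] that inj_def)
  moreover have "cyl Q u - 1 / real (Suc m) \<le> (\<Sum>v\<in>F m. cyl Q (u @ [v]))" for u m
  proof (rule general2[where ins="\<lambda>v u. u @ [v]" and rem=butlast and get=last])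
    show "w = u @ [last w]" if "length w = Suc (length u)" "butlast w = u" for w
      using that by (metis append_butlast_last_id list.size(3) nat.simps(3))
  qed (auto simp: map_pmf_butlast[OF inv] la inj_def)
  moreover have "cyl Q u - 1 / real (Suc m) \<le> (\<Sum>v\<in>F m. cyl Q (v # u))" for u m
  proof (rule general2[where ins="\<lambda>v u. v # u" and rem=tl and get=hd])
    show "w = hd w # u" if "length w = Suc (length u)" "tl w = u" for w
      using that by (cases w) auto
  qed (auto simp: map_pmf_tl[OF inv] he inj_def)
  moreover have "cyl Q u \<in> {0..1}" for u by (simp add: cyl_def pmf_le_1)
  ultimately show ?thesis unfolding tight_masses_def mem_Collect_eq by blast
qed

text \<open>
  The partial sum conditions make \<open>q\<close> restricted to each length a probability distribution, and these
  distributions consistent. The extension theorem then supplies the stationary law.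
\<close>

lemma tight_masses_realized:
  fixes A :: "'a::countable set"
  assumes F: "\<And>m. finite (F m)" and q: "q \<in> tight_masses A F"
  obtains Q where "Q \<in> tight_laws A F" "cyl Q = q"
proof -
  have q01: "0 \<le> q u" "q u \<le> 1" and q0: "q [] = 1" and qA: "\<not> set u \<subseteq> A \<Longrightarrow> q u = 0"
    and up: "finite G \<Longrightarrow> (\<Sum>v\<in>G. q (u @ [v])) \<le> q u" "finite G \<Longrightarrow> (\<Sum>v\<in>G. q (v # u)) \<le> q u"
    and low: "q u - 1 / real (Suc m) \<le> (\<Sum>v\<in>F m. q (u @ [v]))" "q u - 1 / real (Suc m) \<le> (\<Sum>v\<in>F m. q (v # u))" for u G m
    using q by (auto simp: tight_masses_def)
  define qn where "qn n u = (if length u = n then q u else 0)" for n u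
  have qn0: "0 \<le> qn n u" for n u by (simp add: qn_def q01)
  have inner: "(\<integral>\<^sup>+v. ennreal (q (u @ [v])) \<partial>count_space UNIV) = ennreal (q u)" for u
    by (rule nn_integral_finite_sums[OF q01(1) up(1)]) (use low(1)[of u] F in blast)+
  have total: "(\<integral>\<^sup>+u. ennreal (qn n u) \<partial>count_space UNIV) = 1" for n
  proof (induction n)
    case 0
    have "(\<integral>\<^sup>+u. ennreal (qn 0 u) \<partial>count_space UNIV) = (\<Sum>u\<in>{[]}. ennreal (qn 0 u))"
      by (rule nn_integral_count_space') (auto simp: qn_def)
    then show ?case by (simp add: qn_def q0)
  next
    case (Suc n)
    have bij: "bij_betw (\<lambda>(u, v). u @ [v]) UNIV {w :: 'a list. w \<noteq> []}"
      unfolding bij_betw_def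
    proof
      show "(\<lambda>(u, v). u @ [v]) ` UNIV = {w :: 'a list. w \<noteq> []}"
        by (auto simp: image_iff) (metis append_butlast_last_id)
    qed (auto simp: inj_on_def)
    have "(\<integral>\<^sup>+w. ennreal (qn (Suc n) w) \<partial>count_space UNIV) = (\<integral>\<^sup>+w. ennreal (qn (Suc n) w) \<partial>count_space {w. w \<noteq> []})"
      by (rule nn_integral_count_space_eq) (auto simp: qn_def)
    also have "\<dots> = (\<integral>\<^sup>+x. ennreal (qn (Suc n) (case x of (u, v) \<Rightarrow> u @ [v])) \<partial>count_space UNIV)"
      by (rule nn_integral_bij_count_space[OF bij, symmetric])
    also have "\<dots> = (\<integral>\<^sup>+u. \<integral>\<^sup>+v. ennreal (qn (Suc n) (u @ [v])) \<partial>count_space UNIV \<partial>count_space UNIV)"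
      by (subst nn_integral_fst_count_space[symmetric]) simp
    also have "\<dots> = (\<integral>\<^sup>+u. ennreal (qn n u) \<partial>count_space UNIV)"
      by (rule nn_integral_cong) (auto simp: qn_def inner)
    finally show ?case using Suc by simp
  qed
  define b where "b n = embed_pmf (qn n)" for n
  have pb: "pmf (b n) u = qn n u" for n u
    unfolding b_def using qn0 total by (rule pmf_embed_pmf)
  have sb: "length u = n \<and> set u \<subseteq> A" if "u \<in> set_pmf (b n)" for n u
    using that qA by (auto simp: set_pmf_iff pb qn_def split: if_splits)
  have cons: "map_pmf rem (b (Suc n)) = b n"
    if ins: "\<And>v u. length (ins v u) = Suc (length u)" "\<And>v u. rem (ins v u) = u" "\<And>u. inj (\<lambda>v. ins v u)"
      and low: "\<And>u m. q u - 1 / real (Suc m) \<le> (\<Sum>v\<in>F m. q (ins v u))"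
    for ins :: "'a \<Rightarrow> 'a list \<Rightarrow> 'a list" and rem n
  proof (rule pmf_eqI_ge[symmetric])
    fix u
    show "pmf (b n) u \<le> pmf (map_pmf rem (b (Suc n))) u"
    proof (cases "length u = n")
      case True
      have "q u \<le> pmf (map_pmf rem (b (Suc n))) u + e" if "0 < e" for e
      proof -
        obtain m where m: "1 / real (Suc m) < e" using nat_approx_posE[OF \<open>0 < e\<close>] by metis
        have "q u - 1 / real (Suc m) \<le> (\<Sum>v\<in>F m. q (ins v u))" by (rule low)
        also have "\<dots> = (\<Sum>v\<in>F m. pmf (b (Suc n)) (ins v u))" using True by (simp add: pb qn_def ins)
        also have "\<dots> = (\<Sum>w\<in>(\<lambda>v. ins v u) ` F m. pmf (b (Suc n)) w)"
          by (subst sum.reindex) (auto intro: inj_on_subset[OF ins(3)])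
        also have "\<dots> = measure_pmf.prob (b (Suc n)) ((\<lambda>v. ins v u) ` F m)"
          using F by (simp add: measure_measure_pmf_finite)
        also have "\<dots> \<le> measure_pmf.prob (b (Suc n)) (rem -` {u})"
          by (rule measure_pmf.finite_measure_mono) (auto simp: ins)
        finally show ?thesis using m by (simp add: pmf_map)
      qed
      then show ?thesis using True by (simp add: pb qn_def) (rule field_le_epsilon)
    qed (simp add: pb qn_def)
  qed
  obtain Q where Q: "Q \<in> inv_laws A" "\<And>n. block_law n Q = b n"
  proof (rule stationary_extension[of b A])
    show "map_pmf tl (b (Suc n)) = b n" for n
      by (rule cons[where ins="\<lambda>v u. v # u"]) (use low in \<open>auto simp: inj_def\<close>)
    show "map_pmf butlast (b (Suc n)) = b n" for n
      by (rule cons[where ins="\<lambda>v u. u @ [v]"]) (use low in \<open>auto simp: inj_def\<close>)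
  qed (use sb in auto)
  have cq: "cyl Q = q" by (simp add: fun_eq_iff cyl_def Q pb qn_def)
  have "measure_pmf.prob (block_law 1 Q) {u. hd u \<notin> F m} \<le> 1 / real (Suc m)" for m
  proof -
    have "1 - 1 / real (Suc m) \<le> (\<Sum>v\<in>F m. q [v])" using low(1)[of "[]" m] q0 by simp
    also have "\<dots> = (\<Sum>w\<in>(\<lambda>v. [v]) ` F m. pmf (b 1) w)"
      by (subst sum.reindex) (auto simp: inj_on_def pb qn_def)
    also have "\<dots> = measure_pmf.prob (b 1) ((\<lambda>v. [v]) ` F m)"
      using F by (simp add: measure_measure_pmf_finite)
    also have "\<dots> \<le> measure_pmf.prob (b 1) (- {u. hd u \<notin> F m})"
      by (rule measure_pmf.finite_measure_mono) auto
    also have "\<dots> = 1 - measure_pmf.prob (b 1) {u. hd u \<notin> F m}"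
      using measure_pmf.prob_compl[of "{u. hd u \<notin> F m}" "b 1"] by (simp add: Compl_eq_Diff_UNIV)
    finally show ?thesis by (simp add: Q)
  qed
  then have "Q \<in> tight_laws A F" using Q(1) unfolding tight_laws_def by blast
  then show ?thesis using cq by (rule that)
qed

text \<open>
  A cover by weakly open sets is a cover of the cylinder probabilities by sets open in the product
  topology, where Tychonoff's theorem applies.
\<close>

lemma compactin_tight_laws:
  fixes A :: "'a::countable set"
  assumes F: "\<And>m. finite (F m)"
  shows "compactin (weak_topology A) (tight_laws A F)"
  unfolding compactin_def
proof (intro conjI allI impI)
  show "tight_laws A F \<subseteq> topspace (weak_topology A)"
    by (auto simp: topspace_weak_topology tight_laws_def)
  fix \<U> assume U: "Ball \<U> (openin (weak_topology A)) \<and> tight_laws A F \<subseteq> \<Union> \<U>"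
  have "\<forall>U\<in>\<U>. \<exists>V. open V \<and> U = {Q \<in> inv_laws A. cyl Q \<in> V}"
  proof
    fix U assume "U \<in> \<U>"
    then have "openin (weak_topology A) U" using U by blast
    then show "\<exists>V. open V \<and> U = {Q \<in> inv_laws A. cyl Q \<in> V}"
      by (rule weak_topology_cylinders) blast
  qed
  then obtain V where V: "\<And>U. U \<in> \<U> \<Longrightarrow> open (V U) \<and> U = {Q \<in> inv_laws A. cyl Q \<in> V U}" by metis
  have cover: "tight_masses A F \<subseteq> (\<Union>U\<in>\<U>. V U)"
  proof
    fix q assume "q \<in> tight_masses A F"
    then obtain Q where Q: "Q \<in> tight_laws A F" "cyl Q = q" by (rule tight_masses_realized[OF F])
    then obtain U where "U \<in> \<U>" "Q \<in> U" using U by auto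
    then show "q \<in> (\<Union>U\<in>\<U>. V U)" using V[of U] Q by auto
  qed
  obtain D where D: "D \<subseteq> \<U>" "finite D" "tight_masses A F \<subseteq> (\<Union>U\<in>D. V U)"
    by (rule compactE_image[OF compact_tight_masses _ cover]) (use V in auto)
  have "tight_laws A F \<subseteq> \<Union> D"
  proof
    fix Q assume Q: "Q \<in> tight_laws A F"
    then have "cyl Q \<in> tight_masses A F" by (rule cyl_in_tight_masses[OF F])
    then obtain U where U: "U \<in> D" "cyl Q \<in> V U" using D(3) by auto
    moreover have "Q \<in> inv_laws A" using Q by (simp add: tight_laws_def)
    ultimately have "Q \<in> U" using V[of U] D(1) by auto
    then show "Q \<in> \<Union> D" using U by auto
  qed
  then show "\<exists>\<F>. finite \<F> \<and> \<F> \<subseteq> \<U> \<and> tight_laws A F \<subseteq> \<Union> \<F>" using D by auto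
qed

section \<open>Concatenation, superadditive sequences and mixtures\<close>

lemma pmf_block_law_cyl:
  fixes A :: "'a::countable set"
  assumes Q: "Q \<in> inv_laws A"
  shows "pmf (block_law n Q) u = (if length u = n then cyl Q u else 0)"
  using set_pmf_block_law[OF Q, of n] by (auto simp: cyl_def pmf_eq_0_set_pmf)

lemma cyl_nonneg: "0 \<le> cyl Q u"
  by (simp add: cyl_def)

lemma pmf_conc:
  assumes p: "\<And>u. u \<in> set_pmf p \<Longrightarrow> length u = n" and w: "n \<le> length w"
  shows "pmf (conc p q) w = pmf p (take n w) * pmf q (drop n w)"
proof -
  have "pmf (conc p q) w = measure_pmf.prob (pair_pmf p q) ((\<lambda>(u, v). u @ v) -` {w})"
    by (simp add: conc_def pmf_map)
  also have "\<dots> = measure_pmf.prob (pair_pmf p q) {(take n w, drop n w)}"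
  proof (rule measure_pmf.finite_measure_eq_AE)
    have "u @ v = w \<longleftrightarrow> u = take n w \<and> v = drop n w" if "u \<in> set_pmf p" for u v
      using append_eq_conv_conj[of u v w] p[OF that] by simp
    then show "AE x in pair_pmf p q. (x \<in> (\<lambda>(u, v). u @ v) -` {w}) = (x \<in> {(take n w, drop n w)})"
      by (auto simp: AE_measure_pmf_iff)
  qed auto
  also have "\<dots> = pmf p (take n w) * pmf q (drop n w)"
    by (simp add: measure_pmf_single pmf_pair)
  finally show ?thesis .
qed

lemma mean_conc_split:
  assumes p: "\<And>u. u \<in> set_pmf p \<Longrightarrow> length u = n" and F: "bounded (range F)" and G: "bounded (range G)"
  shows "mean (conc p q) (\<lambda>w. F (take n w) * G (drop n w)) = mean p F * mean q G"
proof -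
  have "mean (conc p q) (\<lambda>w. F (take n w) * G (drop n w)) = mean p (\<lambda>u. mean q (\<lambda>v. F (take n (u @ v)) * G (drop n (u @ v))))"
    by (intro mean_conc bounded_range_intros bounded_range_comp[OF F] bounded_range_comp[OF G])
  also have "\<dots> = mean p (\<lambda>u. F u * mean q G)"
    by (rule integral_cong_AE) (auto simp: AE_measure_pmf_iff p)
  finally show ?thesis by simp
qed

text \<open>
  Fekete's lemma for a sequence that is superadditive up to an additive constant. Values may be
  infinite, so the lower estimate is derived for real numbers below \<open>a k\<close>.
\<close>

lemma superadditive_limit:
  fixes a :: "nat \<Rightarrow> ereal"
  assumes a: "\<And>n. 0 \<le> a n" and C: "0 \<le> C" and sup: "\<And>n m. a n + a m \<le> a (n + m) + ereal C"
  shows "(\<lambda>n. a n / ereal (real n)) \<longlonglongrightarrow> (SUP k\<in>{1..}. (a k - ereal C) / ereal (real k))"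
    (is "_ \<longlonglongrightarrow> ?S")
proof (rule order_tendstoI)
  fix y assume "y < ?S"
  then obtain k where k: "1 \<le> k" "y < (a k - ereal C) / ereal (real k)" by (auto simp: less_SUP_iff)
  show "eventually (\<lambda>n. y < a n / ereal (real n)) sequentially"
  proof (cases "y < 0")
    case True
    then have "y < a n / ereal (real n)" for n
      using a[of n] by (intro less_le_trans[OF True]) (cases n; simp add: divide_ereal_def)
    then show ?thesis by simp
  next
    case False
    obtain y' where y': "y < ereal y'" "ereal y' < (a k - ereal C) / ereal (real k)"
      using ereal_dense2[OF k(2)] by auto
    obtain y0 where y0: "y = ereal y0" "0 \<le> y0" using False y'(1) by (cases y) auto
    \<comment> \<open>A value slightly below \<open>a k - C\<close>: every additional stretch of length \<open>k\<close> contributes at least \<open>b\<close>.\<close>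
    define b where "b = y' * real k"
    have b0: "0 < b" using y0 y'(1) k(1) by (simp add: b_def)
    have ab: "ereal (b + C) < a k"
      using y'(2) k(1) by (cases "a k") (auto simp: b_def field_simps)
    have N: "ereal (real N * b) \<le> a (N * k + r)" for N r
    proof (induction N)
      case (Suc N)
      have "ereal (b + C) + ereal (real N * b) \<le> a k + a (N * k + r)"
        using ab Suc by (intro add_mono) auto
      also have "\<dots> \<le> a (Suc N * k + r) + ereal C" using sup[of k "N * k + r"] by (simp add: add.assoc)
      finally show ?case
        by (cases "a (Suc N * k + r)") (auto simp: algebra_simps)
    qed (use a in \<open>simp add: zero_ereal_def[symmetric]\<close>)
    have "(\<lambda>n. y' - b / real n) \<longlonglongrightarrow> y' - 0"
      by (intro tendsto_intros tendsto_divide_0[OF tendsto_const] filterlim_real_sequentially filterlim_at_top_imp_at_infinity)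
    then have "eventually (\<lambda>n. y0 < y' - b / real n) sequentially"
      using y'(1) y0(1) by (intro order_tendstoD(1)) auto
    then show ?thesis
      using eventually_ge_at_top[of 1]
    proof eventually_elim
      case (elim n)
      have "real n < (real (n div k) + 1) * real k"
      proof -
        have "n < (n div k + 1) * k" using k(1) by (metis Suc_eq_plus1 dividend_less_div_times less_le_trans mult.commute mult_Suc add.commute order_refl zero_less_one)
        then have "real n < real ((n div k + 1) * k)" by (simp only: of_nat_less_iff)
        then show ?thesis by (simp add: algebra_simps)
      qed
      then have "(y' - b / real n) * real n \<le> real (n div k) * b"
      proof -
        have "real n * y' < (real (n div k) + 1) * real k * y'"
          using \<open>real n < _\<close> y0 y'(1) by (intro mult_strict_right_mono) auto
        moreover have "(y' - b / real n) * real n = y' * real n - b" using elim by (simp add: field_simps)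
        ultimately show ?thesis by (simp add: b_def algebra_simps)
      qed
      then have "ereal ((y' - b / real n) * real n) \<le> ereal (real (n div k) * b)" by simp
      also have "\<dots> \<le> a n" using N[of "n div k" "n mod k"] by simp
      finally have "ereal (y' - b / real n) \<le> a n / ereal (real n)"
        using elim by (cases "a n") (auto simp: pos_le_divide_eq)
      from less_le_trans[OF _ this] show ?case using elim(1) y0(1) by simp
    qed
  qed
next
  fix y assume Sy: "?S < y"
  have fin: "(a n - ereal C) / ereal (real n) \<le> ?S" if "1 \<le> n" for n
    using that by (intro SUP_upper) simp
  obtain y1 where y1: "?S < ereal y1" "ereal y1 < y" using ereal_dense2[OF Sy] by auto
  have "(\<lambda>n. y1 + C / real n) \<longlonglongrightarrow> y1 + 0"
    by (intro tendsto_intros tendsto_divide_0[OF tendsto_const] filterlim_real_sequentially filterlim_at_top_imp_at_infinity)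
  then have "(\<lambda>n. ereal (y1 + C / real n)) \<longlonglongrightarrow> ereal y1" by simp
  from order_tendstoD(2)[OF this y1(2)] eventually_ge_at_top[of 1]
  show "eventually (\<lambda>n. a n / ereal (real n) < y) sequentially"
  proof eventually_elim
    case (elim n)
    have "(a n - ereal C) / ereal (real n) \<le> ereal y1" using fin[OF elim(2)] y1(1) by simp
    then have "a n / ereal (real n) \<le> ereal (y1 + C / real n)"
      using elim(2) a[of n] by (cases "a n") (auto simp: field_simps)
    then show ?case using elim(1) by simp
  qed
qed

lemma emeasure_mixture:
  assumes "sets N = sets M" "B \<in> sets M" and a: "0 \<le> a" "a \<le> 1"
  shows "emeasure (mixture a M N) B = ennreal a * emeasure M B + ennreal (1 - a) * emeasure N B"
  unfolding mixture_def
proof (rule emeasure_measure_of_sigma)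
  show "sigma_algebra (space M) (sets M)" ..
  show "positive (sets M) (\<lambda>B. ennreal a * emeasure M B + ennreal (1 - a) * emeasure N B)"
    by (simp add: positive_def)
  show "countably_additive (sets M) (\<lambda>B. ennreal a * emeasure M B + ennreal (1 - a) * emeasure N B)"
    using assms(1)
    by (auto simp: countably_additive_def suminf_add[symmetric] ennreal_suminf_cmult suminf_emeasure)
qed fact

lemma mixture_in_inv_laws:
  assumes M: "M \<in> inv_laws A" and N: "N \<in> inv_laws A" and a: "0 \<le> a" "a \<le> 1"
  shows "mixture a M N \<in> inv_laws A"
proof -
  let ?X = "mixture a M N"
  have s: "sets ?X = sets (seq_space A)" "space ?X = space (seq_space A)"
    using inv_lawsD[OF M] by (simp_all add: mixture_def)
  have sNM: "sets N = sets M" using inv_lawsD[OF M] inv_lawsD[OF N] by simp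
  have e: "emeasure ?X B = ennreal a * emeasure M B + ennreal (1 - a) * emeasure N B" if "B \<in> sets (seq_space A)" for B
    using that inv_lawsD(1)[OF M] by (intro emeasure_mixture sNM a) auto
  have one: "ennreal a + ennreal (1 - a) = 1" using a by (simp add: ennreal_plus[symmetric] del: ennreal_plus)
  have "emeasure ?X (space ?X) = 1"
    using e[of "space (seq_space A)"] prob_space.emeasure_space_1[OF inv_lawsD(2)[OF M]]
      prob_space.emeasure_space_1[OF inv_lawsD(2)[OF N]] inv_lawsD(4)[OF M] inv_lawsD(4)[OF N] one
    by (simp add: s)
  then have p: "prob_space ?X" by (rule prob_spaceI)
  have "distr ?X (seq_space A) left_shift = ?X"
  proof (rule measure_eqI)
    fix B assume "B \<in> sets (distr ?X (seq_space A) left_shift)"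
    then have B: "B \<in> sets (seq_space A)" by simp
    have m: "left_shift \<in> measurable L (seq_space A)" if "sets L = sets (seq_space A)" for L
      unfolding measurable_cong_sets[OF that refl] by (rule left_shift_measurable)
    have B': "left_shift -` B \<inter> space (seq_space A) \<in> sets (seq_space A)"
      by (rule measurable_sets[OF left_shift_measurable B])
    have L: "emeasure L (left_shift -` B \<inter> space (seq_space A)) = emeasure L B" if "L \<in> inv_laws A" for L
      using emeasure_distr[OF m[OF inv_lawsD(1)[OF that]] B] inv_lawsD[OF that] by simp
    show "emeasure (distr ?X (seq_space A) left_shift) B = emeasure ?X B"
      using emeasure_distr[OF m[OF s(1)] B] by (simp add: s e B B' L[OF M] L[OF N])
  qed (simp add: s)
  with s p show ?thesis by (simp add: inv_laws_def)
qed

lemma pmf_block_law_emeasure: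
  fixes A :: "'a::countable set"
  assumes Q: "Q \<in> inv_laws A"
  shows "ennreal (pmf (block_law n Q) u) = emeasure Q {y \<in> space (seq_space A). block n y = u}"
proof -
  have "ennreal (pmf (block_law n Q) u) = emeasure (measure_pmf (block_law n Q)) {u}"
    by (simp add: emeasure_pmf_single)
  also have "\<dots> = emeasure Q (block n -` {u} \<inter> space Q)"
    unfolding measure_pmf_block_law[OF Q] by (rule emeasure_distr) (auto intro: measurable_window_inv[OF Q])
  also have "block n -` {u} \<inter> space Q = {y \<in> space (seq_space A). block n y = u}"
    using inv_lawsD(4)[OF Q] by auto
  finally show ?thesis .
qed

lemma pmf_block_law_mixture:
  fixes A :: "'a::countable set"
  assumes M: "M \<in> inv_laws A" and N: "N \<in> inv_laws A" and a: "0 \<le> a" "a \<le> 1"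
  shows "pmf (block_law n (mixture a M N)) u = a * pmf (block_law n M) u + (1 - a) * pmf (block_law n N) u"
proof -
  let ?B = "{y \<in> space (seq_space A). block n y = u}"
  have "block n -` {u} \<inter> space (seq_space A) \<in> sets (seq_space A)"
    using measurable_window[of "[1..int n]" A] by (intro measurable_sets[of "block n"]) (auto simp: block_def[abs_def])
  moreover have "block n -` {u} \<inter> space (seq_space A) = ?B" by auto
  ultimately have B: "?B \<in> sets M" using inv_lawsD(1)[OF M] by simp
  have "ennreal (pmf (block_law n (mixture a M N)) u) = ennreal (a * pmf (block_law n M) u + (1 - a) * pmf (block_law n N) u)"
    using a by (simp add: pmf_block_law_emeasure[OF mixture_in_inv_laws[OF M N a]] ennreal_plus ennreal_mult
        pmf_block_law_emeasure[OF M] pmf_block_law_emeasure[OF N] emeasure_mixture[OF _ B a] inv_lawsD(1)[OF M] inv_lawsD(1)[OF N])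
  then show ?thesis using a by (subst (asm) ennreal_inj) (auto intro!: add_nonneg_nonneg mult_nonneg_nonneg)
qed

section \<open>Specific relative entropy with respect to a quasi-Bernoulli law\<close>

text \<open>
  Adjacent blocks are independent up to a bounded factor. The constant is taken strictly positive so
  that \<open>exp (- C) < 1\<close>, which the iteration in \<open>zero_rate_cyl_ge_power\<close> needs.
\<close>

locale quasi_bernoulli =
  fixes A :: "'a::countable set" and P :: "(int \<Rightarrow> 'a) measure" and C :: real
  assumes P: "P \<in> inv_laws A" and C: "0 < C"
    and cyl_upper: "cyl P (u @ v) \<le> exp C * (cyl P u * cyl P v)"
    and cyl_lower: "cyl P u * cyl P v \<le> exp C * cyl P (u @ v)"
begin

abbreviation p :: "nat \<Rightarrow> 'a list pmf" where "p n \<equiv> block_law n P"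

abbreviation ent :: "nat \<Rightarrow> (int \<Rightarrow> 'a) measure \<Rightarrow> ereal" where
  "ent n Q \<equiv> kl (block_law n Q) (p n)"

lemma length_p: "u \<in> set_pmf (block_law n Q) \<Longrightarrow> Q \<in> inv_laws A \<Longrightarrow> length u = n"
  using set_pmf_block_law by blast

lemma pmf_p: "pmf (p n) u = (if length u = n then cyl P u else 0)"
  by (rule pmf_block_law_cyl[OF P])

lemma pmf_conc_p: "pmf (conc (p n) (p m)) w = (if length w = n + m then cyl P (take n w) * cyl P (drop n w) else 0)"
proof (cases "length w = n + m")
  case True
  then show ?thesis using pmf_conc[of "p n" n w "p m"] length_p[OF _ P] by (simp add: pmf_p)
next
  case False
  then have "w \<notin> set_pmf (conc (p n) (p m))"
    using length_p[OF _ P] by (auto simp: set_pmf_conc)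
  then show ?thesis using False by (simp add: pmf_eq_0_set_pmf)
qed

lemma mean_p_le_conc:
  assumes "bounded (range F)" "\<And>w. 0 \<le> F w"
  shows "mean (p (n + m)) F \<le> exp C * mean (conc (p n) (p m)) F"
proof (rule mean_le_dominated[OF assms])
  fix w show "pmf (p (n + m)) w \<le> exp C * pmf (conc (p n) (p m)) w"
    using cyl_upper[of "take n w" "drop n w"] by (simp add: pmf_p pmf_conc_p)
qed

lemma mean_conc_le_p:
  assumes "bounded (range F)" "\<And>w. 0 \<le> F w"
  shows "mean (conc (p n) (p m)) F \<le> exp C * mean (p (n + m)) F"
proof (rule mean_le_dominated[OF assms])
  fix w show "pmf (conc (p n) (p m)) w \<le> exp C * pmf (p (n + m)) w"
    using cyl_lower[of "take n w" "drop n w"] by (simp add: pmf_p pmf_conc_p)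
qed

lemma mean_p_split_le:
  assumes F: "bounded (range F)" "\<And>u. 0 \<le> F u" and G: "bounded (range G)" "\<And>u. 0 \<le> G u"
  shows "mean (p (n + m)) (\<lambda>w. F (take n w) * G (drop n w)) \<le> exp C * (mean (p n) F * mean (p m) G)"
proof -
  have "mean (p (n + m)) (\<lambda>w. F (take n w) * G (drop n w)) \<le> exp C * mean (conc (p n) (p m)) (\<lambda>w. F (take n w) * G (drop n w))"
    by (intro mean_p_le_conc bounded_range_intros bounded_range_comp[OF F(1)] bounded_range_comp[OF G(1)] mult_nonneg_nonneg F G)
  then show ?thesis using F G length_p[OF _ P] by (simp add: mean_conc_split)
qed

lemma mean_p_split_ge:
  assumes F: "bounded (range F)" "\<And>u. 0 \<le> F u" and G: "bounded (range G)" "\<And>u. 0 \<le> G u"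
  shows "mean (p n) F * mean (p m) G \<le> exp C * mean (p (n + m)) (\<lambda>w. F (take n w) * G (drop n w))"
proof -
  have "mean (conc (p n) (p m)) (\<lambda>w. F (take n w) * G (drop n w)) \<le> exp C * mean (p (n + m)) (\<lambda>w. F (take n w) * G (drop n w))"
    by (intro mean_conc_le_p bounded_range_intros bounded_range_comp[OF F(1)] bounded_range_comp[OF G(1)] mult_nonneg_nonneg F G)
  then show ?thesis using F G length_p[OF _ P] by (simp add: mean_conc_split)
qed

lemma ent_superadditive:
  assumes Q: "Q \<in> inv_laws A"
  shows "ent n Q + ent m Q \<le> ent (n + m) Q + ereal C"
proof -
  have "kl (map_pmf (take n) (block_law (n + m) Q)) (p n) + kl (map_pmf (drop n) (block_law (n + m) Q)) (p m)
    \<le> ent (n + m) Q + ereal (ln (exp C))"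
    by (rule kl_superadditive) (auto intro: mean_p_split_le)
  then show ?thesis by (simp add: map_pmf_take[OF Q] map_pmf_drop[OF Q])
qed

text \<open>
  The supremum in Fekete's lemma, which is the limit of the entropies per site. In this form the
  function is visibly lower semicontinuous, and each single \<open>k\<close> gives a lower bound for it.
\<close>

definition rate :: "(int \<Rightarrow> 'a) measure \<Rightarrow> ereal" where
  "rate Q = (SUP k\<in>{1..}. (ent k Q - ereal C) / ereal (real k))"

lemma rate_limit:
  assumes Q: "Q \<in> inv_laws A"
  shows "(\<lambda>n. ent n Q / ereal (real n)) \<longlonglongrightarrow> rate Q"
  unfolding rate_def
  by (rule superadditive_limit) (use C kl_nonneg ent_superadditive[OF Q] in auto)

lemma entropy_rate_limit:
  assumes Q: "Q \<in> inv_laws A"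
  shows "entropy_rate A Q P \<longlonglongrightarrow> rate Q"
  using rate_limit[OF Q] by (simp add: entropy_rate_def[abs_def] rel_entropy_marginal[OF Q P])

lemma specific_rel_entropy_eq_rate:
  assumes Q: "Q \<in> inv_laws A"
  shows "convergent (entropy_rate A Q P)" "specific_rel_entropy A Q P = rate Q"
  using entropy_rate_limit[OF Q] by (auto simp: convergent_def specific_rel_entropy_def intro: limI)

lemma rate_nonneg:
  assumes Q: "Q \<in> inv_laws A"
  shows "0 \<le> rate Q"
proof (rule LIMSEQ_le_const[OF rate_limit[OF Q]])
  show "\<exists>N. \<forall>n\<ge>N. 0 \<le> ent n Q / ereal (real n)"
  proof (intro exI allI impI)
    fix n :: nat show "0 \<le> ent n Q / ereal (real n)"
      using kl_nonneg[of "block_law n Q" "p n"] by (cases n) (auto simp: divide_ereal_def)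
  qed
qed

lemma ent_le_rate:
  assumes "1 \<le> k" "rate Q = ereal r"
  shows "ent k Q \<le> ereal (real k * r + C)"
proof -
  have "(ent k Q - ereal C) / ereal (real k) \<le> ereal r"
    unfolding assms(2)[symmetric] rate_def using assms(1) by (intro SUP_upper) simp
  then show ?thesis using assms(1) kl_nonneg[of "block_law k Q" "p k"]
    by (cases "ent k Q") (auto simp: field_simps)
qed

lemma rate_lsc: "lower_semicontinuous (weak_topology A) rate"
  unfolding lower_semicontinuous_def
proof
  fix c :: ereal
  have ts: "topspace (weak_topology A) = inv_laws A" by (rule topspace_weak_topology)
  show "openin (weak_topology A) {Q \<in> topspace (weak_topology A). c < rate Q}"
  proof (cases c)
    case PInf
    then show ?thesis by simp
  next
    case MInf
    have "- \<infinity> < rate Q" if "Q \<in> inv_laws A" for Q using rate_nonneg[OF that] by auto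
    then have "{Q \<in> topspace (weak_topology A). c < rate Q} = topspace (weak_topology A)" using MInf ts by auto
    then show ?thesis by simp
  next
    case (real r)
    let ?U = "\<lambda>k f. {Q \<in> inv_laws A. mean (block_law k Q) f \<in> {r * real k + C + ln (mean (p k) (\<lambda>x. exp (f x)))<..}}"
    have "{Q \<in> topspace (weak_topology A). c < rate Q} = (\<Union>k\<in>{1..}. \<Union>f\<in>{f. bounded (range f)}. ?U k f)"
    proof -
      have "c < rate Q \<longleftrightarrow> (\<exists>k\<ge>1. \<exists>f. bounded (range f) \<and> r * real k + C + ln (mean (p k) (\<lambda>x. exp (f x))) < mean (block_law k Q) f)" for Q
      proof -
        have "c < rate Q \<longleftrightarrow> (\<exists>k\<ge>1. ereal r < (ent k Q - ereal C) / ereal (real k))"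
          by (auto simp: rate_def less_SUP_iff real)
        also have "\<dots> \<longleftrightarrow> (\<exists>k\<ge>1. ereal (r * real k + C) < ent k Q)"
        proof (intro ex_cong1 conj_cong refl)
          fix k :: nat assume "1 \<le> k"
          then show "(ereal r < (ent k Q - ereal C) / ereal (real k)) = (ereal (r * real k + C) < ent k Q)"
            using kl_nonneg[of "block_law k Q" "p k"] by (cases "ent k Q") (auto simp: field_simps)
        qed
        also have "\<dots> \<longleftrightarrow> (\<exists>k\<ge>1. \<exists>f. bounded (range f) \<and> r * real k + C + ln (mean (p k) (\<lambda>x. exp (f x))) < mean (block_law k Q) f)"
          by (auto simp: kl_def less_SUP_iff algebra_simps)
        finally show ?thesis .
      qed
      then show ?thesis by (auto simp: ts)
    qed
    also have "openin (weak_topology A) \<dots>"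
    proof -
      have "openin (weak_topology A) (?U k f)" if "bounded (range f)" for k f
        using that by (rule openin_weak_topology_block) simp
      then have "openin (weak_topology A) (\<Union>f\<in>{f. bounded (range f)}. ?U k f)" for k
        by (intro openin_Union) blast
      then show ?thesis by (intro openin_Union) blast
    qed
    finally show ?thesis .
  qed
qed

lemma rate_mix:
  assumes Q: "Q \<in> inv_laws A" "Q1 \<in> inv_laws A" "Q2 \<in> inv_laws A" and a: "0 \<le> a" "a \<le> 1"
    and mix: "\<And>n u. pmf (block_law n Q) u = a * pmf (block_law n Q1) u + (1 - a) * pmf (block_law n Q2) u"
  shows "rate Q = ereal a * rate Q1 + ereal (1 - a) * rate Q2"
proof -
  let ?x = "\<lambda>n. ereal a * (ent n Q1 / ereal (real n)) + ereal (1 - a) * (ent n Q2 / ereal (real n))"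
  have nn: "0 \<le> ent n Q / ereal (real n)" for n Q
    using kl_nonneg[of "block_law n Q" "p n"] by (cases n) (auto simp: divide_ereal_def)
  have x: "?x \<longlonglongrightarrow> ereal a * rate Q1 + ereal (1 - a) * rate Q2"
    by (intro tendsto_add_ereal_nonneg tendsto_cmult_ereal rate_limit Q)
       (use a nn rate_nonneg Q in auto)
  have eq: "?x n = (ereal a * ent n Q1 + ereal (1 - a) * ent n Q2) / ereal (real n)" for n
    using a by (simp add: divide_ereal_def ereal_left_distrib kl_nonneg mult.assoc)
  have l2: "(\<lambda>n. ent n Q / ereal (real n) + ereal (ln 2 / real n)) \<longlonglongrightarrow> rate Q + ereal 0"
  proof (intro tendsto_add_ereal_nonneg rate_limit Q)
    have "(\<lambda>n. ln 2 / real n) \<longlonglongrightarrow> 0"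
      by (intro tendsto_divide_0[OF tendsto_const] filterlim_real_sequentially filterlim_at_top_imp_at_infinity)
    then show "(\<lambda>n. ereal (ln 2 / real n)) \<longlonglongrightarrow> ereal 0" by simp
  qed (use rate_nonneg[OF Q(1)] in auto)
  have "rate Q \<le> ereal a * rate Q1 + ereal (1 - a) * rate Q2"
  proof (rule LIMSEQ_le[OF rate_limit[OF Q(1)] x], intro exI[of _ 1] allI impI)
    fix n :: nat assume "1 \<le> n"
    then show "ent n Q / ereal (real n) \<le> ?x n"
      unfolding eq using kl_mix_le[OF mix a] by (intro ereal_divide_right_mono) auto
  qed
  moreover have "ereal a * rate Q1 + ereal (1 - a) * rate Q2 \<le> rate Q + ereal 0"
  proof (rule LIMSEQ_le[OF x l2], intro exI[of _ 1] allI impI)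
    fix n :: nat assume n: "1 \<le> n"
    have "?x n \<le> (ent n Q + ereal (ln 2)) / ereal (real n)"
      unfolding eq using kl_mix_ge[OF mix a] n by (intro ereal_divide_right_mono) auto
    also have "\<dots> = ent n Q / ereal (real n) + ereal (ln 2 / real n)"
      using n by (simp add: divide_ereal_def ereal_left_distrib kl_nonneg divide_inverse)
    finally show "?x n \<le> ent n Q / ereal (real n) + ereal (ln 2 / real n)" .
  qed
  ultimately show ?thesis by (simp add: zero_ereal_def[symmetric])
qed

lemma rate_self: "rate P = 0"
proof (rule LIMSEQ_unique[OF rate_limit[OF P]])
  show "(\<lambda>n. ent n P / ereal (real n)) \<longlonglongrightarrow> 0" by (simp add: kl_self)
qed

text \<open>
  A zero rate bounds all block entropies by \<open>C\<close>. If \<open>f\<close> is nearly optimal for a block of length \<open>n\<close> whose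
  entropy is nearly the supremum \<open>S\<close>, then no test function of a longer block can gain more than a small
  amount. The penalty \<open>- t\<close> on the occurrence of \<open>u\<close> after the block costs \<open>t cyl Q u\<close>, and by the
  quasi-Bernoulli property it lowers the exponential moment by at least \<open>(1 - exp (- t)) exp (- C) cyl P u\<close>.
  Comparing the two and letting \<open>t\<close> tend to 0 gives the claim.
\<close>

lemma zero_rate_cyl_ge:
  assumes Q: "Q \<in> inv_laws A" and 0: "rate Q = 0"
  shows "exp (- C) * cyl P u \<le> cyl Q u"
proof -
  let ?m = "length u"
  define s where "s = (SUP n\<in>{1..}. ent n Q)"
  have sC: "s \<le> ereal C"
    unfolding s_def using ent_le_rate[of _ Q 0] 0 by (intro SUP_least) (auto simp: zero_ereal_def)
  have s0: "0 \<le> s" unfolding s_def by (rule SUP_upper2[of 1]) (auto simp: kl_nonneg)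
  obtain S where S: "s = ereal S" using sC s0 by (cases s) auto
  have entS: "ent n Q \<le> ereal S" if "1 \<le> n" for n
    unfolding S[symmetric] s_def using that by (intro SUP_upper) simp
  let ?x = "exp (- C) * cyl P u"
  have key: "(1 - exp (- t)) * ?x \<le> t * cyl Q u" if t: "0 < t" for t
  proof (rule field_le_epsilon)
    fix e :: real assume e: "0 < e"
    have "ereal (S - e) < s" using S e by simp
    then obtain n where n: "1 \<le> n" "ereal (S - e) < ent n Q" unfolding s_def by (auto simp: less_SUP_iff)
    obtain f where f: "bounded (range f)" "mean (p n) (\<lambda>x. exp (f x)) = 1" "S - e < mean (block_law n Q) f"
      by (rule kl_normalized[OF n(2)])
    let ?g = "\<lambda>v. indicator {u} v :: real"
    \<comment> \<open>\<open>exp (- t \<one>\<^sub>u) = 1 - ?D \<one>\<^sub>u\<close> for the indicator \<open>\<one>\<^sub>u\<close> of \<open>u\<close>.\<close>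
    let ?D = "1 - exp (- t)"
    have D: "0 < ?D" "?D < 1" using t by auto
    define F where "F w = f (take n w) - t * ?g (drop n w)" for w
    have bf: "bounded (range (\<lambda>w. f (take n w)))" by (rule bounded_range_comp[OF f(1)])
    have bg: "bounded (range (\<lambda>w. ?g (drop n w)))"
      using bounded_range_comp[OF bounded_range_indicator[of "{u}"], of "drop n"] .
    have bF: "bounded (range F)" unfolding F_def by (intro bounded_range_intros bf bg)
    have mQ: "mean (block_law (n + ?m) Q) F = mean (block_law n Q) f - t * cyl Q u"
    proof -
      have 1: "mean (block_law (n + ?m) Q) (\<lambda>w. f (take n w)) = mean (block_law n Q) f"
        using map_pmf_take[OF Q, of n "n + ?m"] integral_map_pmf[of "take n" "block_law (n + ?m) Q" f] by simp
      have 2: "mean (block_law (n + ?m) Q) (\<lambda>w. ?g (drop n w)) = cyl Q u"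
        using map_pmf_drop[OF Q, of n "n + ?m"] integral_map_pmf[of "drop n" "block_law (n + ?m) Q" ?g]
        by (simp add: cyl_def measure_pmf_single)
      have "mean (block_law (n + ?m) Q) F = mean (block_law (n + ?m) Q) (\<lambda>w. f (take n w)) - t * mean (block_law (n + ?m) Q) (\<lambda>w. ?g (drop n w))"
        unfolding F_def by (simp only: Bochner_Integration.integral_diff integrable_pmf_bounded bf bg integral_mult_right_zero bounded_range_intros)
      then show ?thesis by (simp only: 1 2)
    qed
    define X where "X = mean (p (n + ?m)) (\<lambda>w. exp (f (take n w)) * ?g (drop n w))"
    have X: "?x \<le> X"
    proof -
      have "mean (p n) (\<lambda>x. exp (f x)) * mean (p ?m) ?g \<le> exp C * X"
        unfolding X_def by (rule mean_p_split_ge) (auto intro: bounded_range_exp f)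
      then show ?thesis by (simp add: f measure_pmf_single pmf_block_law_cyl[OF P] exp_minus field_simps)
    qed
    have mP: "mean (p (n + ?m)) (\<lambda>w. exp (F w)) = 1 - ?D * X"
    proof -
      have 1: "mean (p (n + ?m)) (\<lambda>w. exp (f (take n w))) = 1"
        using map_pmf_take[OF P, of n "n + ?m"] integral_map_pmf[of "take n" "p (n + ?m)" "\<lambda>x. exp (f x)"] f(2) by simp
      have 2: "exp (F w) = exp (f (take n w)) - ?D * (exp (f (take n w)) * ?g (drop n w))" for w
        by (simp add: F_def exp_diff exp_minus field_simps split: split_indicator)
      have "mean (p (n + ?m)) (\<lambda>w. exp (F w)) = mean (p (n + ?m)) (\<lambda>w. exp (f (take n w))) - ?D * X"
        unfolding 2 X_def by (simp only: Bochner_Integration.integral_diff integrable_pmf_bounded bf bg integral_mult_right_zero bounded_range_intros)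
      then show ?thesis by (simp only: 1)
    qed
    define c where "c = 1 - ?D * ?x"
    have c: "mean (p (n + ?m)) (\<lambda>w. exp (F w)) \<le> c"
      unfolding mP c_def using X D by (simp add: mult_left_mono)
    have "0 < c" using c mean_exp_pos[OF bF, of "p (n + ?m)"] by simp
    then have "ereal (mean (block_law (n + ?m) Q) F) \<le> ent (n + ?m) Q + ereal (ln c)"
      by (rule kl_normalized_upper[OF bF c])
    also have "\<dots> \<le> ereal S + ereal (ln c)" using n(1) by (intro add_right_mono entS) simp
    finally have "mean (block_law n Q) f - t * cyl Q u \<le> S + ln c" by (simp add: mQ)
    moreover have "ln c \<le> - (?D * ?x)" using ln_le_minus_one[OF \<open>0 < c\<close>] by (simp add: c_def)
    ultimately show "?D * ?x \<le> t * cyl Q u + e" using f(3) by linarith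
  qed
  have y: "0 \<le> cyl Q u" "cyl Q u \<le> 1" by (simp_all add: cyl_def pmf_le_1)
  have x0: "0 \<le> ?x" by (simp add: cyl_def)
  show ?thesis
  proof (rule field_le_epsilon)
    fix t :: real assume t: "0 < t"
    have "1 + t \<le> exp t" by (rule exp_ge_add_one_self)
    then have "exp (- t) \<le> 1 / (1 + t)" using t by (simp add: exp_minus field_simps)
    then have "t / (1 + t) \<le> 1 - exp (- t)" using t by (simp add: field_simps)
    then have "t / (1 + t) * ?x \<le> t * cyl Q u" using key[OF t] x0 by (meson mult_right_mono order_trans)
    then have "t * ?x \<le> t * ((1 + t) * cyl Q u)" using t by (simp add: field_simps)
    then have "?x \<le> (1 + t) * cyl Q u" using t by simp
    also have "\<dots> \<le> cyl Q u + t" using y t by (simp add: distrib_right mult_left_le)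
    finally show "?x \<le> cyl Q u + t" .
  qed
qed

text \<open>
  Stationarity of \<open>P\<close> and \<open>Q\<close> passes to the normalised difference of the cylinder probabilities, and the
  extension theorem turns these into a law.
\<close>

lemma subtract_invariant:
  assumes Q: "Q \<in> inv_laws A" and d: "0 < d" "d < 1" and ge: "\<And>u. d * cyl P u \<le> cyl Q u"
  obtains R where "R \<in> inv_laws A"
    "\<And>n u. pmf (block_law n Q) u = d * pmf (p n) u + (1 - d) * pmf (block_law n R) u"
proof -
  define g where "g n u = (pmf (block_law n Q) u - d * pmf (p n) u) / (1 - d)" for n u
  have g0: "0 \<le> g n u" for n u
  proof -
    have "d * pmf (p n) u \<le> pmf (block_law n Q) u"
      using ge[of u] by (simp add: pmf_block_law_cyl[OF P] pmf_block_law_cyl[OF Q])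
    then show ?thesis using d by (simp add: g_def)
  qed
  have int: "integrable (count_space UNIV) (g n)" "(\<integral>u. g n u \<partial>count_space UNIV) = 1" for n
    using d by (auto simp: g_def[abs_def] integrable_pmf integral_pmf)
  have total: "(\<integral>\<^sup>+u. ennreal (g n u) \<partial>count_space UNIV) = 1" for n
    by (subst nn_integral_eq_integral[OF int(1)]) (simp_all add: g0 int(2))
  define b where "b n = embed_pmf (g n)" for n
  have pb: "pmf (b n) u = g n u" for n u
    unfolding b_def by (rule pmf_embed_pmf[OF g0 total])
  have mix: "pmf (block_law n Q) u = d * pmf (p n) u + (1 - d) * pmf (b n) u" for n u
    using d by (simp add: pb g_def)
  have probmix: "measure_pmf.prob (block_law n Q) X = d * measure_pmf.prob (p n) X + (1 - d) * measure_pmf.prob (b n) X" for n X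
    using mean_mix[OF bounded_range_indicator[of X] mix] by simp
  have sb: "set_pmf (b n) \<subseteq> set_pmf (block_law n Q)" for n
  proof
    fix u assume "u \<in> set_pmf (b n)"
    then have "0 < pmf (b n) u" by (simp add: pmf_positive)
    then have "0 < pmf (block_law n Q) u" unfolding mix using d by (intro add_nonneg_pos) auto
    then show "u \<in> set_pmf (block_law n Q)" by (simp add: set_pmf_iff)
  qed
  have cons: "map_pmf r (b (Suc n)) = b n"
    if "map_pmf r (block_law (Suc n) Q) = block_law n Q" "map_pmf r (p (Suc n)) = p n" for r n
  proof (rule pmf_eqI)
    fix u
    have e: "pmf (block_law n Q) u = measure_pmf.prob (block_law (Suc n) Q) (r -` {u})"
      "pmf (p n) u = measure_pmf.prob (p (Suc n)) (r -` {u})"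
      unfolding that[symmetric] by (rule pmf_map)+
    have "(1 - d) * pmf (map_pmf r (b (Suc n))) u = (1 - d) * pmf (b n) u"
      using mix[of n u] probmix[of "Suc n" "r -` {u}"] e by (simp add: pmf_map)
    then show "pmf (map_pmf r (b (Suc n))) u = pmf (b n) u" using d by simp
  qed
  have "\<exists>R\<in>inv_laws A. \<forall>n. block_law n R = b n"
  proof (rule stationary_extension[of b A])
    show "length u = n \<and> set u \<subseteq> A" if "u \<in> set_pmf (b n)" for n u
      using that sb[of n] set_pmf_block_law[OF Q, of n] by auto
    show "map_pmf tl (b (Suc n)) = b n" for n by (rule cons[OF map_pmf_tl[OF Q] map_pmf_tl[OF P]])
    show "map_pmf butlast (b (Suc n)) = b n" for n by (rule cons[OF map_pmf_butlast[OF Q] map_pmf_butlast[OF P]])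
  qed blast
  then show ?thesis using mix that by auto
qed

text \<open>
  Affinity makes the remainder \<open>R\<close> in \<open>Q = d P + (1 - d) R\<close> a law of rate zero again, so a lower bound
  valid for all such laws improves itself: from \<open>1 - (1 - d)\<^sup>n\<close> to \<open>d + (1 - d) (1 - (1 - d)\<^sup>n)\<close>.
\<close>

lemma zero_rate_cyl_ge_power:
  assumes "Q \<in> inv_laws A" "rate Q = 0"
  shows "(1 - (1 - exp (- C)) ^ n) * cyl P u \<le> cyl Q u"
  using assms
proof (induction n arbitrary: Q)
  case (Suc n)
  let ?d = "exp (- C)"
  have d: "0 < ?d" "?d < 1" using C by auto
  obtain R where R: "R \<in> inv_laws A"
    "\<And>n u. pmf (block_law n Q) u = ?d * pmf (p n) u + (1 - ?d) * pmf (block_law n R) u"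
    by (rule subtract_invariant[OF Suc.prems(1) d zero_rate_cyl_ge[OF Suc.prems]]) blast
  have "0 = ereal ?d * rate P + ereal (1 - ?d) * rate R"
    using rate_mix[OF Suc.prems(1) P R(1) _ _ R(2)] d Suc.prems(2) by simp
  then have "rate R = 0" using d by (simp add: rate_self)
  then have IH: "(1 - (1 - ?d) ^ n) * cyl P u \<le> cyl R u" by (rule Suc.IH[OF R(1)])
  have "(1 - (1 - ?d) ^ Suc n) * cyl P u = ?d * cyl P u + (1 - ?d) * ((1 - (1 - ?d) ^ n) * cyl P u)"
    by (simp add: algebra_simps)
  also have "\<dots> \<le> ?d * cyl P u + (1 - ?d) * cyl R u"
    using IH d by (intro add_left_mono mult_left_mono) auto
  also have "\<dots> = cyl Q u" unfolding cyl_def R(2) ..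
  finally show ?case .
qed (simp add: cyl_def)

theorem rate_eq_zero_iff:
  assumes Q: "Q \<in> inv_laws A"
  shows "rate Q = 0 \<longleftrightarrow> Q = P"
proof
  assume 0: "rate Q = 0"
  have le: "cyl P u \<le> cyl Q u" for u
  proof -
    have "(\<lambda>n. (1 - exp (- C)) ^ n) \<longlonglongrightarrow> 0"
    proof (rule LIMSEQ_power_zero)
      have "0 < exp (- C)" "exp (- C) < 1" using C by auto
      then show "norm (1 - exp (- C)) < 1" unfolding real_norm_def abs_less_iff by linarith
    qed
    then have "(\<lambda>n. (1 - (1 - exp (- C)) ^ n) * cyl P u) \<longlonglongrightarrow> (1 - 0) * cyl P u"
      by (intro tendsto_mult tendsto_diff tendsto_const)
    then have "(1 - 0) * cyl P u \<le> cyl Q u"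
      by (rule LIMSEQ_le_const2) (use zero_rate_cyl_ge_power[OF Q 0] in auto)
    then show ?thesis by simp
  qed
  have "pmf (p n) u \<le> pmf (block_law n Q) u" for n u
    using le[of u] by (simp add: pmf_block_law_cyl[OF P] pmf_block_law_cyl[OF Q])
  then have "p n = block_law n Q" for n by (intro pmf_eqI_ge)
  then show "Q = P" by (intro inv_laws_eqI[OF Q P]) simp
qed (simp add: rate_self)

end

section \<open>Empirical laws of periodically continued words\<close>

definition cyclic_window :: "'a list \<Rightarrow> nat \<Rightarrow> nat \<Rightarrow> 'a list" where
  "cyclic_window u i m = map (\<lambda>j. u ! ((i + j) mod length u)) [0..<m]"

lemma length_cyclic_window [simp]: "length (cyclic_window u i m) = m"
  by (simp add: cyclic_window_def)

lemma cyclic_window_inner: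
  assumes "i + m \<le> length u" shows "cyclic_window u i m = take m (drop i u)"
  by (rule nth_equalityI) (use assms in \<open>auto simp: cyclic_window_def\<close>)

definition cyclic_orbit :: "'a list \<Rightarrow> nat \<Rightarrow> int \<Rightarrow> 'a" where
  "cyclic_orbit u i = (\<lambda>k. u ! nat ((k - 1 + int i) mod int (length u)))"

text \<open>
  The empirical law of the periodic continuation of \<open>u\<close>, as the image of the uniform distribution on the
  sites of one period.
\<close>

definition cyclic_law :: "'a set \<Rightarrow> 'a list \<Rightarrow> (int \<Rightarrow> 'a) measure" where
  "cyclic_law A u = distr (measure_pmf (pmf_of_set {..<length u})) (seq_space A) (cyclic_orbit u)"

lemma block_cyclic_orbit:
  assumes "u \<noteq> []" shows "block m (cyclic_orbit u i) = cyclic_window u i m"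
proof (rule nth_equalityI)
  fix j assume "j < length (block m (cyclic_orbit u i))"
  then have j: "j < m" by simp
  have "block m (cyclic_orbit u i) ! j = u ! nat ((int j + int i) mod int (length u))"
    using j by (simp add: block_def cyclic_orbit_def)
  also have "(int j + int i) mod int (length u) = int ((i + j) mod length u)" by (simp add: zmod_int add.commute)
  finally show "block m (cyclic_orbit u i) ! j = cyclic_window u i m ! j" using j by (simp add: cyclic_window_def)
qed simp

lemma cyclic_orbit_in_space:
  assumes "u \<noteq> []" "set u \<subseteq> A" shows "cyclic_orbit u i \<in> space (seq_space A)"
  unfolding space_seq_space
proof
  fix k
  have "nat ((k - 1 + int i) mod int (length u)) < length u" using assms(1) by (simp add: nat_less_iff)
  then show "cyclic_orbit u i k \<in> A" unfolding cyclic_orbit_def using assms(2) nth_mem by blast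
qed

lemma measurable_cyclic_orbit:
  assumes "u \<noteq> []" "set u \<subseteq> A" shows "cyclic_orbit u \<in> measurable (measure_pmf q) (seq_space A)"
  using cyclic_orbit_in_space[OF assms] by (simp add: measurable_pmf_measure1)

lemma left_shift_cyclic_orbit:
  assumes "u \<noteq> []" shows "left_shift (cyclic_orbit u i) = cyclic_orbit u (Suc i mod length u)"
proof
  fix k
  have "(k - 1 + int (Suc i mod length u)) mod int (length u) = (k - 1 + int (Suc i)) mod int (length u)"
    by (simp only: zmod_int mod_add_right_eq)
  also have "k - 1 + int (Suc i) = k + 1 - 1 + int i" by simp
  finally have "(k - 1 + int (Suc i mod length u)) mod int (length u) = (k + 1 - 1 + int i) mod int (length u)" .
  then show "left_shift (cyclic_orbit u i) k = cyclic_orbit u (Suc i mod length u) k"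
    by (simp add: left_shift_def cyclic_orbit_def)
qed

text \<open>
  The shift rotates the sites of one period, and the uniform distribution is invariant under rotation.
\<close>

lemma cyclic_law_in_inv_laws:
  assumes u: "u \<noteq> []" "set u \<subseteq> A" shows "cyclic_law A u \<in> inv_laws A"
proof -
  let ?n = "length u" and ?q = "pmf_of_set {..<length u}"
  have ne: "{..<?n} \<noteq> {}" using u(1) by auto
  note m = measurable_cyclic_orbit[OF u]
  have "map_pmf (\<lambda>i. Suc i mod ?n) ?q = ?q"
  proof (rule map_pmf_of_set_bij_betw)
    show "bij_betw (\<lambda>i. Suc i mod ?n) {..<?n} {..<?n}"
    proof -
      have e: "Suc i mod ?n = (if Suc i = ?n then 0 else Suc i)" if "i < ?n" for i
        using that by (simp add: mod_Suc)
      have inj: "inj_on (\<lambda>i. Suc i mod ?n) {..<?n}"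
        by (rule inj_onI) (auto simp: e split: if_splits)
      have "(\<lambda>i. Suc i mod ?n) ` {..<?n} \<subseteq> {..<?n}" using u(1) by auto
      from endo_inj_surj[OF _ this inj] inj show ?thesis by (simp add: bij_betw_def)
    qed
  qed (use ne in auto)
  then have q: "distr (measure_pmf ?q) (count_space UNIV) (\<lambda>i. Suc i mod ?n) = measure_pmf ?q"
    by (metis map_pmf_rep_eq)
  have "distr (cyclic_law A u) (seq_space A) left_shift
      = distr (measure_pmf ?q) (seq_space A) (left_shift \<circ> cyclic_orbit u)"
    unfolding cyclic_law_def by (rule distr_distr[OF left_shift_measurable m])
  also have "left_shift \<circ> cyclic_orbit u = cyclic_orbit u \<circ> (\<lambda>i. Suc i mod ?n)"
    by (simp add: fun_eq_iff left_shift_cyclic_orbit[OF u(1)])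
  also have "distr (measure_pmf ?q) (seq_space A) (cyclic_orbit u \<circ> (\<lambda>i. Suc i mod ?n))
      = distr (distr (measure_pmf ?q) (count_space UNIV) (\<lambda>i. Suc i mod ?n)) (seq_space A) (cyclic_orbit u)"
    by (rule distr_distr[symmetric]) (use m[of ?q] in \<open>auto simp: measurable_pmf_measure1 measurable_count_space_eq1\<close>)
  also have "\<dots> = cyclic_law A u" by (simp only: q cyclic_law_def)
  finally have "distr (cyclic_law A u) (seq_space A) left_shift = cyclic_law A u" .
  moreover have "prob_space (cyclic_law A u)"
    unfolding cyclic_law_def by (rule measure_pmf.prob_space_distr[OF m])
  ultimately show ?thesis by (simp add: inv_laws_def cyclic_law_def)
qed

lemma block_law_cyclic_law:
  fixes A :: "'a::countable set"
  assumes u: "u \<noteq> []" "set u \<subseteq> A"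
  shows "block_law m (cyclic_law A u) = map_pmf (\<lambda>i. cyclic_window u i m) (pmf_of_set {..<length u})"
proof -
  have bm: "block m \<in> measurable (seq_space A) (count_space UNIV)"
    unfolding block_def[abs_def] by (rule measurable_window)
  have "measure_pmf (block_law m (cyclic_law A u)) = measure_pmf (map_pmf (\<lambda>i. cyclic_window u i m) (pmf_of_set {..<length u}))"
    unfolding measure_pmf_block_law[OF cyclic_law_in_inv_laws[OF u]] map_pmf_rep_eq
    unfolding cyclic_law_def distr_distr[OF bm measurable_cyclic_orbit[OF u]]
    by (simp add: o_def block_cyclic_orbit[OF u(1)])
  then show ?thesis by (simp add: measure_pmf_inject)
qed

lemma mean_block_law_cyclic_law:
  fixes A :: "'a::countable set"
  assumes u: "u \<noteq> []" "set u \<subseteq> A"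
  shows "mean (block_law m (cyclic_law A u)) f = (\<Sum>i<length u. f (cyclic_window u i m)) / real (length u)"
proof -
  have "{..<length u} \<noteq> {}" using u(1) by auto
  then show ?thesis
    unfolding block_law_cyclic_law[OF u] by (simp add: integral_pmf_of_set)
qed

lemma cyl_cyclic_law:
  fixes A :: "'a::countable set"
  assumes u: "u \<noteq> []" "set u \<subseteq> A"
  shows "cyl (cyclic_law A u) v = (\<Sum>i<length u. indicator {v} (cyclic_window u i (length v))) / real (length u)"
  using mean_block_law_cyclic_law[OF u, of "length v" "indicator {v}"] by (simp add: cyl_def measure_pmf_single)

section \<open>The large deviation upper bound\<close>

lemma sum_blocks:
  fixes g :: "nat \<Rightarrow> real"
  shows "(\<Sum>i<N * k. g i) = (\<Sum>l<N. \<Sum>j<k. g (l * k + j))"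
proof -
  have "(\<Sum>l<N. \<Sum>j<k. g (l * k + j)) = (\<Sum>l<N. sum g {l * k..<l * k + k})"
  proof (rule sum.cong[OF refl])
    fix l
    show "(\<Sum>j<k. g (l * k + j)) = sum g {l * k..<l * k + k}"
      using sum.shift_bounds_nat_ivl[of g 0 "l * k" k] by (simp add: lessThan_atLeast0 ac_simps)
  qed
  then show ?thesis by (simp add: sum.nat_group)
qed

lemma bounded_range_sum:
  fixes f :: "'b \<Rightarrow> 'a \<Rightarrow> real"
  assumes "\<And>i. i \<in> I \<Longrightarrow> bounded (range (f i))"
  shows "bounded (range (\<lambda>x. \<Sum>i\<in>I. f i x))"
proof (cases "finite I")
  case True
  then show ?thesis using assms by (induction I) (auto intro!: bounded_range_intros)
qed simp

lemma mean_sum_bounded: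
  fixes f :: "'b \<Rightarrow> 'a \<Rightarrow> real"
  assumes "\<And>i. i \<in> I \<Longrightarrow> bounded (range (f i))"
  shows "mean p (\<lambda>x. \<Sum>i\<in>I. f i x) = (\<Sum>i\<in>I. mean p (f i))"
  by (rule Bochner_Integration.integral_sum) (use assms in \<open>auto intro: integrable_pmf_bounded\<close>)

definition block_sum :: "nat \<Rightarrow> ('a list \<Rightarrow> real) \<Rightarrow> nat \<Rightarrow> 'a list \<Rightarrow> real" where
  "block_sum k f N w = (\<Sum>l<N. f (take k (drop (l * k) w)))"

lemma bounded_block_sum: "bounded (range f) \<Longrightarrow> bounded (range (block_sum k f N))"
  unfolding block_sum_def[abs_def] by (intro bounded_range_sum) (erule bounded_range_comp)

lemma block_sum_Suc: "block_sum k f (Suc N) w = f (take k w) + block_sum k f N (drop k w)"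
  unfolding block_sum_def sum.lessThan_Suc_shift by (simp add: add.commute)

lemma block_sum_drop_take:
  assumes "N * k + j \<le> length w"
  shows "block_sum k f N (take (N * k) (drop j w)) = (\<Sum>l<N. f (take k (drop (j + l * k) w)))"
  unfolding block_sum_def
proof (rule sum.cong[OF refl])
  fix l assume "l \<in> {..<N}"
  then have "Suc l * k \<le> N * k" by (intro mult_right_mono) auto
  then have "k \<le> N * k - l * k" by simp
  then show "f (take k (drop (l * k) (take (N * k) (drop j w)))) = f (take k (drop (j + l * k) w))"
    by (simp add: drop_take min_def add.commute)
qed

lemma markov_exp:
  assumes T: "bounded (range T)" and X: "\<And>u. u \<in> set_pmf q \<Longrightarrow> u \<in> X \<Longrightarrow> s \<le> T u"
  shows "measure_pmf.prob q X \<le> exp (- s) * mean q (\<lambda>u. exp (T u))"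
proof -
  have "mean q (indicator X) \<le> mean q (\<lambda>u. exp (- s) * exp (T u))"
  proof (intro mean_mono bounded_range_intros T)
    fix u assume u: "u \<in> set_pmf q"
    show "indicator X u \<le> exp (- s) * exp (T u)"
      using X[OF u] by (auto simp: exp_add[symmetric] split: split_indicator)
  qed
  then show ?thesis by simp
qed

context quasi_bernoulli
begin

lemma exp_block_sum:
  assumes f: "bounded (range f)"
  shows "mean (p (N * k)) (\<lambda>w. exp (block_sum k f N w)) \<le> (exp C * mean (p k) (\<lambda>x. exp (f x))) ^ N"
proof (induction N)
  case 0
  then show ?case by (simp add: block_sum_def)
next
  case (Suc N)
  let ?M = "exp C * mean (p k) (\<lambda>x. exp (f x))"
  have "mean (p (Suc N * k)) (\<lambda>w. exp (block_sum k f (Suc N) w))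
      = mean (p (k + N * k)) (\<lambda>w. exp (f (take k w)) * exp (block_sum k f N (drop k w)))"
    by (simp add: block_sum_Suc exp_add)
  also have "\<dots> \<le> exp C * (mean (p k) (\<lambda>x. exp (f x)) * mean (p (N * k)) (\<lambda>w. exp (block_sum k f N w)))"
    by (rule mean_p_split_le) (auto intro: bounded_range_exp bounded_block_sum f)
  also have "\<dots> = ?M * mean (p (N * k)) (\<lambda>w. exp (block_sum k f N w))" by simp
  also have "\<dots> \<le> ?M * ?M ^ N"
    using mean_exp_pos[OF f, of "p k"] by (intro mult_left_mono Suc) simp
  finally show ?case by simp
qed

text \<open>
  By stationarity the blocks may start at any residue \<open>j\<close> modulo \<open>k\<close>.
\<close>

lemma exp_offset_block_sum:
  assumes f: "bounded (range f)" and n: "N * k + j \<le> n"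
  shows "mean (p n) (\<lambda>w. exp (\<Sum>l<N. f (take k (drop (j + l * k) w)))) \<le> (exp C * mean (p k) (\<lambda>x. exp (f x))) ^ N"
proof -
  have "mean (p n) (\<lambda>w. exp (\<Sum>l<N. f (take k (drop (j + l * k) w))))
      = mean (p n) (\<lambda>w. exp (block_sum k f N (take (N * k) (drop j w))))"
    by (rule integral_cong_AE) (use n length_p[OF _ P] in \<open>auto simp: AE_measure_pmf_iff block_sum_drop_take\<close>)
  also have "\<dots> = mean (map_pmf (\<lambda>w. take (N * k) (drop j w)) (p n)) (\<lambda>w. exp (block_sum k f N w))" by simp
  also have "\<dots> = mean (p (N * k)) (\<lambda>w. exp (block_sum k f N w))"
    using n by (simp add: map_pmf_window[OF P])
  finally show ?thesis using exp_block_sum[OF f, of N k] by simp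
qed

text \<open>
  Windows are grouped by the residue of their starting site modulo \<open>k\<close>. Leaving out the last complete
  block ensures that no window that is counted wraps around; at most \<open>2 k\<close> windows remain.
\<close>

lemma cyclic_sum_le:
  fixes f :: "'a list \<Rightarrow> real"
  assumes B: "\<And>x. \<bar>f x\<bar> \<le> B" and k: "1 \<le> k" "k \<le> length u" and N: "N = length u div k - 1"
  shows "(\<Sum>i<length u. f (cyclic_window u i k)) \<le> (\<Sum>j<k. \<Sum>l<N. f (take k (drop (j + l * k) u))) + 2 * real k * B"
proof -
  let ?n = "length u"
  have dv: "1 \<le> ?n div k" using k by (simp add: div_greater_zero_iff Suc_le_eq)
  have n: "?n = N * k + k + ?n mod k"
  proof -
    have "?n = (?n div k) * k + ?n mod k" by simp
    also have "?n div k = N + 1" using dv N by simp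
    finally show ?thesis by simp
  qed
  have md: "?n mod k \<le> k" using k by (simp add: less_imp_le)
  have "(\<Sum>i<?n. f (cyclic_window u i k)) = (\<Sum>i<N * k. f (cyclic_window u i k)) + (\<Sum>i=N * k..<?n. f (cyclic_window u i k))"
    using n by (metis add.assoc le_add1 lessThan_atLeast0 sum.atLeastLessThan_concat zero_le)
  also have "(\<Sum>i<N * k. f (cyclic_window u i k)) = (\<Sum>i<N * k. f (take k (drop i u)))"
    by (rule sum.cong) (use n in \<open>auto simp: cyclic_window_inner\<close>)
  also have "\<dots> = (\<Sum>l<N. \<Sum>j<k. f (take k (drop (j + l * k) u)))"
    unfolding sum_blocks by (simp add: add.commute)
  also have "\<dots> = (\<Sum>j<k. \<Sum>l<N. f (take k (drop (j + l * k) u)))" by (rule sum.swap)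
  also have "(\<Sum>i=N * k..<?n. f (cyclic_window u i k)) \<le> (\<Sum>i=N * k..<?n. B)"
    by (rule sum_mono) (use B in \<open>auto simp: abs_le_iff\<close>)
  also have "\<dots> = real (?n - N * k) * B" by simp
  also have "\<dots> \<le> 2 * real k * B"
  proof (rule mult_right_mono)
    have "?n - N * k \<le> 2 * k" using n md by linarith
    then show "real (?n - N * k) \<le> 2 * real k" by linarith
    show "0 \<le> B" using B[of "[]"] by linarith
  qed
  finally show ?thesis by simp
qed

text \<open>
  By Jensen's inequality, the exponential of the average over the \<open>k\<close> residues is at most the average of
  the \<open>k\<close> exponentials, each of which involves disjoint blocks only. Markov's inequality then bounds the
  probability.
\<close>

lemma prob_functional_ge:
  fixes f :: "'a list \<Rightarrow> real"
  assumes B: "\<And>x. \<bar>f x\<bar> \<le> B" and f1: "mean (p k) (\<lambda>x. exp (f x)) = 1" and k: "1 \<le> k" "k \<le> n"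
  shows "measure_pmf.prob (p n) {u. s \<le> mean (block_law k (cyclic_law A u)) f} \<le> exp (2 * B) * exp (- (real n / real k) * (s - C))"
proof -
  define N where "N = n div k - 1"
  have f: "bounded (range f)" using B by (rule bounded_rangeI)
  define S where "S j w = (\<Sum>l<N. f (take k (drop (j + l * k) w)))" for j w
  define T where "T w = (\<Sum>j<k. (1 / real k) * S j w)" for w
  have bS: "bounded (range (S j))" for j
    unfolding S_def[abs_def] by (intro bounded_range_sum bounded_range_comp[OF f])
  have bT: "bounded (range T)"
    unfolding T_def[abs_def] by (intro bounded_range_sum bounded_range_intros bS)
  have dv: "1 \<le> n div k" using k by (simp add: div_greater_zero_iff Suc_le_eq)
  have Nk: "N * k + j \<le> n" if "j < k" for j
  proof -
    have "n div k = Suc N" using dv by (simp add: N_def)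
    then have "N * k + k = (n div k) * k" by simp
    also have "\<dots> \<le> n" by simp
    finally show ?thesis using that by simp
  qed
  have "measure_pmf.prob (p n) {u. s \<le> mean (block_law k (cyclic_law A u)) f} \<le> exp (- (real n / real k * s - 2 * B)) * mean (p n) (\<lambda>u. exp (T u))"
  proof (rule markov_exp[OF bT])
    fix u assume u: "u \<in> set_pmf (p n)" "u \<in> {u. s \<le> mean (block_law k (cyclic_law A u)) f}"
    then have len: "length u = n" "set u \<subseteq> A" using set_pmf_block_law[OF P, of n] by auto
    then have ne: "u \<noteq> []" using k by auto
    have "real n * s \<le> (\<Sum>i<n. f (cyclic_window u i k))"
      using u(2) k by (simp add: mean_block_law_cyclic_law[OF ne len(2)] len field_simps)
    also have "\<dots> \<le> (\<Sum>j<k. S j u) + 2 * real k * B"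
      using cyclic_sum_le[OF B k(1), of u N] k by (simp add: len S_def N_def)
    also have "(\<Sum>j<k. S j u) = real k * T u" using k by (simp add: T_def sum_distrib_left)
    finally show "real n / real k * s - 2 * B \<le> T u" using k by (simp add: field_simps)
  qed
  also have "mean (p n) (\<lambda>u. exp (T u)) \<le> mean (p n) (\<lambda>u. \<Sum>j<k. (1 / real k) * exp (S j u))"
  proof (intro mean_mono bounded_range_intros bT bounded_range_sum bS)
    fix u
    have "0 \<in> {..<k}" using k by simp
    then have ne: "{..<k} \<noteq> {}" by blast
    have "exp (\<Sum>j\<in>{..<k}. (1 / real k) *\<^sub>R S j u) \<le> (\<Sum>j\<in>{..<k}. (1 / real k) * exp (S j u))"
      by (rule convex_on_sum[OF _ ne exp_convex]) (use k in auto)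
    then show "exp (T u) \<le> (\<Sum>j<k. (1 / real k) * exp (S j u))" by (simp add: T_def)
  qed
  also have "\<dots> = (\<Sum>j<k. (1 / real k) * mean (p n) (\<lambda>u. exp (S j u)))"
    by (subst mean_sum_bounded) (intro bounded_range_intros bS, simp)
  also have "\<dots> \<le> (\<Sum>j<k. (1 / real k) * exp C ^ N)"
  proof (intro sum_mono mult_left_mono)
    fix j assume "j \<in> {..<k}"
    then show "mean (p n) (\<lambda>u. exp (S j u)) \<le> exp C ^ N"
      using exp_offset_block_sum[OF f Nk, of j] f1 by (simp add: S_def)
  qed simp
  also have "\<dots> = exp (real N * C)" using k by (simp add: exp_of_nat_mult)
  also have "\<dots> \<le> exp (real n / real k * C)"
  proof -
    have "real N \<le> real (n div k)" by (simp add: N_def)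
    also have "\<dots> \<le> real n / real k" by (rule of_nat_div_le_of_nat)
    finally have "real N * C \<le> real n / real k * C" using C by (intro mult_right_mono) auto
    then show ?thesis by (simp only: exp_le_cancel_iff)
  qed
  finally have "measure_pmf.prob (p n) {u. s \<le> mean (block_law k (cyclic_law A u)) f}
      \<le> exp (- (real n / real k * s - 2 * B)) * exp (real n / real k * C)" by simp
  also have "\<dots> = exp (2 * B) * exp (- (real n / real k) * (s - C))"
    unfolding exp_add[symmetric] by (simp add: algebra_simps diff_divide_distrib)
  finally show ?thesis .
qed

end

text \<open>
  Exponential decay at rate \<open>c\<close> up to a constant factor; unlike a bound on the upper limit of logarithms
  this is stable under finite sums without further argument.
\<close>

definition exp_decay :: "(nat \<Rightarrow> real) \<Rightarrow> real \<Rightarrow> bool" where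
  "exp_decay a c \<longleftrightarrow> (\<exists>K. eventually (\<lambda>n. a n \<le> K * exp (- c * real n)) sequentially)"

lemma exp_decay_add:
  assumes "exp_decay a c" "exp_decay b c" shows "exp_decay (\<lambda>n. a n + b n) c"
proof -
  obtain K K' where "eventually (\<lambda>n. a n \<le> K * exp (- c * real n)) sequentially"
    "eventually (\<lambda>n. b n \<le> K' * exp (- c * real n)) sequentially"
    using assms unfolding exp_decay_def by auto
  then have "eventually (\<lambda>n. a n + b n \<le> (K + K') * exp (- c * real n)) sequentially"
    by eventually_elim (simp add: distrib_right)
  then show ?thesis unfolding exp_decay_def by blast
qed

lemma exp_decay_mono:
  assumes "exp_decay b c" "eventually (\<lambda>n. a n \<le> b n) sequentially" shows "exp_decay a c"
proof -
  obtain K where "eventually (\<lambda>n. b n \<le> K * exp (- c * real n)) sequentially"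
    using assms unfolding exp_decay_def by auto
  with assms(2) have "eventually (\<lambda>n. a n \<le> K * exp (- c * real n)) sequentially"
    by eventually_elim simp
  then show ?thesis unfolding exp_decay_def by blast
qed

lemma exp_decay_sum:
  assumes "finite I" "\<And>i. i \<in> I \<Longrightarrow> exp_decay (a i) c" shows "exp_decay (\<lambda>n. \<Sum>i\<in>I. a i n) c"
  using assms
proof (induction I)
  case empty
  show ?case unfolding exp_decay_def by (rule exI[of _ 0]) simp
qed (simp add: exp_decay_add)

lemma exp_decay_limsup:
  assumes "exp_decay a c" and a: "\<And>n. 0 \<le> a n"
  shows "limsup (\<lambda>n. ereal_ln (a n) / ereal (real n)) \<le> ereal (- c)"
proof -
  obtain K0 where K0: "eventually (\<lambda>n. a n \<le> K0 * exp (- c * real n)) sequentially"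
    using assms unfolding exp_decay_def by auto
  define K where "K = max K0 1"
  have "eventually (\<lambda>n. ereal_ln (a n) / ereal (real n) \<le> ereal (ln K / real n - c)) sequentially"
    using K0 eventually_ge_at_top[of 1]
  proof eventually_elim
    case (elim n)
    have K: "0 < K" by (simp add: K_def)
    have le: "a n \<le> K * exp (- c * real n)"
      using elim(1) by (rule order_trans) (simp add: K_def mult_right_mono)
    show ?case
    proof (cases "a n = 0")
      case True
      then show ?thesis using elim(2) by (simp add: ereal_ln_def)
    next
      case False
      then have "ln (a n) \<le> ln (K * exp (- c * real n))" using a[of n] le K by (subst ln_le_cancel_iff) auto
      also have "\<dots> = ln K - c * real n" using K by (simp add: ln_mult)
      finally have "ln (a n) / real n \<le> ln K / real n - c" using elim(2) by (simp add: field_simps)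
      then show ?thesis using False elim(2) by (simp add: ereal_ln_def)
    qed
  qed
  then have "limsup (\<lambda>n. ereal_ln (a n) / ereal (real n)) \<le> limsup (\<lambda>n. ereal (ln K / real n - c))"
    by (rule Limsup_mono)
  also have "\<dots> = ereal (0 - c)"
  proof (rule lim_imp_Limsup)
    have "(\<lambda>n. ln K / real n - c) \<longlonglongrightarrow> 0 - c"
      by (intro tendsto_diff tendsto_const tendsto_divide_0[OF tendsto_const] filterlim_real_sequentially filterlim_at_top_imp_at_infinity)
    then show "(\<lambda>n. ereal (ln K / real n - c)) \<longlonglongrightarrow> ereal (0 - c)" by simp
  qed simp
  finally show ?thesis by simp
qed

context quasi_bernoulli
begin

text \<open>
  Choose \<open>k\<close> and a normalised \<open>f\<close> that witness \<open>c < rate Q\<close>. The neighbourhood consists of the laws under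
  which the mean of \<open>f\<close> over a \<open>k\<close>-block exceeds \<open>c k + C\<close>.
\<close>

lemma local_upper_bound:
  assumes Q: "Q \<in> inv_laws A" and c: "ereal c < rate Q"
  obtains G where "openin (weak_topology A) G" "Q \<in> G"
    "exp_decay (\<lambda>n. measure_pmf.prob (p n) {u. cyclic_law A u \<in> G}) c"
proof -
  obtain k where k: "1 \<le> k" "ereal c < (ent k Q - ereal C) / ereal (real k)"
    using c by (auto simp: rate_def less_SUP_iff)
  then have "ereal (c * real k + C) < ent k Q"
    using kl_nonneg[of "block_law k Q" "p k"] by (cases "ent k Q") (auto simp: field_simps)
  then obtain f where f: "bounded (range f)" "mean (p k) (\<lambda>x. exp (f x)) = 1" "c * real k + C < mean (block_law k Q) f"
    by (rule kl_normalized)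
  obtain B where B: "\<And>x. \<bar>f x\<bar> \<le> B" using f(1) unfolding bounded_range_iff by auto
  define s where "s = c * real k + C"
  define G where "G = {R \<in> inv_laws A. mean (block_law k R) f \<in> {s<..}}"
  have "openin (weak_topology A) G" unfolding G_def by (rule openin_weak_topology_block[OF f(1)]) simp
  moreover have "Q \<in> G" using f(3) Q by (simp add: G_def s_def)
  moreover have "exp_decay (\<lambda>n. measure_pmf.prob (p n) {u. cyclic_law A u \<in> G}) c"
    unfolding exp_decay_def
  proof (intro exI[of _ "exp (2 * B)"], use eventually_ge_at_top[of k] in eventually_elim)
    case (elim n)
    have "measure_pmf.prob (p n) {u. cyclic_law A u \<in> G} \<le> measure_pmf.prob (p n) {u. s \<le> mean (block_law k (cyclic_law A u)) f}"
      by (rule measure_pmf.finite_measure_mono) (auto simp: G_def)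
    also have "\<dots> \<le> exp (2 * B) * exp (- (real n / real k) * (s - C))"
      by (rule prob_functional_ge[OF B f(2) k(1) elim])
    also have "- (real n / real k) * (s - C) = - c * real n" using k(1) by (simp add: s_def)
    finally show ?case .
  qed
  ultimately show ?thesis by (rule that)
qed

text \<open>
  The \<open>m\<close>-th condition fails with probability at most \<open>exp (- L n) / 2\<^sup>m\<^sup>+\<^sup>1\<close>: the letters outside
  \<open>F m\<close> are so improbable that a reward \<open>t m\<close> for each of them leaves the exponential moment of a single
  letter bounded by 2.
  The conditions can then be summed over all \<open>m\<close>.
\<close>

lemma exponential_tightness:
  assumes L: "0 \<le> L"
  obtains F where "\<And>m. finite (F m)"
    "\<And>n. 1 \<le> n \<Longrightarrow> measure_pmf.prob (p n) {u. cyclic_law A u \<notin> tight_laws A F} \<le> exp (- L * real n)"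
proof -
  \<comment> \<open>The Markov exponent \<open>n t m / (m + 1)\<close> must pay for \<open>L n\<close>, for the moment bound \<open>(2 exp C)\<^sup>n\<close> and
    for a summable factor in \<open>m\<close>.\<close>
  define t where "t m = real (Suc m) * (L + real (Suc m) + C + ln 2)" for m
  have tp: "0 < t m" for m unfolding t_def using L C by (intro mult_pos_pos add_nonneg_pos) auto
  have "\<exists>F. finite F \<and> measure_pmf.prob (p 1) {u. hd u \<notin> F} \<le> exp (- t m)" for m
  proof -
    have "(\<lambda>j. measure_pmf.prob (p 1) {u. hd u \<notin> finite_exhaustion j}) \<longlonglongrightarrow> measure_pmf.prob (p 1) (\<Inter>j. {u. hd u \<notin> finite_exhaustion j})"
      by (rule measure_pmf.finite_Lim_measure_decseq) (auto simp: decseq_def finite_exhaustion_def)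
    moreover have "(\<Inter>j. {u :: 'a list. hd u \<notin> finite_exhaustion j}) = {}"
      by (auto simp: finite_exhaustion_def)
    ultimately have "(\<lambda>j. measure_pmf.prob (p 1) {u. hd u \<notin> finite_exhaustion j}) \<longlonglongrightarrow> 0" by simp
    from order_tendstoD(2)[OF this, of "exp (- t m)"]
    obtain j where "measure_pmf.prob (p 1) {u. hd u \<notin> finite_exhaustion j} < exp (- t m)"
      by (auto simp: eventually_sequentially)
    then show ?thesis using finite_finite_exhaustion[of j] by (intro exI[of _ "finite_exhaustion j"]) auto
  qed
  then obtain F where F: "\<And>m. finite (F m)" "\<And>m. measure_pmf.prob (p 1) {u. hd u \<notin> F m} \<le> exp (- t m)" by metis
  have one: "measure_pmf.prob (p n) {u. 1 / real (Suc m) < measure_pmf.prob (block_law 1 (cyclic_law A u)) {v. hd v \<notin> F m}}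
      \<le> exp (- L * real n) * (1 / 2) ^ Suc m" if n: "1 \<le> n" for n m
  proof -
    define f where "f v = t m * indicator {v. hd v \<notin> F m} v" for v :: "'a list"
    have f: "bounded (range f)" unfolding f_def[abs_def] by (intro bounded_range_intros)
    have M: "mean (p 1) (\<lambda>v. exp (f v)) \<le> 2"
    proof -
      have "(\<lambda>v. exp (f v)) = (\<lambda>v. 1 + (exp (t m) - 1) * indicator {v. hd v \<notin> F m} v)"
        by (auto simp: f_def split: split_indicator)
      then have "mean (p 1) (\<lambda>v. exp (f v)) = 1 + (exp (t m) - 1) * measure_pmf.prob (p 1) {v. hd v \<notin> F m}"
        using integrable_pmf_bounded[of "indicator {v. hd v \<notin> F m}" "p 1"] by simp
      also have "\<dots> \<le> 1 + (exp (t m) - 1) * exp (- t m)"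
        using F(2) tp[of m] by (intro add_left_mono mult_left_mono) auto
      also have "\<dots> \<le> 2" by (simp add: left_diff_distrib exp_minus)
      finally show ?thesis .
    qed
    have "measure_pmf.prob (p n) {u. 1 / real (Suc m) < measure_pmf.prob (block_law 1 (cyclic_law A u)) {v. hd v \<notin> F m}}
       \<le> exp (- (real n * t m / real (Suc m))) * mean (p n) (\<lambda>u. exp (block_sum 1 f n u))"
    proof (rule markov_exp[OF bounded_block_sum[OF f]])
      fix u assume u: "u \<in> set_pmf (p n)" "u \<in> {u. 1 / real (Suc m) < measure_pmf.prob (block_law 1 (cyclic_law A u)) {v. hd v \<notin> F m}}"
      then have len: "length u = n" "set u \<subseteq> A" using set_pmf_block_law[OF P, of n] by auto
      then have ne: "u \<noteq> []" using n by auto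
      have "1 / real (Suc m) \<le> mean (block_law 1 (cyclic_law A u)) (indicator {v. hd v \<notin> F m})" using u(2) by simp
      also have "\<dots> = (\<Sum>i<n. indicator {v. hd v \<notin> F m} (cyclic_window u i 1)) / real n"
        unfolding mean_block_law_cyclic_law[OF ne len(2)] len ..
      also have "(\<Sum>i<n. indicator {v. hd v \<notin> F m} (cyclic_window u i 1) :: real) = (\<Sum>i<n. indicator {v. hd v \<notin> F m} (take 1 (drop i u)))"
        by (rule sum.cong) (use len in \<open>auto simp: cyclic_window_inner simp del: One_nat_def\<close>)
      finally have "t m * (1 / real (Suc m)) \<le> t m * ((\<Sum>i<n. indicator {v. hd v \<notin> F m} (take 1 (drop i u))) / real n)"
        using tp[of m] by (intro mult_left_mono) auto
      then have "real n * (t m * (1 / real (Suc m))) \<le> t m * (\<Sum>i<n. indicator {v. hd v \<notin> F m} (take 1 (drop i u)))"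
        using n by (simp add: field_simps)
      also have "\<dots> = block_sum 1 f n u" by (simp add: block_sum_def f_def sum_distrib_left)
      finally show "real n * t m / real (Suc m) \<le> block_sum 1 f n u" by simp
    qed
    also have "mean (p n) (\<lambda>u. exp (block_sum 1 f n u)) \<le> (exp C * 2) ^ n"
    proof -
      have "mean (p n) (\<lambda>u. exp (block_sum 1 f n u)) \<le> (exp C * mean (p 1) (\<lambda>x. exp (f x))) ^ n"
        using exp_block_sum[OF f, of n 1] by simp
      also have "\<dots> \<le> (exp C * 2) ^ n"
        using M mean_exp_pos[OF f, of "p 1"] by (intro power_mono mult_left_mono) auto
      finally show ?thesis .
    qed
    also have "(exp C * 2) ^ n = exp (real n * (C + ln 2))"
      by (simp add: exp_of_nat_mult exp_add)
    also have "exp (- (real n * t m / real (Suc m))) * exp (real n * (C + ln 2)) = exp (- L * real n) * exp (- (real n * real (Suc m)))"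
    proof -
      have "real n * t m / real (Suc m) = real n * (L + real (Suc m) + C + ln 2)" by (simp add: t_def)
      then show ?thesis unfolding exp_add[symmetric] by (simp add: algebra_simps)
    qed
    also have "\<dots> \<le> exp (- L * real n) * (1 / 2) ^ Suc m"
    proof (rule mult_left_mono)
      have "(2 :: real) \<le> exp 1" using exp_ge_add_one_self[of 1] by simp
      then have h: "exp (- 1) \<le> (1 / 2 :: real)" by (simp add: exp_minus field_simps)
      have "exp (- (real n * real (Suc m))) \<le> exp (real (Suc m) * (- 1))"
        using n by (simp del: of_nat_Suc)
      also have "\<dots> = exp (- 1) ^ Suc m" by (rule exp_of_nat_mult)
      also have "\<dots> \<le> (1 / 2) ^ Suc m" by (rule power_mono[OF h]) simp
      finally show "exp (- (real n * real (Suc m))) \<le> (1 / 2) ^ Suc m" .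
    qed simp
    finally show ?thesis by simp
  qed
  have "measure_pmf.prob (p n) {u. cyclic_law A u \<notin> tight_laws A F} \<le> exp (- L * real n)" if n: "1 \<le> n" for n
  proof -
    let ?X = "\<lambda>m. {u. 1 / real (Suc m) < measure_pmf.prob (block_law 1 (cyclic_law A u)) {v. hd v \<notin> F m}}"
    have sm: "(\<lambda>m. exp (- L * real n) * (1 / 2) ^ Suc m) sums (exp (- L * real n) * 1)"
      by (rule sums_mult[OF power_half_series])
    have s: "summable (\<lambda>m. measure_pmf.prob (p n) (?X m))"
      by (rule summable_comparison_test[OF _ sums_summable[OF sm]]) (use one[OF n] in auto)
    have "measure_pmf.prob (p n) {u. cyclic_law A u \<notin> tight_laws A F} \<le> measure_pmf.prob (p n) (\<Union>m. ?X m)"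
    proof (rule measure_pmf.finite_measure_mono_AE)
      show "AE u in p n. u \<in> {u. cyclic_law A u \<notin> tight_laws A F} \<longrightarrow> u \<in> (\<Union>m. ?X m)"
        unfolding AE_measure_pmf_iff
      proof (intro ballI impI)
        fix u assume u: "u \<in> set_pmf (p n)" "u \<in> {u. cyclic_law A u \<notin> tight_laws A F}"
        then have "length u = n" "set u \<subseteq> A" using set_pmf_block_law[OF P, of n] by auto
        then have "cyclic_law A u \<in> inv_laws A" using n by (intro cyclic_law_in_inv_laws) auto
        then show "u \<in> (\<Union>m. ?X m)" using u(2) by (auto simp: tight_laws_def not_le)
      qed
    qed simp
    also have "\<dots> \<le> (\<Sum>m. measure_pmf.prob (p n) (?X m))"
      by (rule measure_pmf.finite_measure_subadditive_countably[OF _ s]) simp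
    also have "\<dots> \<le> (\<Sum>m. exp (- L * real n) * (1 / 2) ^ Suc m)"
      by (rule suminf_le[OF one[OF n] s sums_summable[OF sm]])
    also have "\<dots> = exp (- L * real n)" using sums_unique[OF sm] by simp
    finally show ?thesis .
  qed
  then show ?thesis using F(1) by (rule that[rotated])
qed

text \<open>
  The compact part of the closed set is covered by finitely many neighbourhoods from
  \<open>local_upper_bound\<close>; the rest is negligible by exponential tightness.
\<close>

theorem upper_bound:
  assumes K: "closedin (weak_topology A) K"
  shows "limsup (\<lambda>n. ereal_ln (measure_pmf.prob (p n) {u. cyclic_law A u \<in> K}) / ereal (real n)) \<le> - (INF Q\<in>K. rate Q)"
    (is "?L \<le> - ?I")
proof -
  have Kin: "Q \<in> inv_laws A" if "Q \<in> K" for Q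
    using closedin_subset[OF K] that by (auto simp: topspace_weak_topology)
  have I0: "0 \<le> ?I" by (rule INF_greatest) (rule rate_nonneg[OF Kin])
  have key: "?L \<le> ereal (- c)" if c: "ereal c < ?I" "0 \<le> c" for c
  proof -
    obtain F where F: "\<And>m. finite (F m)"
      and Fp: "\<And>n. 1 \<le> n \<Longrightarrow> measure_pmf.prob (p n) {u. cyclic_law A u \<notin> tight_laws A F} \<le> exp (- c * real n)"
      using exponential_tightness[OF c(2)] by metis
    have comp: "compactin (weak_topology A) (K \<inter> tight_laws A F)"
      by (rule closed_Int_compactin[OF K compactin_tight_laws[OF F]])
    have "\<forall>Q\<in>K. \<exists>G. openin (weak_topology A) G \<and> Q \<in> G \<and> exp_decay (\<lambda>n. measure_pmf.prob (p n) {u. cyclic_law A u \<in> G}) c"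
    proof
      fix Q assume Q: "Q \<in> K"
      then have "ereal c < rate Q" using c(1) by (meson INF_lower less_le_trans)
      from local_upper_bound[OF Kin[OF Q] this]
      show "\<exists>G. openin (weak_topology A) G \<and> Q \<in> G \<and> exp_decay (\<lambda>n. measure_pmf.prob (p n) {u. cyclic_law A u \<in> G}) c"
        by blast
    qed
    then obtain G where G: "\<And>Q. Q \<in> K \<Longrightarrow> openin (weak_topology A) (G Q)" "\<And>Q. Q \<in> K \<Longrightarrow> Q \<in> G Q"
      "\<And>Q. Q \<in> K \<Longrightarrow> exp_decay (\<lambda>n. measure_pmf.prob (p n) {u. cyclic_law A u \<in> G Q}) c" by metis
    obtain \<F> where \<F>: "finite \<F>" "\<F> \<subseteq> G ` K" "K \<inter> tight_laws A F \<subseteq> \<Union> \<F>"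
      using compactinD[OF comp, of "G ` K"] G by blast
    have "exp_decay (\<lambda>n. (\<Sum>V\<in>\<F>. measure_pmf.prob (p n) {u. cyclic_law A u \<in> V}) + measure_pmf.prob (p n) {u. cyclic_law A u \<notin> tight_laws A F}) c"
    proof (intro exp_decay_add exp_decay_sum \<F>(1))
      show "exp_decay (\<lambda>n. measure_pmf.prob (p n) {u. cyclic_law A u \<in> V}) c" if "V \<in> \<F>" for V
        using that \<F>(2) G(3) by auto
      show "exp_decay (\<lambda>n. measure_pmf.prob (p n) {u. cyclic_law A u \<notin> tight_laws A F}) c"
        unfolding exp_decay_def using Fp by (intro exI[of _ 1] eventually_sequentiallyI[of 1]) simp
    qed
    then have "exp_decay (\<lambda>n. measure_pmf.prob (p n) {u. cyclic_law A u \<in> K}) c"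
    proof (rule exp_decay_mono, intro always_eventually allI)
      fix n
      have "measure_pmf.prob (p n) {u. cyclic_law A u \<in> K}
          \<le> measure_pmf.prob (p n) ((\<Union>V\<in>\<F>. {u. cyclic_law A u \<in> V}) \<union> {u. cyclic_law A u \<notin> tight_laws A F})"
        by (rule measure_pmf.finite_measure_mono) (use \<F>(3) in auto)
      also have "\<dots> \<le> measure_pmf.prob (p n) (\<Union>V\<in>\<F>. {u. cyclic_law A u \<in> V}) + measure_pmf.prob (p n) {u. cyclic_law A u \<notin> tight_laws A F}"
        by (rule measure_Un_le) auto
      also have "measure_pmf.prob (p n) (\<Union>V\<in>\<F>. {u. cyclic_law A u \<in> V}) \<le> (\<Sum>V\<in>\<F>. measure_pmf.prob (p n) {u. cyclic_law A u \<in> V})"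
        by (rule measure_UNION_le[OF \<F>(1)]) auto
      finally show "measure_pmf.prob (p n) {u. cyclic_law A u \<in> K}
          \<le> (\<Sum>V\<in>\<F>. measure_pmf.prob (p n) {u. cyclic_law A u \<in> V}) + measure_pmf.prob (p n) {u. cyclic_law A u \<notin> tight_laws A F}"
        by simp
    qed
    then show ?thesis by (rule exp_decay_limsup) simp
  qed
  show ?thesis
  proof (rule ccontr)
    assume "\<not> ?thesis"
    then have "- ?I < ?L" by simp
    then obtain z where z: "- ?I < ereal z" "ereal z < ?L" using ereal_dense2 by blast
    have L0: "?L \<le> 0"
    proof (rule Limsup_bounded, intro always_eventually allI)
      fix n :: nat
      have neg: "ln (measure_pmf.prob (p n) {u. cyclic_law A u \<in> K}) \<le> 0"
          if "measure_pmf.prob (p n) {u. cyclic_law A u \<in> K} \<noteq> 0"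
          using that by (subst ln_le_zero_iff) (auto simp: zero_less_measure_iff)
      show "ereal_ln (measure_pmf.prob (p n) {u. cyclic_law A u \<in> K}) / ereal (real n) \<le> 0"
      proof (cases n)
        case (Suc m)
        then show ?thesis using neg by (auto simp: ereal_ln_def zero_ereal_def divide_le_0_iff)
      next
        case 0
        then show ?thesis using neg by (auto simp: ereal_ln_def divide_ereal_def zero_ereal_def[symmetric] not_less)
      qed
    qed
    have "ereal (- z) < ?I" using z(1) by (simp add: ereal_uminus_less_reorder)
    moreover have "ereal z < 0" using z(2) L0 by (rule less_le_trans)
    then have "0 \<le> - z" by (simp add: zero_ereal_def)
    ultimately have "?L \<le> ereal (- (- z))" by (rule key)
    then show False using z(2) by simp
  qed
qed

end

section \<open>The large deviation lower bound\<close>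

lemma open_fun_finite_nbhd:
  fixes V :: "('b \<Rightarrow> real) set"
  assumes "open V" "x \<in> V"
  obtains S d where "finite S" "0 < d" "\<And>y. (\<And>v. v \<in> S \<Longrightarrow> \<bar>y v - x v\<bar> < d) \<Longrightarrow> y \<in> V"
proof -
  have "openin (product_topology (\<lambda>_. euclidean) UNIV) V"
    using assms(1) by (simp add: euclidean_product_topology)
  then have "\<exists>U. finite {i \<in> UNIV. U i \<noteq> topspace (euclidean :: real topology)} \<and>
      (\<forall>i \<in> UNIV. openin euclidean (U i)) \<and> x \<in> Pi\<^sub>E UNIV U \<and> Pi\<^sub>E UNIV U \<subseteq> V"
    unfolding openin_product_topology_alt using assms(2) by blast
  then obtain U where U: "finite {i. U i \<noteq> UNIV}" "\<And>i. open (U i)" "\<And>i. x i \<in> U i" "Pi\<^sub>E UNIV U \<subseteq> V"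
    by auto
  have "\<exists>d>0. \<forall>t. \<bar>t - x i\<bar> < d \<longrightarrow> t \<in> U i" for i
    using U(2)[of i] U(3)[of i] unfolding open_dist dist_real_def by blast
  then obtain e where e: "\<And>i. 0 < e i" "\<And>i t. \<bar>t - x i\<bar> < e i \<Longrightarrow> t \<in> U i" by metis
  let ?S = "{i. U i \<noteq> UNIV}"
  define d where "d = Min (insert 1 (e ` ?S))"
  show ?thesis
  proof (rule that)
    show "finite ?S" by fact
    show "0 < d" unfolding d_def using U(1) e(1) by (subst Min_gr_iff) auto
    fix y assume y: "\<And>v. v \<in> ?S \<Longrightarrow> \<bar>y v - x v\<bar> < d"
    have "y i \<in> U i" for i
    proof (cases "i \<in> ?S")
      case True
      then have "d \<le> e i" unfolding d_def using U(1) by (intro Min_le) auto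
      then show ?thesis using y[OF True] by (intro e(2)) simp
    qed auto
    then show "y \<in> V" using U(4) by auto
  qed
qed

primrec concat_power :: "'a list pmf \<Rightarrow> 'a list pmf \<Rightarrow> nat \<Rightarrow> 'a list pmf" where
  "concat_power q z 0 = z"
| "concat_power q z (Suc N) = conc q (concat_power q z N)"

lemma set_concat_power:
  assumes q: "\<And>u. u \<in> set_pmf q \<Longrightarrow> length u = k \<and> set u \<subseteq> A" and z: "\<And>u. u \<in> set_pmf z \<Longrightarrow> length u = r \<and> set u \<subseteq> A"
  shows "u \<in> set_pmf (concat_power q z N) \<Longrightarrow> length u = N * k + r \<and> set u \<subseteq> A"
  using z by (induction N arbitrary: u) (fastforce simp: set_pmf_conc dest: q)+

text \<open>
  Independence and centring make the mixed terms vanish.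
\<close>

lemma second_moment_block_sum:
  assumes q: "\<And>u. u \<in> set_pmf q \<Longrightarrow> length u = k" and B: "\<And>u. \<bar>g u\<bar> \<le> B" and 0: "mean q g = 0"
  shows "mean (concat_power q z N) (\<lambda>w. (block_sum k g N w)\<^sup>2) \<le> real N * B\<^sup>2"
proof (induction N)
  case 0
  then show ?case by (simp add: block_sum_def)
next
  case (Suc N)
  let ?z = "concat_power q z N"
  have g: "bounded (range g)" using B by (rule bounded_rangeI)
  have S: "bounded (range (block_sum k g N))" by (rule bounded_block_sum[OF g])
  have g2: "bounded (range (\<lambda>u. (g u)\<^sup>2))" and S2: "bounded (range (\<lambda>w. (block_sum k g N w)\<^sup>2))"
    unfolding power2_eq_square by (intro bounded_range_intros g S)+
  have comp: "bounded (range (\<lambda>w. F (take k w) * G (drop k w)))" if "bounded (range F)" "bounded (range G)" for F G :: "'a list \<Rightarrow> real"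
    by (intro bounded_range_intros bounded_range_comp[OF that(1)] bounded_range_comp[OF that(2)])
  have "(\<lambda>w. (block_sum k g (Suc N) w)\<^sup>2) = (\<lambda>w. (g (take k w))\<^sup>2 * 1 + 2 * (g (take k w) * block_sum k g N (drop k w))
      + 1 * (block_sum k g N (drop k w))\<^sup>2)"
    by (simp add: fun_eq_iff block_sum_Suc power2_sum)
  then have "mean (conc q ?z) (\<lambda>w. (block_sum k g (Suc N) w)\<^sup>2)
     = mean (conc q ?z) (\<lambda>w. (g (take k w))\<^sup>2 * 1) + 2 * mean (conc q ?z) (\<lambda>w. g (take k w) * block_sum k g N (drop k w))
      + mean (conc q ?z) (\<lambda>w. 1 * (block_sum k g N (drop k w))\<^sup>2)"
    using comp[OF g2 bounded_range_const[of 1]] comp[OF g S] comp[OF bounded_range_const[of 1] S2]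
    by (simp add: integrable_pmf_bounded)
  also have "\<dots> = mean q (\<lambda>u. (g u)\<^sup>2) + mean ?z (\<lambda>w. (block_sum k g N w)\<^sup>2)"
    using mean_conc_split[of q k, OF q g2 bounded_range_const[of 1], of ?z] mean_conc_split[of q k, OF q g S, of ?z]
      mean_conc_split[of q k, OF q bounded_range_const[of 1] S2, of ?z] 0 by simp
  also have "\<dots> \<le> B\<^sup>2 + real N * B\<^sup>2"
  proof (rule add_mono[OF _ Suc])
    have "mean q (\<lambda>u. (g u)\<^sup>2) \<le> mean q (\<lambda>u. B\<^sup>2)"
      using B by (intro mean_mono g2 bounded_range_const) (metis abs_ge_zero power2_abs power_mono)
    then show "mean q (\<lambda>u. (g u)\<^sup>2) \<le> B\<^sup>2" by simp
  qed
  finally show ?case by (simp add: algebra_simps)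
qed

lemma block_sum_deviation:
  assumes q: "\<And>u. u \<in> set_pmf q \<Longrightarrow> length u = k" and B: "\<And>u. \<bar>g u\<bar> \<le> B" and 0: "mean q g = 0" and t: "0 < t"
  shows "measure_pmf.prob (concat_power q z N) {w. t \<le> \<bar>block_sum k g N w\<bar>} \<le> real N * B\<^sup>2 / t\<^sup>2"
proof -
  let ?z = "concat_power q z N"
  have g: "bounded (range g)" using B by (rule bounded_rangeI)
  have S2: "bounded (range (\<lambda>w. (block_sum k g N w)\<^sup>2))"
    unfolding power2_eq_square by (intro bounded_range_intros bounded_block_sum g)
  have "mean ?z (\<lambda>w. t\<^sup>2 * indicator {w. t \<le> \<bar>block_sum k g N w\<bar>} w) \<le> mean ?z (\<lambda>w. (block_sum k g N w)\<^sup>2)"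
  proof (intro mean_mono bounded_range_intros S2)
    fix w
    show "t\<^sup>2 * indicator {w. t \<le> \<bar>block_sum k g N w\<bar>} w \<le> (block_sum k g N w)\<^sup>2"
      using t power_mono[of t "\<bar>block_sum k g N w\<bar>" 2] by (auto split: split_indicator)
  qed
  also have "\<dots> \<le> real N * B\<^sup>2" by (rule second_moment_block_sum[OF q B 0])
  finally show ?thesis using t by (simp add: field_simps)
qed

context quasi_bernoulli
begin

text \<open>
  Each additional block costs its own entropy and one constant \<open>C\<close> for cutting it off. The remainder is
  distributed as under \<open>P\<close> and costs nothing.
\<close>

lemma kl_concat_power:
  "kl (concat_power (block_law k Q) (p r) N) (p (N * k + r)) \<le> ereal (real N) * (ent k Q + ereal C)"
proof (induction N)
  case 0
  then show ?case by (simp add: kl_self zero_ereal_def[symmetric])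
next
  case (Suc N)
  let ?z = "concat_power (block_law k Q) (p r) N"
  have "kl (conc (block_law k Q) ?z) (p (k + (N * k + r))) \<le> ent k Q + kl ?z (p (N * k + r)) + ereal (ln (exp C))"
    by (rule kl_conc_le) (auto intro: mean_conc_le_p)
  also have "\<dots> \<le> ent k Q + ereal (real N) * (ent k Q + ereal C) + ereal C"
    by (intro add_mono Suc) auto
  also have "\<dots> = ereal (real (Suc N)) * (ent k Q + ereal C)"
    using kl_nonneg[of "block_law k Q" "p k"] by (cases "ent k Q") (auto simp: algebra_simps)
  finally show ?case by (simp add: add.assoc)
qed

text \<open>
  Occurrences of \<open>v\<close> inside a \<open>k\<close>-block minus their expectation under \<open>Q\<close>. The last possible position is
  left out, so that at most \<open>k\<close> terms occur even when \<open>v\<close> is empty.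
\<close>

definition centred_count :: "(int \<Rightarrow> 'a) measure \<Rightarrow> 'a list \<Rightarrow> nat \<Rightarrow> 'a list \<Rightarrow> real" where
  "centred_count Q v k z = (\<Sum>s<k - length v. indicator {v} (take (length v) (drop s z)) - cyl Q v)"

lemma cyl_le_1: "cyl Q v \<le> 1"
  by (simp add: cyl_def pmf_le_1)

lemma abs_indicator_cyl: "\<bar>indicator {v} w - cyl Q v\<bar> \<le> 1"
  using cyl_nonneg[of Q v] cyl_le_1[of Q v] by (auto split: split_indicator)

lemma abs_centred_count_le: "\<bar>centred_count Q v k z\<bar> \<le> real k"
proof -
  have "\<bar>centred_count Q v k z\<bar> \<le> (\<Sum>s<k - length v. \<bar>indicator {v} (take (length v) (drop s z)) - cyl Q v\<bar>)"
    unfolding centred_count_def by (rule sum_abs)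
  also have "\<dots> \<le> (\<Sum>s<k - length v. 1)" by (intro sum_mono abs_indicator_cyl)
  also have "\<dots> \<le> real k" by simp
  finally show ?thesis .
qed

text \<open>
  Stationarity of \<open>Q\<close>: every position inside the block sees \<open>v\<close> with the same probability.
\<close>

lemma mean_centred_count:
  assumes Q: "Q \<in> inv_laws A" shows "mean (block_law k Q) (centred_count Q v k) = 0"
proof -
  have b: "bounded (range (\<lambda>z. indicator {v} (take (length v) (drop s z)) :: real))" for s
    using bounded_range_comp[OF bounded_range_indicator[of "{v}"], of "\<lambda>z. take (length v) (drop s z)"] .
  have one: "mean (block_law k Q) (\<lambda>z. indicator {v} (take (length v) (drop s z)) - cyl Q v) = 0" if "s < k - length v" for s
  proof -
    have "mean (block_law k Q) (\<lambda>z. indicator {v} (take (length v) (drop s z)))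
        = mean (map_pmf (\<lambda>z. take (length v) (drop s z)) (block_law k Q)) (indicator {v})" by (simp only: integral_map_pmf)
    also have "map_pmf (\<lambda>z. take (length v) (drop s z)) (block_law k Q) = block_law (length v) Q"
      using that by (intro map_pmf_window[OF Q]) simp
    also have "mean (block_law (length v) Q) (indicator {v}) = cyl Q v" by (simp add: cyl_def measure_pmf_single)
    finally show ?thesis using integrable_pmf_bounded[OF b] by simp
  qed
  have "mean (block_law k Q) (centred_count Q v k)
      = (\<Sum>s<k - length v. mean (block_law k Q) (\<lambda>z. indicator {v} (take (length v) (drop s z)) - cyl Q v))"
    unfolding centred_count_def[abs_def] by (rule mean_sum_bounded) (intro bounded_range_intros b)
  then show ?thesis using one by simp
qed

text \<open>
  Only windows that cross a block boundary or lie in the remainder escape the block counts: at most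
  \<open>length v\<close> per block and \<open>k\<close> in the remainder, each contributing at most 1.
\<close>

lemma cyl_cyclic_law_deviation:
  assumes u: "length u = n" "set u \<subseteq> A" and k: "1 \<le> k" "length v \<le> k" and n: "1 \<le> n" and N: "N = n div k"
  shows "real n * \<bar>cyl (cyclic_law A u) v - cyl Q v\<bar>
    \<le> \<bar>block_sum k (centred_count Q v k) N u\<bar> + real N * real (length v) + real k"
proof -
  let ?j = "length v"
  define a where "a i = indicator {v} (cyclic_window u i ?j) - cyl Q v" for i
  have a1: "\<bar>a i\<bar> \<le> 1" for i unfolding a_def by (rule abs_indicator_cyl)
  have ne: "u \<noteq> []" using u n by auto
  have nN: "n = N * k + n mod k" unfolding N by simp
  have "cyl (cyclic_law A u) v = (\<Sum>i<n. indicator {v} (cyclic_window u i ?j)) / real n"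
    using cyl_cyclic_law[OF ne u(2)] u(1) by simp
  then have "real n * (cyl (cyclic_law A u) v - cyl Q v) = (\<Sum>i<n. a i)"
    using n by (simp add: a_def sum_subtractf field_simps)
  also have "\<dots> = (\<Sum>i<N * k. a i) + (\<Sum>i=N * k..<n. a i)"
    using nN by (metis le_add1 lessThan_atLeast0 sum.atLeastLessThan_concat zero_le)
  also have "(\<Sum>i<N * k. a i) = (\<Sum>l<N. \<Sum>s<k. a (l * k + s))" by (rule sum_blocks)
  also have "\<dots> = (\<Sum>l<N. (\<Sum>s<k - ?j. a (l * k + s)) + (\<Sum>s=k - ?j..<k. a (l * k + s)))"
    by (intro sum.cong refl) (metis diff_le_self lessThan_atLeast0 sum.atLeastLessThan_concat zero_le)
  also have "\<dots> = (\<Sum>l<N. \<Sum>s<k - ?j. a (l * k + s)) + (\<Sum>l<N. \<Sum>s=k - ?j..<k. a (l * k + s))"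
    by (rule sum.distrib)
  also have "(\<Sum>l<N. \<Sum>s<k - ?j. a (l * k + s)) = block_sum k (centred_count Q v k) N u"
    unfolding block_sum_def centred_count_def
  proof (intro sum.cong refl)
    fix l s assume l: "l \<in> {..<N}" and s: "s \<in> {..<k - ?j}"
    have "Suc l * k \<le> N * k" using l by (intro mult_right_mono) auto
    then have "l * k + k \<le> n" using nN by simp
    then have "l * k + s + ?j \<le> length u" using s u(1) by simp
    then have "cyclic_window u (l * k + s) ?j = take ?j (drop (l * k + s) u)" by (rule cyclic_window_inner)
    also have "\<dots> = take ?j (drop s (take k (drop (l * k) u)))"
      using s by (simp add: drop_take min_def add.commute)
    finally show "a (l * k + s) = indicator {v} (take ?j (drop s (take k (drop (l * k) u)))) - cyl Q v"
      by (simp add: a_def)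
  qed
  finally have eq: "real n * (cyl (cyclic_law A u) v - cyl Q v)
     = block_sum k (centred_count Q v k) N u + (\<Sum>l<N. \<Sum>s=k - ?j..<k. a (l * k + s)) + (\<Sum>i=N * k..<n. a i)" .
  have "\<bar>\<Sum>l<N. \<Sum>s=k - ?j..<k. a (l * k + s)\<bar> \<le> (\<Sum>l<N. \<Sum>s=k - ?j..<k. 1)"
    by (intro order_trans[OF sum_abs] sum_mono a1)
  also have "\<dots> = real N * real ?j" using k(2) by simp
  finally have e1: "\<bar>\<Sum>l<N. \<Sum>s=k - ?j..<k. a (l * k + s)\<bar> \<le> real N * real ?j" .
  have "\<bar>\<Sum>i=N * k..<n. a i\<bar> \<le> (\<Sum>i=N * k..<n. 1)"
    by (intro order_trans[OF sum_abs] sum_mono a1)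
  also have "\<dots> = real (n - N * k)" by (simp only: sum_constant card_atLeastLessThan mult_1_right)
  also have "n - N * k = n mod k" by (simp add: N minus_div_mult_eq_mod)
  also have "\<dots> \<le> real k" using k(1) by (simp add: less_imp_le)
  finally have e2: "\<bar>\<Sum>i=N * k..<n. a i\<bar> \<le> real k" .
  have "real n * \<bar>cyl (cyclic_law A u) v - cyl Q v\<bar> = \<bar>real n * (cyl (cyclic_law A u) v - cyl Q v)\<bar>"
    by (simp add: abs_mult)
  then show ?thesis unfolding eq using e1 e2 by linarith
qed

text \<open>
  Fix a cylinder neighbourhood of \<open>Q\<close> inside \<open>G\<close> of radius \<open>d\<close>, and \<open>k\<close> so large that the entropy cost
  per site is below \<open>r + e / 2\<close> and block boundaries contribute less than \<open>d / 4\<close>. Fluctuations and the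
  remainder contribute less than \<open>d / 4\<close> each once \<open>n\<close> is large.
\<close>

lemma lower_bound_eventually:
  assumes G: "openin (weak_topology A) G" and Q: "Q \<in> G" and r: "rate Q = ereal r" and e: "0 < e"
  shows "eventually (\<lambda>n. ereal (- (r + e)) \<le> ereal_ln (measure_pmf.prob (p n) {u. cyclic_law A u \<in> G}) / ereal (real n)) sequentially"
proof -
  obtain V where V: "open V" "G = {Q \<in> inv_laws A. cyl Q \<in> V}" by (rule weak_topology_cylinders[OF G])
  have Qi: "Q \<in> inv_laws A" and QV: "cyl Q \<in> V" using Q V by auto
  obtain S d where S: "finite S" and d: "0 < d" "\<And>y. (\<And>v. v \<in> S \<Longrightarrow> \<bar>y v - cyl Q v\<bar> < d) \<Longrightarrow> y \<in> V"
    by (rule open_fun_finite_nbhd[OF V(1) QV]) blast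
  define j where "j = Max (insert 0 (length ` S))"
  have j: "length v \<le> j" if "v \<in> S" for v unfolding j_def using S that by (intro Max_ge) auto
  have inv_lim: "(\<lambda>n. x / real n) \<longlonglongrightarrow> 0" for x :: real
    by (intro tendsto_divide_0[OF tendsto_const] filterlim_real_sequentially filterlim_at_top_imp_at_infinity)
  have "eventually (\<lambda>k. ent k Q / ereal (real k) < ereal (r + e / 4)) sequentially"
    using rate_limit[OF Qi] by (rule order_tendstoD(2)) (use r e in simp)
  moreover have "eventually (\<lambda>k. C / real k < e / 4) sequentially"
    using inv_lim by (rule order_tendstoD(2)) (use e in simp)
  moreover have "eventually (\<lambda>k. real j / real k < d / 4) sequentially"
    using inv_lim by (rule order_tendstoD(2)) (use d in simp)
  ultimately have "eventually (\<lambda>k. ent k Q / ereal (real k) < ereal (r + e / 4) \<and> C / real k < e / 4 \<and> real j / real k < d / 4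
      \<and> max 1 j \<le> k) sequentially"
    using eventually_ge_at_top[of "max 1 j"] by eventually_elim simp
  then obtain k where k: "ent k Q / ereal (real k) < ereal (r + e / 4)" "C / real k < e / 4" "real j / real k < d / 4" "max 1 j \<le> k"
    by (auto simp: eventually_sequentially)
  have k1: "1 \<le> k" "j \<le> k" using k(4) by auto
  obtain h where h: "ent k Q = ereal h"
    using k(1) kl_nonneg[of "block_law k Q" "p k"] k1 by (cases "ent k Q") auto
  define c where "c = h + C"
  have c: "c / real k < r + e / 2"
  proof -
    have "h / real k < r + e / 4" using k(1) k1 h by simp
    then show ?thesis using k(2) unfolding c_def add_divide_distrib by linarith
  qed
  have c0: "0 \<le> c" using kl_nonneg[of "block_law k Q" "p k"] h C by (simp add: c_def)
  define N where "N n = n div k" for n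
  \<comment> \<open>Chebyshev with blocks centred and bounded by \<open>k\<close> and deviation \<open>k d / 4\<close> per block, for each of
    the finitely many cylinders.\<close>
  define pi where "pi n = 1 - (real (card S) * 16 / d\<^sup>2) / real (N n)" for n
  have Nlim: "filterlim N at_top at_top"
    unfolding N_def[abs_def] using k1 by (intro filterlim_at_top_div_const_nat) simp
  have pilim: "pi \<longlonglongrightarrow> 1"
  proof -
    have "(\<lambda>n. 1 - (real (card S) * 16 / d\<^sup>2) / real (N n)) \<longlonglongrightarrow> 1 - 0"
      by (intro tendsto_diff tendsto_const filterlim_compose[OF inv_lim Nlim])
    then show ?thesis by (simp add: pi_def[abs_def])
  qed
  define q where "q n = concat_power (block_law k Q) (p (n mod k)) (N n)" for n
  have supp: "length u = n \<and> set u \<subseteq> A" if "u \<in> set_pmf (q n)" for u n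
    using set_concat_power[of "block_law k Q" k A "p (n mod k)" "n mod k" u "N n"] that
      set_pmf_block_law[OF Qi, of k] set_pmf_block_law[OF P, of "n mod k"]
    by (auto simp: q_def N_def)
  have klq: "kl (q n) (p n) \<le> ereal (real (N n) * c)" for n
    using kl_concat_power[of k Q "n mod k" "N n"] by (simp add: q_def N_def h c_def)
  let ?X = "{u. cyclic_law A u \<in> G}"
  have prob_ge: "pi n \<le> measure_pmf.prob (q n) ?X" if n: "1 \<le> N n" "real k / real n < d / 4" "1 \<le> n" for n
  proof -
    let ?W = "\<lambda>v. {w. real (N n) * real k * (d / 4) \<le> \<bar>block_sum k (centred_count Q v k) (N n) w\<bar>}"
    have t: "0 < real (N n) * real k * (d / 4)" using n k1 d by simp
    have W: "measure_pmf.prob (q n) (?W v) \<le> (16 / d\<^sup>2) / real (N n)" if "v \<in> S" for v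
    proof -
      have "measure_pmf.prob (q n) (?W v) \<le> real (N n) * (real k)\<^sup>2 / (real (N n) * real k * (d / 4))\<^sup>2"
        unfolding q_def by (rule block_sum_deviation[OF length_p[OF _ Qi] abs_centred_count_le mean_centred_count[OF Qi] t])
      also have "\<dots> = (16 / d\<^sup>2) / real (N n)"
        using n k1 d by (simp add: power2_eq_square field_simps)
      finally show ?thesis .
    qed
    have "1 - measure_pmf.prob (q n) ?X = measure_pmf.prob (q n) (- ?X)"
      using measure_pmf.prob_compl[of ?X "q n"] by (simp add: Compl_eq_Diff_UNIV)
    also have "\<dots> \<le> measure_pmf.prob (q n) (\<Union>v\<in>S. ?W v)"
    proof (rule measure_pmf.finite_measure_mono_AE)
      show "AE u in q n. u \<in> - ?X \<longrightarrow> u \<in> (\<Union>v\<in>S. ?W v)"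
        unfolding AE_measure_pmf_iff
      proof (intro ballI impI, rule ccontr)
        fix u assume u: "u \<in> set_pmf (q n)" "u \<in> - ?X" "u \<notin> (\<Union>v\<in>S. ?W v)"
        have len: "length u = n" "set u \<subseteq> A" using supp[OF u(1)] by auto
        have ne: "u \<noteq> []" using len n by auto
        have inv: "cyclic_law A u \<in> inv_laws A" by (rule cyclic_law_in_inv_laws[OF ne len(2)])
        have "cyl (cyclic_law A u) \<in> V"
        proof (rule d(2))
          fix v assume v: "v \<in> S"
          have lv: "length v \<le> k" using j[OF v] k1 by simp
          have "\<bar>block_sum k (centred_count Q v k) (N n) u\<bar> < real (N n) * real k * (d / 4)"
            using u(3) v by auto
          then have "real n * \<bar>cyl (cyclic_law A u) v - cyl Q v\<bar>
              < real (N n) * real k * (d / 4) + real (N n) * real (length v) + real k"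
            using cyl_cyclic_law_deviation[OF len k1(1) lv n(3) N_def, of Q] by linarith
          also have "real (N n) * real (length v) \<le> real (N n) * real k * (d / 4)"
          proof -
            have "real (length v) \<le> real j" using j[OF v] by simp
            also have "real j \<le> real k * (d / 4)" using k(3) k1 by (simp add: field_simps)
            finally show ?thesis by (simp add: mult.assoc mult_left_mono)
          qed
          also have "real (N n) * real k * (d / 4) \<le> real n * (d / 4)"
          proof (rule mult_right_mono)
            have "N n * k \<le> n" by (simp add: N_def)
            then show "real (N n) * real k \<le> real n" by (metis of_nat_le_iff of_nat_mult)
          qed (use d in simp)
          also have "real k \<le> real n * (d / 4)" using n by (simp add: field_simps)
          finally have "real n * \<bar>cyl (cyclic_law A u) v - cyl Q v\<bar> < real n * (d / 4) + real n * (d / 4) + real n * (d / 4)" by simp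
          also have "\<dots> \<le> real n * d" using d by simp
          finally show "\<bar>cyl (cyclic_law A u) v - cyl Q v\<bar> < d" using n by simp
        qed
        then show False using u(2) inv V(2) by auto
      qed
    qed simp
    also have "\<dots> \<le> (\<Sum>v\<in>S. measure_pmf.prob (q n) (?W v))" by (rule measure_UNION_le[OF S]) auto
    also have "\<dots> \<le> (\<Sum>v\<in>S. (16 / d\<^sup>2) / real (N n))" by (intro sum_mono W)
    also have "\<dots> = (real (card S) * 16 / d\<^sup>2) / real (N n)" by simp
    finally show ?thesis by (simp add: pi_def)
  qed
  have lim: "(\<lambda>n. (c / real k + ln 2 / real n) / pi n) \<longlonglongrightarrow> (c / real k + 0) / 1"
    by (intro tendsto_divide tendsto_add tendsto_const inv_lim pilim) simp
  have ev1: "eventually (\<lambda>n. (c / real k + ln 2 / real n) / pi n < r + e) sequentially"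
    using lim by (rule order_tendstoD(2)) (use c e in simp)
  have ev2: "eventually (\<lambda>n. 0 < pi n) sequentially"
    using pilim by (rule order_tendstoD(1)) simp
  have ev3: "eventually (\<lambda>n. real k / real n < d / 4) sequentially"
    using inv_lim by (rule order_tendstoD(2)) (use d in simp)
  have ev4: "eventually (\<lambda>n. 1 \<le> N n) sequentially"
    using Nlim unfolding filterlim_at_top by blast
  show ?thesis
    using ev1 ev2 ev3 ev4 eventually_ge_at_top[of 1]
  proof eventually_elim
    case (elim n)
    let ?a = "measure_pmf.prob (q n) ?X" and ?b = "measure_pmf.prob (p n) ?X"
    have a: "pi n \<le> ?a" by (rule prob_ge) (use elim in auto)
    then have a0: "0 < ?a" using elim by simp
    have b0: "0 < ?b" by (rule kl_event(1)[OF klq a0])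
    have "- ?a * ln ?b \<le> real (N n) * c + ln 2" by (rule kl_event(2)[OF klq a0])
    moreover have "real (N n) * c \<le> real n / real k * c"
      unfolding N_def using c0 by (intro mult_right_mono of_nat_div_le_of_nat)
    moreover have lb: "ln ?b \<le> 0" using b0 by simp
    moreover have "pi n * (- ln ?b) \<le> ?a * (- ln ?b)" using a lb by (intro mult_right_mono) auto
    moreover have "real n * (c / real k + ln 2 / real n) = real n / real k * c + ln 2"
      using elim(5) by (simp add: distrib_left)
    ultimately have fin: "pi n * (- ln ?b) \<le> real n * (c / real k + ln 2 / real n)"
      by linarith
    have cross: "x / m \<le> y / t" if "t * x \<le> m * y" "0 < t" "0 < m" for x y t m :: real
      using that by (simp add: field_simps)
    have "- ln ?b / real n \<le> (c / real k + ln 2 / real n) / pi n"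
      by (rule cross[OF fin]) (use elim(2,5) in auto)
    then have "- (r + e) \<le> ln ?b / real n" using elim(1) by linarith
    then show ?case using b0 elim(5) by (simp add: ereal_ln_def)
  qed
qed

theorem lower_bound:
  assumes G: "openin (weak_topology A) G"
  shows "- (INF Q\<in>G. rate Q) \<le> liminf (\<lambda>n. ereal_ln (measure_pmf.prob (p n) {u. cyclic_law A u \<in> G}) / ereal (real n))"
    (is "_ \<le> ?L")
proof -
  have "- rate Q \<le> ?L" if Q: "Q \<in> G" for Q
  proof -
    have Qi: "Q \<in> inv_laws A" using openin_subset[OF G] Q by (auto simp: topspace_weak_topology)
    show ?thesis
    proof (cases "rate Q")
      case (real r)
      have le: "ereal (- (r + e)) \<le> ?L" if "0 < e" for e
        by (rule Liminf_bounded) (rule lower_bound_eventually[OF G Q real that])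
      have "- rate Q \<le> ?L + ereal e" if "0 < e" for e
      proof -
        have "- rate Q = ereal (- (r + e)) + ereal e" by (simp add: real)
        also have "\<dots> \<le> ?L + ereal e" by (intro add_right_mono le that)
        finally show ?thesis .
      qed
      then show ?thesis by (rule ereal_le_epsilon2)
    next
      case MInf
      then show ?thesis using rate_nonneg[OF Qi] by simp
    qed simp
  qed
  then have "- ?L \<le> (INF Q\<in>G. rate Q)"
    by (intro INF_greatest) (simp add: ereal_uminus_le_reorder)
  then show ?thesis by (simp add: ereal_uminus_le_reorder)
qed

section \<open>Compactness of level sets\<close>

text \<open>
  Outside the compact sets of exponential tightness the probabilities decay at rate \<open>L > c\<close>. That
  complement is open, so by the lower bound the rate function is at least \<open>L\<close> on it, and the level set
  lies inside the compact set.
\<close>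

theorem compact_level_sets:
  "compactin (weak_topology A) {Q \<in> inv_laws A. rate Q \<le> ereal c}"
proof -
  define L where "L = max c 0 + 1"
  obtain F where F: "\<And>m. finite (F m)"
    and Fp: "\<And>n. 1 \<le> n \<Longrightarrow> measure_pmf.prob (p n) {u. cyclic_law A u \<notin> tight_laws A F} \<le> exp (- L * real n)"
    using exponential_tightness[of L] by (auto simp: L_def)
  let ?T = "weak_topology A" and ?K = "{Q \<in> inv_laws A. rate Q \<le> ereal c}"
  have ts: "topspace ?T = inv_laws A" by (rule topspace_weak_topology)
  let ?G = "inv_laws A - tight_laws A F"
  have "?G = (\<Union>m. {Q \<in> inv_laws A. mean (block_law 1 Q) (indicator {u. hd u \<notin> F m}) \<in> {1 / real (Suc m)<..}})"
  proof -
    have "Q \<in> ?G \<longleftrightarrow> (\<exists>m. 1 / real (Suc m) < measure_pmf.prob (block_law 1 Q) {u. hd u \<notin> F m})"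
      if "Q \<in> inv_laws A" for Q
      using that by (simp add: tight_laws_def not_le del: of_nat_Suc)
    then show ?thesis by auto
  qed
  also have "openin ?T \<dots>"
  proof (rule openin_Union)
    have "openin ?T {Q \<in> inv_laws A. mean (block_law 1 Q) (indicator {u. hd u \<notin> F m}) \<in> {1 / real (Suc m)<..}}" for m
      by (rule openin_weak_topology_block) simp_all
    then show "openin ?T T" if "T \<in> range (\<lambda>m. {Q \<in> inv_laws A. mean (block_law 1 Q) (indicator {u. hd u \<notin> F m}) \<in> {1 / real (Suc m)<..}})" for T
      using that by blast
  qed
  finally have G: "openin ?T ?G" .
  have closed: "closedin ?T ?K"
  proof -
    have "?K = topspace ?T - {Q \<in> topspace ?T. ereal c < rate Q}" by (auto simp: ts not_less)
    also have "closedin ?T \<dots>"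
      using rate_lsc unfolding lower_semicontinuous_def by (intro closedin_diff closedin_topspace) blast
    finally show ?thesis .
  qed
  have sub: "?K \<subseteq> tight_laws A F"
  proof
    fix Q assume Q: "Q \<in> ?K"
    show "Q \<in> tight_laws A F"
    proof (rule ccontr)
      assume "Q \<notin> tight_laws A F"
      then have QG: "Q \<in> ?G" using Q by simp
      have "exp_decay (\<lambda>n. measure_pmf.prob (p n) {u. cyclic_law A u \<in> ?G}) L"
        unfolding exp_decay_def
      proof (intro exI[of _ 1] eventually_sequentiallyI[of 1])
        fix n :: nat assume n: "1 \<le> n"
        have "measure_pmf.prob (p n) {u. cyclic_law A u \<in> ?G} \<le> measure_pmf.prob (p n) {u. cyclic_law A u \<notin> tight_laws A F}"
          by (rule measure_pmf.finite_measure_mono) auto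
        then show "measure_pmf.prob (p n) {u. cyclic_law A u \<in> ?G} \<le> 1 * exp (- L * real n)" using Fp[OF n] by simp
      qed
      from exp_decay_limsup[OF this]
      have "limsup (\<lambda>n. ereal_ln (measure_pmf.prob (p n) {u. cyclic_law A u \<in> ?G}) / ereal (real n)) \<le> ereal (- L)" by simp
      moreover have "- (INF R\<in>?G. rate R) \<le> liminf (\<lambda>n. ereal_ln (measure_pmf.prob (p n) {u. cyclic_law A u \<in> ?G}) / ereal (real n))"
        by (rule lower_bound[OF G])
      moreover have "liminf (\<lambda>n. ereal_ln (measure_pmf.prob (p n) {u. cyclic_law A u \<in> ?G}) / ereal (real n))
          \<le> limsup (\<lambda>n. ereal_ln (measure_pmf.prob (p n) {u. cyclic_law A u \<in> ?G}) / ereal (real n))"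
        by (rule Liminf_le_Limsup) simp
      ultimately have "- (INF R\<in>?G. rate R) \<le> ereal (- L)" by (meson order_trans)
      moreover have "(INF R\<in>?G. rate R) \<le> rate Q" by (rule INF_lower[OF QG])
      moreover have "rate Q \<le> ereal c" using Q by simp
      ultimately have "- ereal c \<le> ereal (- L)" by (meson ereal_minus_le_minus order_trans)
      then show False by (simp add: L_def)
    qed
  qed
  have "compactin ?T (?K \<inter> tight_laws A F)"
    by (rule closed_Int_compactin[OF closed compactin_tight_laws[OF F]])
  then show ?thesis using sub by (simp add: Int_absorb2)
qed

end

section \<open>Summable variation implies the quasi-Bernoulli property\<close>

definition past :: "(int \<Rightarrow> 'e) \<Rightarrow> int \<Rightarrow> 'e" where
  "past x = restrict x {..0}"

definition append_letter :: "(int \<Rightarrow> 'e) \<Rightarrow> 'e \<Rightarrow> int \<Rightarrow> 'e" where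
  "append_letter z b = (\<lambda>k\<in>{..0}. if k = 0 then b else z (k + 1))"

definition drop_letter :: "(int \<Rightarrow> 'e) \<Rightarrow> int \<Rightarrow> 'e" where
  "drop_letter z = (\<lambda>k\<in>{..0}. z (k - 1))"

definition first_letter :: "'e \<Rightarrow> (int \<Rightarrow> 'e) set" where
  "first_letter b = {y \<in> space future_space. y 1 = b}"

definition step_prob :: "((int \<Rightarrow> 'e) \<Rightarrow> (int \<Rightarrow> 'e) measure) \<Rightarrow> (int \<Rightarrow> 'e) \<Rightarrow> 'e \<Rightarrow> ennreal" where
  "step_prob K z b = emeasure (K z) (first_letter b)"

text \<open>
  The conditional probability of a letter string given the past, by the chain rule. It is defined for
  every past, not only almost every one, which is what makes the comparison of pasts uniform.
\<close>

fun word_prob :: "((int \<Rightarrow> 'e) \<Rightarrow> (int \<Rightarrow> 'e) measure) \<Rightarrow> (int \<Rightarrow> 'e) \<Rightarrow> 'e list \<Rightarrow> ennreal" where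
  "word_prob K z [] = 1"
| "word_prob K z (b # a) = step_prob K z b * word_prob K (append_letter z b) a"

lemma space_past_space: "space (past_space :: (int \<Rightarrow> 'e) measure) = extensional {..0}"
  unfolding past_space_def space_PiM PiE_def space_count_space by auto

lemma past_in_space: "past x \<in> space past_space"
  by (simp add: space_past_space past_def)

lemma append_letter_in_space: "append_letter z b \<in> space past_space"
  by (simp add: space_past_space append_letter_def)

lemma measurable_past: "past \<in> measurable (seq_space UNIV) past_space"
  unfolding past_def[abs_def] seq_space_def past_space_def by (rule measurable_restrict_subset) simp

lemma measurable_past_component: "k \<le> 0 \<Longrightarrow> (\<lambda>z. z k) \<in> measurable past_space (count_space UNIV)"
  unfolding past_space_def by (rule measurable_component_singleton) simp

lemma measurable_append_letter: "(\<lambda>z. append_letter z b) \<in> measurable past_space past_space"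
proof -
  have "(\<lambda>z. \<lambda>k\<in>{..0}. if k = 0 then b else z (k + 1)) \<in> measurable past_space (PiM {..0} (\<lambda>_. count_space UNIV))"
  proof (rule measurable_restrict)
    fix k :: int assume "k \<in> {..0}"
    then show "(\<lambda>z. if k = 0 then b else z (k + 1)) \<in> measurable past_space (count_space UNIV)"
      by (cases "k = 0") (auto intro: measurable_past_component)
  qed
  then show ?thesis by (simp add: append_letter_def past_space_def)
qed

lemma measurable_drop_letter: "drop_letter \<in> measurable past_space past_space"
proof -
  have "(\<lambda>z. \<lambda>k\<in>{..0}. z (k - 1)) \<in> measurable past_space (PiM {..0} (\<lambda>_. count_space UNIV))"
    by (rule measurable_restrict) (auto intro: measurable_past_component)
  then show ?thesis by (simp add: drop_letter_def[abs_def] past_space_def)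
qed

lemma first_letter_sets: "first_letter b \<in> sets future_space"
proof -
  have "(\<lambda>y. y 1) \<in> measurable future_space (count_space UNIV)"
    unfolding future_space_def by (rule measurable_component_singleton) simp
  then have "(\<lambda>y. y 1) -` {b} \<inter> space future_space \<in> sets future_space" by (rule measurable_sets) simp
  moreover have "(\<lambda>y. y 1) -` {b} \<inter> space future_space = first_letter b" by (auto simp: first_letter_def)
  ultimately show ?thesis by simp
qed

lemma measurable_step_prob:
  assumes "regular_version \<nu> K" shows "(\<lambda>z. step_prob K z b) \<in> borel_measurable past_space"
proof -
  have "K \<in> measurable past_space (subprob_algebra future_space)"
    using assms unfolding regular_version_def by (blast intro: measurable_prob_algebraD)
  from measurable_compose[OF this measurable_emeasure_subprob_algebra[OF first_letter_sets]]
  show ?thesis by (simp add: step_prob_def)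
qed

lemma measurable_word_prob:
  assumes K: "regular_version \<nu> K" shows "(\<lambda>z. word_prob K z a) \<in> borel_measurable past_space"
proof (induction a)
  case (Cons b a)
  then show ?case
    using measurable_step_prob[OF K] measurable_compose[OF measurable_append_letter Cons] by simp
qed simp

lemma prob_space_kernel:
  assumes "regular_version \<nu> K" "z \<in> space past_space" shows "prob_space (K z)"
  using assms measurable_space[of K past_space "prob_algebra future_space" z]
  by (auto simp: regular_version_def space_prob_algebra)

lemma variation_upper:
  assumes z: "z \<in> space past_space" "z' \<in> space past_space"
    and agree: "\<And>k. - int n < k \<Longrightarrow> k \<le> 0 \<Longrightarrow> z k = z' k"
    and B: "B \<in> sets (vimage_algebra (space future_space) (\<lambda>y. y 1) (count_space UNIV))" "0 < measure (K z) B"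
  shows "\<bar>ereal_ln (measure (K z) B) - ereal_ln (measure (K z') B)\<bar> \<le> variation K n"
proof -
  have "\<bar>ereal_ln (measure (K z) B) - ereal_ln (measure (K z') B)\<bar>
    \<le> (SUP B \<in> {B \<in> sets (vimage_algebra (space future_space) (\<lambda>y. y 1) (count_space UNIV)). 0 < measure (K z) B}.
        \<bar>ereal_ln (measure (K z) B) - ereal_ln (measure (K z') B)\<bar>)"
    by (rule SUP_upper) (use B in blast)
  also have "\<dots> \<le> variation K n"
    unfolding variation_def by (rule SUP_upper2[of "(z, z')"]) (use z agree in auto)
  finally show ?thesis .
qed

lemma variation_nonneg:
  assumes K: "regular_version \<nu> K" shows "0 \<le> variation K n"
proof -
  let ?z = "restrict (\<lambda>_. undefined) {..0} :: int \<Rightarrow> 'e"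
  have z: "?z \<in> space past_space" by (simp add: space_past_space)
  interpret prob_space "K ?z" by (rule prob_space_kernel[OF K z])
  have "space (K ?z) = space future_space"
    using K z measurable_space[of K past_space "prob_algebra future_space" ?z] sets_eq_imp_space_eq
    by (auto simp: regular_version_def space_prob_algebra)
  then have one: "measure (K ?z) (space future_space) = 1" using prob_space by simp
  have B: "space future_space \<in> sets (vimage_algebra (space future_space) (\<lambda>y :: int \<Rightarrow> 'e. y 1) (count_space UNIV))"
    by (metis sets.top space_vimage_algebra)
  have "\<bar>ereal_ln (measure (K ?z) (space future_space)) - ereal_ln (measure (K ?z) (space future_space))\<bar> \<le> variation K n"
    by (rule variation_upper[OF z z _ B]) (simp_all add: one)
  then show ?thesis by (simp add: one ereal_ln_def zero_ereal_def)
qed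

lemma step_prob_variation:
  assumes K: "regular_version \<nu> K" and z: "z \<in> space past_space" "z' \<in> space past_space"
    and agree: "\<And>k. - int n < k \<Longrightarrow> k \<le> 0 \<Longrightarrow> z k = z' k" and var: "variation K n \<le> ereal c"
  shows "step_prob K z b \<le> ennreal (exp c) * step_prob K z' b"
proof -
  let ?B = "first_letter b"
  interpret z: prob_space "K z" by (rule prob_space_kernel[OF K z(1)])
  interpret z': prob_space "K z'" by (rule prob_space_kernel[OF K z(2)])
  have "measure (K z) ?B \<le> exp c * measure (K z') ?B"
  proof (cases "measure (K z) ?B = 0")
    case False
    then have p: "0 < measure (K z) ?B" by (simp add: zero_less_measure_iff)
    have B: "?B \<in> sets (vimage_algebra (space future_space) (\<lambda>y. y 1) (count_space UNIV))"
      unfolding sets_vimage_algebra first_letter_def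
      by (rule sigma_sets.Basic) (auto intro!: exI[of _ "{b}"])
    have "\<bar>ereal_ln (measure (K z) ?B) - ereal_ln (measure (K z') ?B)\<bar> \<le> variation K n"
      by (rule variation_upper[where z=z and z'=z' and n=n and K=K, OF z agree B p])
    then have le: "\<bar>ereal_ln (measure (K z) ?B) - ereal_ln (measure (K z') ?B)\<bar> \<le> ereal c" using var by simp
    then have n0: "measure (K z') ?B \<noteq> 0" using p by (auto simp: ereal_ln_def)
    then have p': "0 < measure (K z') ?B" by (simp add: zero_less_measure_iff)
    have "ln (measure (K z) ?B) - ln (measure (K z') ?B) \<le> c"
      using le p p' by (simp add: ereal_ln_def)
    then have "ln (measure (K z) ?B) \<le> ln (exp c * measure (K z') ?B)" using p' by (simp add: ln_mult)
    then show ?thesis using p p' by (subst (asm) ln_le_cancel_iff) auto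
  qed simp
  then have "ennreal (measure (K z) ?B) \<le> ennreal (exp c * measure (K z') ?B)" by (rule ennreal_leI)
  then show ?thesis by (simp add: step_prob_def z.emeasure_eq_measure z'.emeasure_eq_measure ennreal_mult)
qed

text \<open>
  After \<open>i\<close> steps the two pasts agree on \<open>i\<close> more coordinates, so the \<open>i\<close>-th factors differ at most by the
  factor \<open>exp (c (n + i))\<close>.
\<close>

lemma word_prob_variation:
  assumes K: "regular_version \<nu> K" and var: "\<And>n. variation K n \<le> ereal (c n)"
  shows "z \<in> space past_space \<Longrightarrow> z' \<in> space past_space \<Longrightarrow> (\<And>k. - int n < k \<Longrightarrow> k \<le> 0 \<Longrightarrow> z k = z' k) \<Longrightarrow>
    word_prob K z a \<le> ennreal (exp (\<Sum>i<length a. c (n + i))) * word_prob K z' a"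
proof (induction a arbitrary: z z' n)
  case (Cons b a)
  have s: "step_prob K z b \<le> ennreal (exp (c n)) * step_prob K z' b"
    by (rule step_prob_variation[OF K Cons.prems var])
  have "word_prob K (append_letter z b) a \<le> ennreal (exp (\<Sum>i<length a. c (Suc n + i))) * word_prob K (append_letter z' b) a"
  proof (rule Cons.IH[OF append_letter_in_space append_letter_in_space])
    fix k assume "- int (Suc n) < k" "k \<le> 0"
    then show "append_letter z b k = append_letter z' b k"
      using Cons.prems(3)[of "k + 1"] by (auto simp: append_letter_def)
  qed
  from mult_mono[OF s this]
  have "word_prob K z (b # a) \<le> (ennreal (exp (c n)) * step_prob K z' b) * (ennreal (exp (\<Sum>i<length a. c (Suc n + i))) * word_prob K (append_letter z' b) a)"
    by simp
  also have "\<dots> = (ennreal (exp (c n)) * ennreal (exp (\<Sum>i<length a. c (Suc n + i)))) * word_prob K z' (b # a)"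
    by (simp add: ac_simps)
  also have "ennreal (exp (c n)) * ennreal (exp (\<Sum>i<length a. c (Suc n + i))) = ennreal (exp (\<Sum>i<length (b # a). c (n + i)))"
    by (simp add: ennreal_mult[symmetric] exp_add[symmetric] sum.lessThan_Suc_shift del: sum.lessThan_Suc)
  finally show ?case .
qed simp

text \<open>
  The defining property of the conditional law, extended from sets of pasts to functions of the past.
\<close>

lemma nn_integral_first_letter:
  fixes \<nu> :: "(int \<Rightarrow> 'e::finite) measure"
  assumes \<nu>: "\<nu> \<in> inv_laws UNIV" and K: "regular_version \<nu> K" and F: "F \<in> borel_measurable past_space"
  shows "(\<integral>\<^sup>+x. F (past x) * indicator {x. x 1 = b} x \<partial>\<nu>) = (\<integral>\<^sup>+x. F (past x) * step_prob K (past x) b \<partial>\<nu>)"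
proof -
  have s: "sets \<nu> = sets (seq_space UNIV)" by (rule inv_lawsD[OF \<nu>])
  have sp: "space \<nu> = UNIV" using inv_lawsD(4)[OF \<nu>] by (simp add: seq_space_def space_PiM)
  have pm: "past \<in> measurable \<nu> past_space" using measurable_past s by (simp cong: measurable_cong_sets)
  have "(\<lambda>x. x 1) \<in> measurable (seq_space (UNIV :: 'e set)) (count_space UNIV)"
    unfolding seq_space_def by (rule measurable_component_singleton) simp
  then have "(\<lambda>x. x 1) -` {b} \<inter> space (seq_space UNIV) \<in> sets (seq_space UNIV)" by (rule measurable_sets) simp
  then have E: "{x. x 1 = b} \<in> sets \<nu>" by (simp add: s seq_space_def space_PiM vimage_def)
  let ?M1 = "distr (density \<nu> (indicator {x. x 1 = b})) past_space past"
  let ?M2 = "density (distr \<nu> past_space past) (\<lambda>z. step_prob K z b)"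
  have pd: "past \<in> measurable (density \<nu> (indicator {x. x 1 = b})) past_space" using pm by simp
  have "?M1 = ?M2"
  proof (rule measure_eqI)
    fix X assume "X \<in> sets ?M1"
    then have X: "X \<in> sets past_space" by simp
    have PX: "past -` X \<in> sets \<nu>" using measurable_sets[OF pm X] by (simp add: sp)
    have "emeasure ?M1 X = emeasure (density \<nu> (indicator {x. x 1 = b})) (past -` X)"
      using X pd by (simp add: emeasure_distr sp)
    also have "\<dots> = (\<integral>\<^sup>+x. indicator {x. x 1 = b} x * indicator (past -` X) x \<partial>\<nu>)"
      by (rule emeasure_density) (use PX E in simp_all)
    also have "\<dots> = (\<integral>\<^sup>+x. indicator ({x. x 1 = b} \<inter> past -` X) x \<partial>\<nu>)"
      by (rule nn_integral_cong) (auto split: split_indicator)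
    also have "\<dots> = emeasure \<nu> ({x. x 1 = b} \<inter> past -` X)" using PX E by (intro nn_integral_indicator) auto
    also have "{x. x 1 = b} \<inter> past -` X = {x \<in> space \<nu>. restrict x {..0} \<in> X \<and> restrict x {0<..} \<in> first_letter b}"
    proof -
      have "restrict x {0<..} \<in> first_letter b \<longleftrightarrow> x 1 = b" for x :: "int \<Rightarrow> 'e"
        by (simp add: first_letter_def future_space_def space_PiM)
      then show ?thesis by (simp add: sp past_def set_eq_iff conj_commute)
    qed
    also have "emeasure \<nu> \<dots> = (\<integral>\<^sup>+z\<in>X. emeasure (K z) (first_letter b) \<partial>(distr \<nu> past_space (\<lambda>x. restrict x {..0})))"
      by (rule conjunct2[OF K[unfolded regular_version_def], rule_format, OF X first_letter_sets])
    also have "\<dots> = emeasure ?M2 X"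
      using X measurable_step_prob[OF K, of b]
      by (subst emeasure_density) (auto simp: step_prob_def past_def[abs_def])
    finally show "emeasure ?M1 X = emeasure ?M2 X" .
  qed simp
  then have "(\<integral>\<^sup>+z. F z \<partial>?M1) = (\<integral>\<^sup>+z. F z \<partial>?M2)" by simp
  moreover have "(\<integral>\<^sup>+z. F z \<partial>?M1) = (\<integral>\<^sup>+x. F (past x) * indicator {x. x 1 = b} x \<partial>\<nu>)"
  proof -
    have Fp: "(\<lambda>x. F (past x)) \<in> borel_measurable \<nu>" by (rule measurable_compose[OF pm F])
    have "(\<integral>\<^sup>+z. F z \<partial>?M1) = (\<integral>\<^sup>+x. F (past x) \<partial>density \<nu> (indicator {x. x 1 = b}))"
      by (rule nn_integral_distr[OF pd]) (simp add: F)
    also have "\<dots> = (\<integral>\<^sup>+x. indicator {x. x 1 = b} x * F (past x) \<partial>\<nu>)"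
      by (rule nn_integral_density) (use E Fp in auto)
    finally show ?thesis by (simp add: mult.commute)
  qed
  moreover have "(\<integral>\<^sup>+z. F z \<partial>?M2) = (\<integral>\<^sup>+x. F (past x) * step_prob K (past x) b \<partial>\<nu>)"
  proof -
    have gm: "(\<lambda>z. step_prob K z b) \<in> borel_measurable past_space" by (rule measurable_step_prob[OF K])
    have "(\<integral>\<^sup>+z. F z \<partial>?M2) = (\<integral>\<^sup>+z. step_prob K z b * F z \<partial>distr \<nu> past_space past)"
      by (rule nn_integral_density) (use F gm in auto)
    also have "\<dots> = (\<integral>\<^sup>+x. step_prob K (past x) b * F (past x) \<partial>\<nu>)"
      by (rule nn_integral_distr[OF pm]) (use F gm in auto)
    finally show ?thesis by (simp add: mult.commute)
  qed
  ultimately show ?thesis by simp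
qed

lemma nn_integral_left_shift:
  assumes Q: "Q \<in> inv_laws A" and h: "h \<in> borel_measurable (seq_space A)"
  shows "(\<integral>\<^sup>+x. h (left_shift x) \<partial>Q) = (\<integral>\<^sup>+x. h x \<partial>Q)"
proof -
  have m: "left_shift \<in> measurable Q (seq_space A)"
    using left_shift_measurable inv_lawsD(1)[OF Q] by (simp cong: measurable_cong_sets)
  have "(\<integral>\<^sup>+x. h x \<partial>Q) = (\<integral>\<^sup>+x. h x \<partial>distr Q (seq_space A) left_shift)"
    by (simp add: inv_lawsD(3)[OF Q])
  also have "\<dots> = (\<integral>\<^sup>+x. h (left_shift x) \<partial>Q)" by (rule nn_integral_distr[OF m]) (simp add: h)
  finally show ?thesis by simp
qed

lemma measurable_window_indicator:
  "(\<lambda>x. indicator {x. map x js = a} x :: ennreal) \<in> borel_measurable (seq_space (UNIV :: 'e::countable set))"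
proof -
  have eq: "(\<lambda>x. indicator {x. map x js = a} x :: ennreal) = (\<lambda>x. indicator {a} (map x js))"
    by (auto simp: fun_eq_iff split: split_indicator)
  show ?thesis unfolding eq by (rule measurable_compose[OF measurable_window]) simp
qed

text \<open>
  The chain rule is an induction on the string, with the test function of the past generalised. The
  first letter is moved into the past by a shift, the induction hypothesis is applied there, and after
  shifting back the letter is the next one, to which the conditional law applies.
\<close>

lemma nn_integral_word:
  fixes \<nu> :: "(int \<Rightarrow> 'e::finite) measure"
  assumes \<nu>: "\<nu> \<in> inv_laws UNIV" and K: "regular_version \<nu> K"
  shows "F \<in> borel_measurable past_space \<Longrightarrow>
    (\<integral>\<^sup>+x. F (past x) * indicator {x. map x [1..int (length a)] = a} x \<partial>\<nu>) = (\<integral>\<^sup>+x. F (past x) * word_prob K (past x) a \<partial>\<nu>)"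
proof (induction a arbitrary: F)
  case Nil
  then show ?case by simp
next
  case (Cons b a)
  let ?n = "int (length a)"
  have comp0: "(\<lambda>z. indicator {z. z 0 = b} z :: ennreal) \<in> borel_measurable past_space"
  proof -
    have eq: "(\<lambda>z. indicator {z. z 0 = b} z :: ennreal) = (\<lambda>z. indicator {b} (z 0))"
      by (auto simp: fun_eq_iff split: split_indicator)
    show ?thesis unfolding eq by (rule measurable_compose[OF measurable_past_component]) simp_all
  qed
  define F' where "F' z = F (drop_letter z) * indicator {z. z 0 = b} z" for z
  have F': "F' \<in> borel_measurable past_space"
    unfolding F'_def[abs_def] using measurable_compose[OF measurable_drop_letter Cons.prems] comp0 by measurable
  have ds: "drop_letter (past (left_shift x)) = past x" for x :: "int \<Rightarrow> 'e"
    by (auto simp: fun_eq_iff drop_letter_def past_def left_shift_def)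
  have win: "map (left_shift x) [1..?n] = a \<and> x 1 = b \<longleftrightarrow> map x [1..int (length (b # a))] = b # a" for x
  proof -
    have "[1..int (length (b # a))] = 1 # [1 + 1..?n + 1]"
      by (subst upto.simps) (simp add: add.commute)
    moreover have "map (left_shift x) [1..?n] = map x [1 + 1..?n + 1]"
      unfolding left_shift_def by (rule map_upto_shift)
    ultimately show ?thesis by auto
  qed
  define h where "h x = F' (past x) * indicator {x. map x [1..?n] = a} x" for x
  have h: "h \<in> borel_measurable (seq_space UNIV)"
    unfolding h_def[abs_def] using measurable_compose[OF measurable_past F'] measurable_window_indicator by measurable
  define k where "k x = F' (past x) * word_prob K (past x) a" for x
  have k: "k \<in> borel_measurable (seq_space UNIV)"
    unfolding k_def[abs_def] using measurable_compose[OF measurable_past F'] measurable_compose[OF measurable_past measurable_word_prob[OF K]] by measurable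
  have ap: "append_letter (past x) b = past (left_shift x)" if "x 1 = b" for x
    using that by (auto simp: fun_eq_iff append_letter_def past_def left_shift_def)
  have "(\<integral>\<^sup>+x. F (past x) * indicator {x. map x [1..int (length (b # a))] = b # a} x \<partial>\<nu>) = (\<integral>\<^sup>+x. h (left_shift x) \<partial>\<nu>)"
  proof (rule nn_integral_cong)
    fix x :: "int \<Rightarrow> 'e"
    show "F (past x) * indicator {x. map x [1..int (length (b # a))] = b # a} x = h (left_shift x)"
    proof -
      have "past (left_shift x) 0 = x 1" by (simp add: past_def left_shift_def)
      then have "h (left_shift x) = F (past x) * (indicator {b} (x 1) * indicator {x. map x [1..?n] = a} (left_shift x))"
        by (simp add: h_def F'_def ds mult.assoc split: split_indicator)
      also have "indicator {b} (x 1) * indicator {x. map x [1..?n] = a} (left_shift x)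
          = (indicator {x. map x [1..int (length (b # a))] = b # a} x :: ennreal)"
        using win[of x] unfolding indicator_def mem_Collect_eq singleton_iff by (simp only: of_bool_conj[symmetric] conj_commute)
      finally show ?thesis by simp
    qed
  qed
  also have "\<dots> = (\<integral>\<^sup>+x. h x \<partial>\<nu>)" by (rule nn_integral_left_shift[OF \<nu> h])
  also have "\<dots> = (\<integral>\<^sup>+x. k x \<partial>\<nu>)" unfolding h_def k_def by (rule Cons.IH[OF F'])
  also have "\<dots> = (\<integral>\<^sup>+x. k (left_shift x) \<partial>\<nu>)" by (rule nn_integral_left_shift[OF \<nu> k, symmetric])
  also have "\<dots> = (\<integral>\<^sup>+x. (F (past x) * word_prob K (append_letter (past x) b) a) * indicator {x. x 1 = b} x \<partial>\<nu>)"
  proof (rule nn_integral_cong)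
    fix x :: "int \<Rightarrow> 'e"
    have "past (left_shift x) 0 = x 1" by (simp add: past_def left_shift_def)
    then show "k (left_shift x) = (F (past x) * word_prob K (append_letter (past x) b) a) * indicator {x. x 1 = b} x"
      by (auto simp: k_def F'_def ds ap split: split_indicator)
  qed
  also have "\<dots> = (\<integral>\<^sup>+x. (F (past x) * word_prob K (append_letter (past x) b) a) * step_prob K (past x) b \<partial>\<nu>)"
  proof (rule nn_integral_first_letter[OF \<nu> K, where F="\<lambda>z. F z * word_prob K (append_letter z b) a"])
    show "(\<lambda>z. F z * word_prob K (append_letter z b) a) \<in> borel_measurable past_space"
      using Cons.prems measurable_compose[OF measurable_append_letter measurable_word_prob[OF K]] by measurable
  qed
  also have "\<dots> = (\<integral>\<^sup>+x. F (past x) * word_prob K (past x) (b # a) \<partial>\<nu>)"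
    by (rule nn_integral_cong) (simp add: ac_simps)
  finally show ?case .
qed

lemma cyl_window:
  fixes \<nu> :: "(int \<Rightarrow> 'e::countable) measure"
  assumes \<nu>: "\<nu> \<in> inv_laws UNIV"
  shows "ennreal (cyl \<nu> u) = (\<integral>\<^sup>+x. indicator {x. map x [j + 1..j + int (length u)] = u} x \<partial>\<nu>)"
proof -
  have "ennreal (cyl \<nu> u) = emeasure (measure_pmf (block_law (length u) \<nu>)) {u}"
    by (simp add: cyl_def emeasure_pmf_single)
  also have "\<dots> = emeasure (distr \<nu> (count_space UNIV) (\<lambda>y. map y [j + 1..j + int (length u)])) {u}"
    by (simp add: measure_pmf_block_law[OF \<nu>] distr_window[OF \<nu>])
  also have "\<dots> = (\<integral>\<^sup>+w. indicator {u} w \<partial>distr \<nu> (count_space UNIV) (\<lambda>y. map y [j + 1..j + int (length u)]))"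
    by (rule nn_integral_indicator[symmetric]) simp
  also have "\<dots> = (\<integral>\<^sup>+x. indicator {u} (map x [j + 1..j + int (length u)]) \<partial>\<nu>)"
    by (rule nn_integral_distr[OF measurable_window_inv(1)[OF \<nu>]]) simp
  also have "\<dots> = (\<integral>\<^sup>+x. indicator {x. map x [j + 1..j + int (length u)] = u} x \<partial>\<nu>)"
    by (rule nn_integral_cong) (auto split: split_indicator)
  finally show ?thesis .
qed

text \<open>
  The probabilities of a string given two pasts differ at most by a fixed factor. Averaging over one of
  the pasts compares them with the unconditional probability, and averaging over pasts that end in \<open>u\<close>
  gives the claim.
\<close>

theorem summable_variation_quasi_bernoulli:
  fixes \<nu> :: "(int \<Rightarrow> 'e::finite) measure"
  assumes \<nu>: "\<nu> \<in> inv_laws UNIV" and sv: "summable_variation \<nu>"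
  obtains C where "quasi_bernoulli UNIV \<nu> C"
proof -
  obtain K where K: "regular_version \<nu> K" and fin: "(\<Sum>n. variation K n) < \<infinity>"
    using sv unfolding summable_variation_def by blast
  note nn = variation_nonneg[OF K]
  define S where "S = (\<Sum>n. variation K n)"
  have sums: "(\<Sum>i<n. variation K i) \<le> S" for n
    unfolding S_def by (rule sum_le_suminf) (auto intro: summable_ereal_pos nn)
  have S0: "0 \<le> S" using sums[of 0] by simp
  obtain s where s: "S = ereal s" "0 \<le> s" using fin S0 unfolding S_def[symmetric] by (cases S) auto
  have le1: "variation K n \<le> S" for n
  proof -
    have "variation K n \<le> (\<Sum>i<Suc n. variation K i)"
      by (simp add: add_increasing sum_nonneg nn)
    then show ?thesis using sums order_trans by blast
  qed
  define c where "c n = real_of_ereal (variation K n)" for n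
  have vc: "variation K n = ereal (c n)" for n
    using le1[of n] nn[of n] s by (cases "variation K n") (auto simp: c_def)
  have cs: "(\<Sum>i<n. c i) \<le> s" for n
    using sums[of n] by (simp add: vc s sum_ereal)
  \<comment> \<open>One more than the sum of the variations, to make the constant positive.\<close>
  define C where "C = s + 1"
  have wp: "word_prob K z a \<le> ennreal (exp C) * word_prob K z' a" if "z \<in> space past_space" "z' \<in> space past_space" for z z' a
  proof -
    have "word_prob K z a \<le> ennreal (exp (\<Sum>i<length a. c (0 + i))) * word_prob K z' a"
      by (rule word_prob_variation[OF K]) (use that vc in auto)
    also have "\<dots> \<le> ennreal (exp C) * word_prob K z' a"
      using cs[of "length a"] by (intro mult_right_mono ennreal_leI) (auto simp: C_def)
    finally show ?thesis .
  qed
  have ps: "prob_space \<nu>" by (rule inv_lawsD[OF \<nu>])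
  have pm: "past \<in> measurable \<nu> past_space"
    using measurable_past inv_lawsD(1)[OF \<nu>] by (simp cong: measurable_cong_sets)
  have wm: "(\<lambda>x. word_prob K (past x) a) \<in> borel_measurable \<nu>" for a
    by (rule measurable_compose[OF pm measurable_word_prob[OF K]])
  have cw: "ennreal (cyl \<nu> a) = (\<integral>\<^sup>+x. word_prob K (past x) a \<partial>\<nu>)" for a
    using cyl_window[OF \<nu>, of a 0] nn_integral_word[OF \<nu> K, of "\<lambda>_. 1" a] by simp
  have up: "word_prob K z a \<le> ennreal (exp C) * ennreal (cyl \<nu> a)" if z: "z \<in> space past_space" for z a
  proof -
    have "word_prob K z a = (\<integral>\<^sup>+x. word_prob K z a \<partial>\<nu>)" using prob_space.emeasure_space_1[OF ps] by simp
    also have "\<dots> \<le> (\<integral>\<^sup>+x. ennreal (exp C) * word_prob K (past x) a \<partial>\<nu>)"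
      by (intro nn_integral_mono wp z past_in_space)
    also have "\<dots> = ennreal (exp C) * ennreal (cyl \<nu> a)" unfolding cw by (rule nn_integral_cmult[OF wm])
    finally show ?thesis .
  qed
  have low: "ennreal (cyl \<nu> a) \<le> ennreal (exp C) * word_prob K z a" if z: "z \<in> space past_space" for z a
  proof -
    have "ennreal (cyl \<nu> a) \<le> (\<integral>\<^sup>+x. ennreal (exp C) * word_prob K z a \<partial>\<nu>)"
      unfolding cw by (intro nn_integral_mono wp z past_in_space)
    then show ?thesis using prob_space.emeasure_space_1[OF ps] by simp
  qed
  have split: "ennreal (cyl \<nu> (u @ a)) = (\<integral>\<^sup>+x. indicator {x. map x [- int (length u) + 1..0] = u} x * word_prob K (past x) a \<partial>\<nu>)"
    and mass: "ennreal (cyl \<nu> u) = (\<integral>\<^sup>+x. indicator {x. map x [- int (length u) + 1..0] = u} x \<partial>\<nu>)" for u a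
  proof -
    let ?js = "[- int (length u) + 1..0]"
    have pw: "map (past x) ?js = map x ?js" for x :: "int \<Rightarrow> 'e" by (auto simp: past_def)
    define F where "F z = (indicator {u} (map z ?js) :: ennreal)" for z
    have F: "F \<in> borel_measurable past_space"
    proof -
      have "(\<lambda>z. map z js) \<in> measurable past_space (count_space (UNIV :: 'e list set))" if "set js \<subseteq> {..0}" for js
        using that
      proof (induction js)
        case (Cons k js)
        have 1: "(\<lambda>z. z k) \<in> measurable past_space (count_space (UNIV :: 'e set))"
          by (rule measurable_past_component) (use Cons in auto)
        have "(\<lambda>z. (z k # map z js)) \<in> measurable past_space (count_space (UNIV :: 'e list set))"
          by (rule measurable_compose_countable[OF _ 1, where f="\<lambda>a z. a # map z js"])
             (rule measurable_compose[OF Cons.IH], use Cons.prems in auto)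
        then show ?case by simp
      qed simp
      then have "(\<lambda>z. map z ?js) \<in> measurable past_space (count_space (UNIV :: 'e list set))" by auto
      then show ?thesis unfolding F_def[abs_def] by (rule measurable_compose) simp
    qed
    have Fp: "F (past x) = indicator {x. map x ?js = u} x" for x
      unfolding F_def pw by (auto split: split_indicator)
    have e: "map x [- int (length u) + 1..- int (length u) + int (length (u @ a))] = u @ a
      \<longleftrightarrow> map x ?js = u \<and> map x [1..int (length a)] = a" for x
    proof -
      have "[- int (length u) + 1..- int (length u) + int (length (u @ a))] = ?js @ [1..int (length a)]"
        using upto_split2[of "- int (length u) + 1" 0 "int (length a)"] by (cases u) simp_all
      then show ?thesis by simp
    qed
    have "ennreal (cyl \<nu> (u @ a)) = (\<integral>\<^sup>+x. F (past x) * indicator {x. map x [1..int (length a)] = a} x \<partial>\<nu>)"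
      unfolding cyl_window[OF \<nu>, of "u @ a" "- int (length u)"] e Fp
      by (rule nn_integral_cong) (auto split: split_indicator)
    also have "\<dots> = (\<integral>\<^sup>+x. F (past x) * word_prob K (past x) a \<partial>\<nu>)" by (rule nn_integral_word[OF \<nu> K F])
    finally show "ennreal (cyl \<nu> (u @ a)) = (\<integral>\<^sup>+x. indicator {x. map x ?js = u} x * word_prob K (past x) a \<partial>\<nu>)"
      unfolding Fp .
    show "ennreal (cyl \<nu> u) = (\<integral>\<^sup>+x. indicator {x. map x ?js = u} x \<partial>\<nu>)"
      using cyl_window[OF \<nu>, of u "- int (length u)"] by simp
  qed
  have im: "(\<lambda>x. indicator {x. map x [- int (length u) + 1..0] = u} x :: ennreal) \<in> borel_measurable \<nu>" for u
    using measurable_window_indicator inv_lawsD(1)[OF \<nu>] by (simp cong: measurable_cong_sets)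
  show ?thesis
  proof (rule that, unfold_locales)
    show "\<nu> \<in> inv_laws UNIV" by fact
    show "0 < C" using s by (simp add: C_def)
    fix u v :: "'e list"
    have "ennreal (cyl \<nu> (u @ v)) \<le> (\<integral>\<^sup>+x. indicator {x. map x [- int (length u) + 1..0] = u} x * (ennreal (exp C) * ennreal (cyl \<nu> v)) \<partial>\<nu>)"
      unfolding split by (intro nn_integral_mono mult_left_mono up past_in_space) simp
    also have "\<dots> = ennreal (cyl \<nu> u) * (ennreal (exp C) * ennreal (cyl \<nu> v))"
      unfolding mass by (rule nn_integral_multc[OF im])
    also have "\<dots> = ennreal (exp C * (cyl \<nu> u * cyl \<nu> v))"
      by (simp add: ennreal_mult cyl_nonneg ac_simps)
    finally show "cyl \<nu> (u @ v) \<le> exp C * (cyl \<nu> u * cyl \<nu> v)"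
      by (subst (asm) ennreal_le_iff) (auto intro!: mult_nonneg_nonneg cyl_nonneg)
    have "ennreal (cyl \<nu> u * cyl \<nu> v) = ennreal (cyl \<nu> u) * ennreal (cyl \<nu> v)" by (simp add: ennreal_mult cyl_nonneg)
    also have "\<dots> = (\<integral>\<^sup>+x. indicator {x. map x [- int (length u) + 1..0] = u} x * ennreal (cyl \<nu> v) \<partial>\<nu>)"
      unfolding mass by (rule nn_integral_multc[OF im, symmetric])
    also have "\<dots> \<le> (\<integral>\<^sup>+x. ennreal (exp C) * (indicator {x. map x [- int (length u) + 1..0] = u} x * word_prob K (past x) v) \<partial>\<nu>)"
    proof (rule nn_integral_mono)
      fix x
      show "indicator {x. map x [- int (length u) + 1..0] = u} x * ennreal (cyl \<nu> v)
        \<le> ennreal (exp C) * (indicator {x. map x [- int (length u) + 1..0] = u} x * word_prob K (past x) v)"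
        using low[OF past_in_space, of v x] by (auto split: split_indicator)
    qed
    also have "\<dots> = ennreal (exp C) * ennreal (cyl \<nu> (u @ v))"
      unfolding split by (rule nn_integral_cmult) (use im wm in measurable)
    also have "\<dots> = ennreal (exp C * cyl \<nu> (u @ v))" by (simp add: ennreal_mult cyl_nonneg)
    finally show "cyl \<nu> u * cyl \<nu> v \<le> exp C * cyl \<nu> (u @ v)"
      by (subst (asm) ennreal_le_iff) (auto intro!: mult_nonneg_nonneg cyl_nonneg)
  qed
qed

section \<open>The law of the word sequence\<close>

lemma length_word_seq: "length (word_seq (x, t) i) = t i"
  using renewal_time_step[of t i] by (simp add: word_seq_def)

lemma upto_concat: "a \<le> b \<Longrightarrow> b \<le> c \<Longrightarrow> [a + 1..b] @ [b + 1..c] = [a + 1..c :: int]"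
proof (cases "a = b")
  case False
  assume "a \<le> b" "b \<le> c"
  then show ?thesis using upto_split2[of "a + 1" b c] False by simp
qed simp

lemma renewal_time_mono: "renewal_time t a \<le> renewal_time t (a + int n)"
proof (induction n)
  case (Suc n)
  then show ?case using renewal_time_step[of t "a + int (Suc n)"] by (simp add: algebra_simps)
qed simp

lemma concat_word_seq:
  "concat (map (word_seq (x, t)) [a + 1..a + int n]) = map x [renewal_time t a + 1..renewal_time t (a + int n)]"
proof (induction n)
  case (Suc n)
  let ?b = "a + int n"
  have "[a + 1..a + int (Suc n)] = [a + 1..?b] @ [?b + 1]"
    using upto_rec2[of "a + 1" "a + int (Suc n)"] by (simp add: algebra_simps)
  then have "concat (map (word_seq (x, t)) [a + 1..a + int (Suc n)])
      = map x ([renewal_time t a + 1..renewal_time t ?b] @ [renewal_time t ?b + 1..renewal_time t (?b + 1)])"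
    using Suc by (simp add: word_seq_def)
  also have "[renewal_time t a + 1..renewal_time t ?b] @ [renewal_time t ?b + 1..renewal_time t (?b + 1)]
      = [renewal_time t a + 1..renewal_time t (?b + 1)]"
    by (rule upto_concat) (use renewal_time_mono[of t a n] renewal_time_mono[of t ?b 1] in auto)
  finally show ?case by (simp add: algebra_simps)
qed simp

lemma map_length_eqD:
  "map length us = map length vs \<Longrightarrow> (u, v) \<in> set (zip us vs) \<Longrightarrow> length u = length v"
  by (induction us vs rule: list_induct2') auto

text \<open>
  Words are determined by their lengths and their concatenation. The condition \<open>a \<le> 0 \<le> a + n\<close> says that
  the window touches the boundary between the sites 0 and 1, where the letter clock is pinned to 0; the
  lengths of the words to the left of it then determine the site \<open>s\<close> at which the letters of the window
  begin.
\<close>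

lemma word_window_iff:
  fixes a :: int
  assumes a: "a \<le> 0" "0 \<le> a + int n" and ws: "length ws = n"
  defines "s \<equiv> - int (length (concat (take (nat (- a)) ws)))"
  shows "map (word_seq (x, t)) [a + 1..a + int n] = ws \<longleftrightarrow>
    (\<forall>j\<in>{a + 1..a + int n}. t j = length (ws ! nat (j - a - 1))) \<and>
    map x [s + 1..s + int (length (concat ws))] = concat ws"
    (is "?l = ws \<longleftrightarrow> ?T \<and> ?X")
proof -
  have len: "length ?l = n" by simp
  have nth: "?l ! i = word_seq (x, t) (a + 1 + int i)" if "i < n" for i
    using that by simp
  have T: "?T \<longleftrightarrow> map length ?l = map length ws"
  proof -
    have "?T \<longleftrightarrow> (\<forall>i<n. t (a + 1 + int i) = length (ws ! i))"
    proof
      assume T: ?T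
      show "\<forall>i<n. t (a + 1 + int i) = length (ws ! i)"
      proof (intro allI impI)
        fix i assume "i < n"
        then have "a + 1 + int i \<in> {a + 1..a + int n}" by simp
        from T[rule_format, OF this] show "t (a + 1 + int i) = length (ws ! i)" by simp
      qed
    next
      assume R: "\<forall>i<n. t (a + 1 + int i) = length (ws ! i)"
      show ?T
      proof
        fix j assume j: "j \<in> {a + 1..a + int n}"
        then have "nat (j - a - 1) < n" "a + 1 + int (nat (j - a - 1)) = j" by auto
        with R show "t j = length (ws ! nat (j - a - 1))" by metis
      qed
    qed
    also have "\<dots> \<longleftrightarrow> map length ?l = map length ws"
      by (simp add: list_eq_iff_nth_eq ws length_word_seq)
    finally show ?thesis .
  qed
  have con: "concat ?l = map x [renewal_time t a + 1..renewal_time t (a + int n)]" by (rule concat_word_seq)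
  have start: "renewal_time t a = s \<and> renewal_time t (a + int n) = s + int (length (concat ws))"
    if "map length ?l = map length ws"
  proof -
    let ?k = "nat (- a)"
    have k: "?k \<le> n" "a + int ?k = 0" using a by auto
    have cl: "length (concat (take i ?l)) = length (concat (take i ws))" for i
      using that by (metis length_concat take_map)
    have tk: "take ?k ?l = map (word_seq (x, t)) [a + 1..a + int ?k]"
      using k a by (simp add: take_map take_upto)
    have "renewal_time t (a + int ?k) - renewal_time t a = int (length (concat (map (word_seq (x, t)) [a + 1..a + int ?k])))"
      unfolding concat_word_seq using renewal_time_mono[of t a ?k] by simp
    also have "\<dots> = int (length (concat (take ?k ws)))" by (simp only: tk[symmetric] cl)
    finally have 1: "renewal_time t a = s" unfolding k(2) renewal_time_0 s_def by linarith
    have "renewal_time t (a + int n) - renewal_time t a = int (length (concat ?l))"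
      unfolding concat_word_seq using renewal_time_mono[of t a n] by simp
    also have "\<dots> = int (length (concat ws))" using cl[of n] ws len by simp
    finally show ?thesis using 1 by simp
  qed
  show ?thesis
  proof
    assume eq: "?l = ws"
    then have ml: "map length ?l = map length ws" by simp
    then have "?X" using con start[OF ml] eq by simp
    with ml T show "?T \<and> ?X" by blast
  next
    assume TX: "?T \<and> ?X"
    then have ml: "map length ?l = map length ws" using T by blast
    have "concat ?l = concat ws" unfolding con using start[OF ml] TX by simp
    moreover have "\<forall>(u, v)\<in>set (zip ?l ws). length u = length v"
      using map_length_eqD[OF ml] by blast
    ultimately show "?l = ws" using len ws by (intro concat_injective) auto
  qed
qed

definition length_weight :: "nat measure \<Rightarrow> 'e list list \<Rightarrow> real" where
  "length_weight \<rho> ws = (\<Prod>w\<leftarrow>ws. measure \<rho> {length w})"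

lemma length_weight_append: "length_weight \<rho> (us @ vs) = length_weight \<rho> us * length_weight \<rho> vs"
  by (simp add: length_weight_def)

lemma length_weight_nonneg: "0 \<le> length_weight \<rho> ws"
  unfolding length_weight_def by (induction ws) auto

context
  fixes \<nu> :: "(int \<Rightarrow> 'e::finite) measure" and \<rho> :: "nat measure"
  assumes \<nu>: "\<nu> \<in> inv_laws UNIV" and \<rho>: "prob_space \<rho>" "sets \<rho> = sets (count_space {1..})"
begin

lemma prob_space_joint_law: "prob_space (joint_law \<nu> \<rho>)"
proof -
  interpret \<nu>: prob_space \<nu> by (rule inv_lawsD[OF \<nu>])
  interpret \<rho>: product_prob_space "\<lambda>_. \<rho>" UNIV by (rule product_prob_spaceI) (rule \<rho>)
  interpret R: prob_space "PiM UNIV (\<lambda>_ :: int. \<rho>)" by (rule \<rho>.prob_space_axioms)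
  interpret pair_prob_space \<nu> "PiM UNIV (\<lambda>_ :: int. \<rho>)" ..
  show ?thesis unfolding joint_law_def by (rule prob_space_axioms)
qed

lemma measurable_word_seq: "word_seq \<in> measurable (joint_law \<nu> \<rho>) (seq_space words)"
  by (rule word_seq_measurable[OF inv_lawsD(1)[OF \<nu>] \<rho>(2)])

text \<open>
  The probability does not depend on the position \<open>a\<close> of the window, because the letters are stationary
  and the word lengths identically distributed. This is the reason for the stationarity of the word
  law.
\<close>

lemma emeasure_word_window:
  assumes a: "a \<le> 0" "0 \<le> a + int n"
  shows "emeasure (distr (word_law \<nu> \<rho>) (count_space UNIV) (\<lambda>y. map y [a + 1..a + int n])) {ws}
    = (if length ws = n then ennreal (length_weight \<rho> ws * cyl \<nu> (concat ws)) else 0)"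
proof -
  interpret \<nu>: prob_space \<nu> by (rule inv_lawsD[OF \<nu>])
  interpret \<rho>: product_prob_space "\<lambda>_. \<rho>" "UNIV :: int set" by (rule product_prob_spaceI) (rule \<rho>)
  let ?js = "[a + 1..a + int n]" and ?J = "joint_law \<nu> \<rho>"
  have sp\<rho>: "space \<rho> = {1..}" using sets_eq_imp_space_eq[OF \<rho>(2)] by simp
  have sp\<nu>: "space \<nu> = UNIV" using inv_lawsD(4)[OF \<nu>] by (simp add: seq_space_def space_PiM)
  have m: "(\<lambda>\<omega>. map (word_seq \<omega>) ?js) \<in> measurable ?J (count_space UNIV)"
    using measurable_compose[OF measurable_word_seq measurable_window] .
  have e: "emeasure (distr (word_law \<nu> \<rho>) (count_space UNIV) (\<lambda>y. map y ?js)) {ws}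
      = emeasure ?J ((\<lambda>\<omega>. map (word_seq \<omega>) ?js) -` {ws} \<inter> space ?J)"
    unfolding word_law_def by (subst distr_distr[OF measurable_window measurable_word_seq]) (simp add: o_def emeasure_distr[OF m])
  show ?thesis
  proof (cases "length ws = n")
    case False
    then have "(\<lambda>\<omega>. map (word_seq \<omega>) ?js) -` {ws} \<inter> space ?J = {}" by auto
    then show ?thesis using e False by simp
  next
    case True
    define s where "s = - int (length (concat (take (nat (- a)) ws)))"
    let ?X = "{x. map x [s + 1..s + int (length (concat ws))] = concat ws}"
    let ?T = "{t \<in> space (PiM UNIV (\<lambda>_ :: int. \<rho>)). \<forall>j\<in>{a + 1..a + int n}. t j \<in> {length (ws ! nat (j - a - 1))} \<inter> {1..}}"
    have "(\<lambda>\<omega>. map (word_seq \<omega>) ?js) -` {ws} \<inter> space ?J = ?X \<times> ?T"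
    proof (rule set_eqI)
      fix \<omega> :: "(int \<Rightarrow> 'e) \<times> (int \<Rightarrow> nat)"
      obtain x t where \<omega>: "\<omega> = (x, t)" by force
      have "t j \<in> {1..}" if "t \<in> space (PiM UNIV (\<lambda>_ :: int. \<rho>))" for j using that by (auto simp: space_PiM sp\<rho>)
      then show "\<omega> \<in> (\<lambda>\<omega>. map (word_seq \<omega>) ?js) -` {ws} \<inter> space ?J \<longleftrightarrow> \<omega> \<in> ?X \<times> ?T"
        using word_window_iff[OF a True, of x t] unfolding \<omega> joint_law_def space_pair_measure s_def[symmetric] sp\<nu> by auto
    qed
    moreover have "?X \<in> sets \<nu>"
    proof -
      have "(\<lambda>x. map x [s + 1..s + int (length (concat ws))]) -` {concat ws} \<inter> space \<nu> \<in> sets \<nu>"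
        by (rule measurable_sets[OF measurable_window_inv(1)[OF \<nu>]]) simp
      then show ?thesis by (simp add: sp\<nu> vimage_def)
    qed
    moreover
    have ls: "{length (ws ! nat (j - a - 1))} \<inter> {1..} \<in> sets \<rho>" for j by (simp add: \<rho>(2))
    have "?T \<in> sets (PiM UNIV (\<lambda>_ :: int. \<rho>))"
    proof (rule sets.sets_Collect_finite_All)
      fix j :: int
      have "(\<lambda>t. t j) -` ({length (ws ! nat (j - a - 1))} \<inter> {1..}) \<inter> space (PiM UNIV (\<lambda>_ :: int. \<rho>)) \<in> sets (PiM UNIV (\<lambda>_ :: int. \<rho>))"
        by (rule measurable_sets[OF measurable_component_singleton[of j UNIV "\<lambda>_. \<rho>"] ls]) simp
      then show "{t \<in> space (PiM UNIV (\<lambda>_ :: int. \<rho>)). t j \<in> {length (ws ! nat (j - a - 1))} \<inter> {1..}} \<in> sets (PiM UNIV (\<lambda>_ :: int. \<rho>))"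
        by (simp only: vimage_def Int_def mem_Collect_eq conj_commute)
    qed simp
    ultimately have "emeasure ?J ((\<lambda>\<omega>. map (word_seq \<omega>) ?js) -` {ws} \<inter> space ?J)
        = emeasure \<nu> ?X * emeasure (PiM UNIV (\<lambda>_ :: int. \<rho>)) ?T"
      unfolding joint_law_def
      by (simp only: sigma_finite_measure.emeasure_pair_measure_Times[OF prob_space_imp_sigma_finite[OF \<rho>.prob_space_axioms]])
    also have "emeasure \<nu> ?X = ennreal (cyl \<nu> (concat ws))"
      unfolding cyl_window[OF \<nu>, of "concat ws" s] using \<open>?X \<in> sets \<nu>\<close> by (rule nn_integral_indicator[symmetric])
    also have "emeasure (PiM UNIV (\<lambda>_ :: int. \<rho>)) ?T = (\<Prod>j\<in>{a + 1..a + int n}. emeasure \<rho> ({length (ws ! nat (j - a - 1))} \<inter> {1..}))"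
      by (rule \<rho>.emeasure_PiM_Collect) (use ls in auto)
    also have "\<dots> = (\<Prod>j\<in>{a + 1..a + int n}. ennreal (measure \<rho> {length (ws ! nat (j - a - 1))}))"
    proof (rule prod.cong[OF refl])
      fix j
      let ?k = "length (ws ! nat (j - a - 1))"
      show "emeasure \<rho> ({?k} \<inter> {1..}) = ennreal (measure \<rho> {?k})"
      proof (cases "1 \<le> ?k")
        case True
        then have "{?k} \<inter> {1..} = {?k}" by auto
        then show ?thesis by (simp add: finite_measure.emeasure_eq_measure[OF prob_space.finite_measure[OF \<rho>(1)]])
      next
        case False
        then have k: "?k = 0" by linarith
        have "{0 :: nat} \<notin> sets \<rho>" by (simp add: \<rho>(2))
        then show ?thesis unfolding k by (simp add: measure_notin_sets)
      qed
    qed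
    also have "\<dots> = (\<Prod>i<n. ennreal (measure \<rho> {length (ws ! i)}))"
      by (rule prod.reindex_bij_witness[where i="\<lambda>i. a + 1 + int i" and j="\<lambda>j. nat (j - a - 1)"]) auto
    also have "\<dots> = ennreal (length_weight \<rho> ws)"
      unfolding length_weight_def using True
      by (simp add: prod_ennreal prod.list_conv_set_nth lessThan_atLeast0)
    finally show ?thesis unfolding e using True
      by (simp add: ennreal_mult cyl_nonneg length_weight_nonneg mult.commute)
  qed
qed

lemma word_law_in_inv_laws: "word_law \<nu> \<rho> \<in> inv_laws words"
proof -
  let ?P = "word_law \<nu> \<rho>"
  have s: "sets ?P = sets (seq_space words)" by (simp add: word_law_def)
  have ps: "prob_space ?P" unfolding word_law_def
    by (rule prob_space.prob_space_distr[OF prob_space_joint_law measurable_word_seq])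
  have shm: "left_shift \<in> measurable ?P (seq_space words)"
    unfolding measurable_cong_sets[OF s refl] by (rule left_shift_measurable)
  have wm: "(\<lambda>y. map y js) \<in> measurable ?P (count_space UNIV)" for js
    unfolding measurable_cong_sets[OF s refl] by (rule measurable_window)
  have "distr ?P (seq_space words) left_shift = ?P"
  proof (rule seq_measure_eqI)
    show "finite_measure (distr ?P (seq_space words) left_shift)"
      using prob_space.prob_space_distr[OF ps shm] by (rule prob_space.finite_measure)
    fix m :: nat assume m: "1 \<le> m"
    have "map (left_shift y) [- int m + 1..int m] = map y [- int m + 1 + 1..- int m + 1 + int (2 * m)]" for y :: "int \<Rightarrow> 'e list"
      unfolding left_shift_def map_upto_shift by (simp add: algebra_simps)
    then have "distr (distr ?P (seq_space words) left_shift) (count_space UNIV) (\<lambda>y. map y [- int m + 1..int m])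
        = distr ?P (count_space UNIV) (\<lambda>y. map y [(- int m + 1) + 1..(- int m + 1) + int (2 * m)])"
      by (subst distr_distr[OF measurable_window shm]) (simp only: o_def)
    also have "\<dots> = distr ?P (count_space UNIV) (\<lambda>y. map y [- int m + 1..- int m + int (2 * m)])"
    proof (rule measure_eqI_countable[where A=UNIV])
      fix ws :: "'e list list"
      show "emeasure (distr ?P (count_space UNIV) (\<lambda>y. map y [(- int m + 1) + 1..(- int m + 1) + int (2 * m)])) {ws}
          = emeasure (distr ?P (count_space UNIV) (\<lambda>y. map y [- int m + 1..- int m + int (2 * m)])) {ws}"
        by (subst (1 2) emeasure_word_window) (use m in auto)
    qed auto
    finally show "distr (distr ?P (seq_space words) left_shift) (count_space UNIV) (\<lambda>y. map y [- int m + 1..int m])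
        = distr ?P (count_space UNIV) (\<lambda>y. map y [- int m + 1..int m])" by simp
  qed (simp_all add: s)
  then show ?thesis using s ps by (simp add: inv_laws_def)
qed

lemma cyl_word_law: "cyl (word_law \<nu> \<rho>) ws = length_weight \<rho> ws * cyl \<nu> (concat ws)"
proof -
  have "ennreal (cyl (word_law \<nu> \<rho>) ws) = emeasure (measure_pmf (block_law (length ws) (word_law \<nu> \<rho>))) {ws}"
    by (simp add: cyl_def emeasure_pmf_single)
  also have "\<dots> = emeasure (distr (word_law \<nu> \<rho>) (count_space UNIV) (\<lambda>y. map y [0 + 1..0 + int (length ws)])) {ws}"
    by (simp add: measure_pmf_block_law[OF word_law_in_inv_laws] block_def[abs_def])
  also have "\<dots> = ennreal (length_weight \<rho> ws * cyl \<nu> (concat ws))" by (subst emeasure_word_window) auto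
  finally show ?thesis
    by (subst (asm) ennreal_inj) (auto intro!: mult_nonneg_nonneg cyl_nonneg length_weight_nonneg)
qed

text \<open>
  The weights of the lengths are multiplicative, so the property is inherited with the same constant.
\<close>

lemma quasi_bernoulli_word_law:
  assumes "quasi_bernoulli UNIV \<nu> C"
  shows "quasi_bernoulli words (word_law \<nu> \<rho>) C"
proof -
  interpret quasi_bernoulli UNIV \<nu> C by fact
  show ?thesis
  proof
    show "word_law \<nu> \<rho> \<in> inv_laws words" by (rule word_law_in_inv_laws)
    show "0 < C" by (rule C)
    fix us vs :: "'e list list"
    let ?w = "length_weight \<rho> us * length_weight \<rho> vs"
    have w: "0 \<le> ?w" by (intro mult_nonneg_nonneg length_weight_nonneg)
    show "cyl (word_law \<nu> \<rho>) (us @ vs) \<le> exp C * (cyl (word_law \<nu> \<rho>) us * cyl (word_law \<nu> \<rho>) vs)"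
      using mult_left_mono[OF cyl_upper[of "concat us" "concat vs"] w]
      by (simp add: cyl_word_law length_weight_append ac_simps)
    show "cyl (word_law \<nu> \<rho>) us * cyl (word_law \<nu> \<rho>) vs \<le> exp C * cyl (word_law \<nu> \<rho>) (us @ vs)"
      using mult_left_mono[OF cyl_lower[of "concat us" "concat vs"] w]
      by (simp add: cyl_word_law length_weight_append ac_simps)
  qed
qed

lemma empirical_eq_cyclic_law:
  fixes y :: "int \<Rightarrow> 'e list"
  assumes y: "y \<in> space (seq_space words)" and n: "0 < n"
  shows "empirical n y = cyclic_law words (block n y)"
proof (rule measure_eqI)
  let ?W = "seq_space words :: (int \<Rightarrow> 'e list) measure"
  have u: "block n y \<noteq> []" "set (block n y) \<subseteq> words"
    using n y by (auto simp: space_seq_space block_def)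
  show "sets (empirical n y) = sets (cyclic_law words (block n y))"
    by (simp add: empirical_def cyclic_law_def)
  fix B assume "B \<in> sets (empirical n y)"
  then have B: "B \<in> sets ?W" by (simp add: empirical_def)
  have orb: "(left_shift ^^ i) (periodic n y) = cyclic_orbit (block n y) i" for i
  proof
    fix k
    let ?r = "(k - 1 + int i) mod int n"
    have r: "0 \<le> ?r" "?r < int n" using n by auto
    have "(left_shift ^^ i) (periodic n y) k = y (?r + 1)"
      by (simp add: left_shift_funpow periodic_def algebra_simps)
    also have "\<dots> = cyclic_orbit (block n y) i k"
      using r by (simp add: cyclic_orbit_def block_def add.commute)
    finally show "(left_shift ^^ i) (periodic n y) k = cyclic_orbit (block n y) i k" .
  qed
  have ne: "{..<n} \<noteq> {}" using n by auto
  have "emeasure (cyclic_law words (block n y)) B = (\<integral>\<^sup>+z. indicator B z \<partial>cyclic_law words (block n y))"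
    using B by (simp add: cyclic_law_def)
  also have "\<dots> = (\<integral>\<^sup>+i. indicator B (cyclic_orbit (block n y) i) \<partial>pmf_of_set {..<n})"
    unfolding cyclic_law_def length_block
    by (rule nn_integral_distr[OF measurable_cyclic_orbit[OF u]]) (use B in simp)
  also have "\<dots> = (\<Sum>i<n. indicator B (cyclic_orbit (block n y) i)) / of_nat n"
    using ne by (simp add: nn_integral_pmf_of_set)
  also have "\<dots> = emeasure (empirical n y) B"
    unfolding emeasure_empirical[OF B] orb using B by (simp add: emeasure_return)
  finally show "emeasure (empirical n y) B = emeasure (cyclic_law words (block n y)) B" by simp
qed

lemma measure_empirical_law:
  assumes n: "0 < n" and G: "G \<in> sets (borel_of (weak_topology words))"
  shows "measure (empirical_law \<nu> \<rho> n) G = measure_pmf.prob (block_law n (word_law \<nu> \<rho>)) {u. cyclic_law words u \<in> G}"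
proof -
  let ?J = "joint_law \<nu> \<rho>"
  have bm: "block n \<in> measurable (seq_space words) (count_space (UNIV :: 'e list list set))"
    unfolding block_def[abs_def] by (rule measurable_window)
  have m: "(\<lambda>\<omega>. block n (word_seq \<omega>)) \<in> measurable ?J (count_space UNIV)"
    by (rule measurable_compose[OF measurable_word_seq bm])
  have "measure (empirical_law \<nu> \<rho> n) G = measure ?J ((\<lambda>\<omega>. empirical n (word_seq \<omega>)) -` G \<inter> space ?J)"
    unfolding empirical_law_def by (rule measure_distr[OF empirical_measurable[OF inv_lawsD(1)[OF \<nu>] \<rho>(2) n] G])
  also have "(\<lambda>\<omega>. empirical n (word_seq \<omega>)) -` G \<inter> space ?J = (\<lambda>\<omega>. block n (word_seq \<omega>)) -` {u. cyclic_law words u \<in> G} \<inter> space ?J"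
    using empirical_eq_cyclic_law[OF measurable_space[OF measurable_word_seq] n] by auto
  also have "measure ?J \<dots> = measure (distr ?J (count_space UNIV) (\<lambda>\<omega>. block n (word_seq \<omega>))) {u. cyclic_law words u \<in> G}"
    by (rule measure_distr[OF m, symmetric]) simp
  also have "distr ?J (count_space UNIV) (\<lambda>\<omega>. block n (word_seq \<omega>)) = measure_pmf (block_law n (word_law \<nu> \<rho>))"
    unfolding measure_pmf_block_law[OF word_law_in_inv_laws]
    unfolding word_law_def
    by (subst distr_distr[OF bm measurable_word_seq]) (simp add: o_def)
  finally show ?thesis .
qed

end

section \<open>The annealed large deviation principle\<close>

theorem theorem1p1:
  fixes \<nu> :: "(int \<Rightarrow> 'e::finite) measure" and \<rho> :: "nat measure"
  assumes "\<nu> \<in> inv_laws UNIV"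
    and "prob_space \<rho>" and "sets \<rho> = sets (count_space {1..})"
    and "summable_variation \<nu>"
  shows "(\<forall>Q \<in> inv_laws words. convergent (entropy_rate words Q (word_law \<nu> \<rho>)) \<and>
            0 \<le> specific_rel_entropy words Q (word_law \<nu> \<rho>)) \<and>
    LDP (weak_topology words) (empirical_law \<nu> \<rho>)
      (\<lambda>Q. specific_rel_entropy words Q (word_law \<nu> \<rho>)) \<and>
    lower_semicontinuous (weak_topology words)
      (\<lambda>Q. specific_rel_entropy words Q (word_law \<nu> \<rho>)) \<and>
    (\<forall>c::real. compactin (weak_topology words)
      {Q \<in> inv_laws words. specific_rel_entropy words Q (word_law \<nu> \<rho>) \<le> ereal c}) \<and>
    (\<forall>Q1 \<in> inv_laws words. \<forall>Q2 \<in> inv_laws words. \<forall>a \<in> {0..1}.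
      specific_rel_entropy words (mixture a Q1 Q2) (word_law \<nu> \<rho>) =
        ereal a * specific_rel_entropy words Q1 (word_law \<nu> \<rho>) +
        ereal (1 - a) * specific_rel_entropy words Q2 (word_law \<nu> \<rho>)) \<and>
    {Q \<in> inv_laws words. specific_rel_entropy words Q (word_law \<nu> \<rho>) = 0} = {word_law \<nu> \<rho>}"
proof -
  obtain C where "quasi_bernoulli UNIV \<nu> C"
    by (rule summable_variation_quasi_bernoulli[OF assms(1,4)])
  then interpret quasi_bernoulli words "word_law \<nu> \<rho>" C
    by (rule quasi_bernoulli_word_law[OF assms(1-3)])
  let ?T = "weak_topology (words :: 'e list set)" and ?I = "\<lambda>Q. specific_rel_entropy words Q (word_law \<nu> \<rho>)"
  have ts: "topspace ?T = inv_laws words" by (rule topspace_weak_topology)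
  have I: "?I Q = rate Q" if "Q \<in> inv_laws words" for Q by (rule specific_rel_entropy_eq_rate(2)[OF that])
  have sets_open: "G \<in> sets (borel_of ?T)" if "openin ?T G" for G
    unfolding borel_of_def using that openin_subset by (subst sets_measure_of) (auto intro: sigma_sets.Basic)
  have sets_closed: "K \<in> sets (borel_of ?T)" if "closedin ?T K" for K
  proof -
    have "topspace ?T - (topspace ?T - K) \<in> sets (borel_of ?T)"
      using that sets.compl_sets[OF sets_open[of "topspace ?T - K"]]
      by (simp add: closedin_def borel_of_def space_measure_of_conv)
    then show ?thesis using closedin_subset[OF that] by (simp add: double_diff)
  qed
  have ev: "eventually (\<lambda>n. ereal_ln (measure (empirical_law \<nu> \<rho> n) G) / ereal (real n)
      = ereal_ln (measure_pmf.prob (p n) {u. cyclic_law words u \<in> G}) / ereal (real n)) sequentially"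
    if "G \<in> sets (borel_of ?T)" for G
    using eventually_gt_at_top[of 0]
    by eventually_elim (simp add: measure_empirical_law[OF assms(1-3) _ that])
  have conv: "\<forall>Q \<in> inv_laws words. convergent (entropy_rate words Q (word_law \<nu> \<rho>)) \<and> 0 \<le> ?I Q"
    using specific_rel_entropy_eq_rate(1) rate_nonneg I by auto
  have ldp: "LDP ?T (empirical_law \<nu> \<rho>) ?I"
    unfolding LDP_def
  proof (intro conjI allI impI)
    fix G assume G: "openin ?T G"
    have "(INF Q\<in>G. ?I Q) = (INF Q\<in>G. rate Q)"
      using openin_subset[OF G] by (intro INF_cong refl I) (auto simp: ts)
    then show "- (INF Q\<in>G. ?I Q) \<le> liminf (\<lambda>n. ereal_ln (measure (empirical_law \<nu> \<rho> n) G) / ereal (real n))"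
      using lower_bound[OF G] by (simp add: Liminf_eq[OF ev[OF sets_open[OF G]]])
  next
    fix K assume K: "closedin ?T K"
    have "(INF Q\<in>K. ?I Q) = (INF Q\<in>K. rate Q)"
      using closedin_subset[OF K] by (intro INF_cong refl I) (auto simp: ts)
    then show "limsup (\<lambda>n. ereal_ln (measure (empirical_law \<nu> \<rho> n) K) / ereal (real n)) \<le> - (INF Q\<in>K. ?I Q)"
      using upper_bound[OF K] by (simp add: Limsup_eq[OF ev[OF sets_closed[OF K]]])
  qed
  have lsc: "lower_semicontinuous ?T ?I"
  proof -
    have "{Q \<in> topspace ?T. c < ?I Q} = {Q \<in> topspace ?T. c < rate Q}" for c
      using I by (auto simp: ts)
    then show ?thesis using rate_lsc by (simp add: lower_semicontinuous_def)
  qed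
  have level: "\<forall>c::real. compactin ?T {Q \<in> inv_laws words. ?I Q \<le> ereal c}"
  proof
    fix c :: real
    have "{Q \<in> inv_laws words. ?I Q \<le> ereal c} = {Q \<in> inv_laws words. rate Q \<le> ereal c}" using I by auto
    then show "compactin ?T {Q \<in> inv_laws words. ?I Q \<le> ereal c}" using compact_level_sets by simp
  qed
  have affine: "\<forall>Q1 :: (int \<Rightarrow> 'e list) measure \<in> inv_laws words. \<forall>Q2 \<in> inv_laws words. \<forall>a \<in> {0..1}.
      ?I (mixture a Q1 Q2) = ereal a * ?I Q1 + ereal (1 - a) * ?I Q2"
  proof (intro ballI)
    fix Q1 Q2 :: "(int \<Rightarrow> 'e list) measure" and a :: real assume Q: "Q1 \<in> inv_laws words" "Q2 \<in> inv_laws words" and a: "a \<in> {0..1}"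
    then have mix: "mixture a Q1 Q2 \<in> inv_laws words" by (intro mixture_in_inv_laws) auto
    have "rate (mixture a Q1 Q2) = ereal a * rate Q1 + ereal (1 - a) * rate Q2"
      using a by (intro rate_mix[OF mix Q] pmf_block_law_mixture[OF Q]) auto
    then show "?I (mixture a Q1 Q2) = ereal a * ?I Q1 + ereal (1 - a) * ?I Q2"
      by (simp add: I mix Q)
  qed
  have zero: "{Q \<in> inv_laws words. ?I Q = 0} = {word_law \<nu> \<rho>}"
    using I rate_eq_zero_iff P by auto
  show ?thesis using conv ldp lsc level affine zero by blast
qed

end
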